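(* Let $m\ge1$ be an integer, and let $\mathcal{T}_h$ be a polygonal mesh of a polygonal domain $\Omega\subset\mathbb{R}^2$ satisfying the shape-regularity conditions A1, A2 (with parameters $N,\sigma$), equipped with sampling nodes and element patches $S(K)$ satisfying Assumption A (with $\gamma:=2R/r$) and Assumption B (for degree $m$), all defined in the context. Then there exists a constant $C$ depending only on $N,\sigma,\gamma$ and $m$ such that for every $K\in\mathcal{T}_h$ and every $g\in H^{m+1}(S(K))$, $$\|g-\mathcal{R}_Kg\|_{L^2(K)}\le C\Lambda_m h_K d_K^m\,|g|_{H^{m+1}(S(K))},$$ $$\|\nabla(g-\mathcal{R}_Kg)\|_{L^2(K)}\le C\left(h_K^m+\Lambda_m d_K^m\right)|g|_{H^{m+1}(S(K))}.$$
   Context: Mesh. $\mathcal{T}_h$ is a partition of $\Omega$ into (closed, possibly non-convex) polygons $K$; $h_K$ is the diameter of $K$. There are an integer $N$, a number $\sigma>0$ and a compatible sub-decomposition $\widetilde{\mathcal{T}}_h$ of $\mathcal{T}_h$ (a conforming triangulation of $\Omega$ refining $\mathcal{T}_h$, so that every $K$ is a union of triangles of $\widetilde{\mathcal{T}}_h$) such that: A1: every $K\in\mathcal{T}_h$ is a union of at most $N$ triangles $T\in\widetilde{\mathcal{T}}_h$; A2: every $T\in\widetilde{\mathcal{T}}_h$ satisfies $h_T/\rho_T\le\sigma$, where $h_T$ is the diameter of $T$ and $\rho_T$ is the radius of the largest disk inscribed in $T$. Patches and nodes. Each $K\in\mathcal{T}_h$ has a sampling node $x_K\in K$ and an element patch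 $S(K)$, an agglomeration of elements of $\mathcal{T}_h$ containing $K$. $\mathcal{I}(K)$ is the set of sampling nodes of the elements in $S(K)$, $\#\mathcal{I}(K)$ is its cardinality, and $d_K=\operatorname{diam}S(K)$. Assumption A: there are $R\ge 2r>0$, the same for all $K\in\mathcal{T}_h$, such that for every $K$ there are disks $B_r$, $B_R$ of radii $r$, $R$ with $B_r\subset S(K)\subset B_R$ and $S(K)$ star-shaped with respect to $B_r$. Assumption B: for every $K\in\mathcal{T}_h$ and every $p\in\mathbb{P}_m(S(K))$, $p|_{\mathcal{I}(K)}=0$ implies $p\equiv0$ on $S(K)$. Here $\mathbb{P}_m(D)$ is the set of polynomials in two variables of total degree at most $m$ restricted to $D$. Reconstruction. For $g$ continuous on $S(K)$ (every $g\in H^{m+1}(S(K))$ is identified with its continuous representative), $\mathcal{R}_Kg$ is the unique minimizer of $\sum_{x\in\mathcal{I}(K)}|g(x)-p(x)|^2$ over $p\in\mathbb{P}_m(S(K))$. Put $$\Lambda(m,\mathcal{I}(K))=\max_{0\ne p\in\mathbb{P}_m(S(K))}\frac{\|p\|_{L^\infty(S(K))}}{\max_{x\in\mathcal{I}(K)}|p(x)|},\qquad \Lambda_m=\max_{K\in\mathcal{T}_h}\left\{1+\Lambda(m,\mathcal{I}(K))\sqrt{\#\mathcal{I}(K)}\right\}.$$ *)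

theory Defs
  imports "HOL-Analysis.Analysis" "HOL-Probability.Essential_Supremum"
begin

section \<open>Polygonal meshes\<close>

text \<open>A polygonal domain may be multiply connected, and it need not lie on one side of its boundary.\<close>

definition polygonal_domain :: "(real^2) set \<Rightarrow> bool" where
  "polygonal_domain D \<longleftrightarrow> open D \<and> connected D \<and> bounded D \<and> D \<noteq> {} \<and>
     (\<exists>E. finite E \<and> (\<forall>e\<in>E. \<exists>a b. a \<noteq> b \<and> e = closed_segment a b) \<and> frontier D = \<Union>E)"

definition closed_polygon :: "(real^2) set \<Rightarrow> bool" where
  "closed_polygon K \<longleftrightarrow> (\<exists>D. polygonal_domain D \<and> K = closure D)"

definition polygonal_mesh :: "(real^2) set \<Rightarrow> (real^2) set set \<Rightarrow> bool" where
  "polygonal_mesh \<Omega> \<T> \<longleftrightarrow> finite \<T> \<and> (\<forall>K\<in>\<T>. closed_polygon K) \<and> \<Union>\<T> = closure \<Omega> \<and>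
     pairwise (\<lambda>K L. interior K \<inter> interior L = {}) \<T>"

text \<open>Conformity is part of the library's notion of a triangulation: the intersection of any two
  members is a (possibly empty) common face.\<close>

definition compatible_subdecomposition ::
    "(real^2) set \<Rightarrow> (real^2) set set \<Rightarrow> (real^2) set set \<Rightarrow> bool" where
  "compatible_subdecomposition \<Omega> \<T> \<T>' \<longleftrightarrow>
     triangulation \<T>' \<and> (\<forall>T\<in>\<T>'. 2 simplex T) \<and> \<Union>\<T>' = closure \<Omega> \<and>
     (\<forall>K\<in>\<T>. \<exists>F\<subseteq>\<T>'. K = \<Union>F)"

definition cond_A1 :: "nat \<Rightarrow> (real^2) set set \<Rightarrow> (real^2) set set \<Rightarrow> bool" where
  "cond_A1 N \<T> \<T>' \<longleftrightarrow> (\<forall>K\<in>\<T>. \<exists>F\<subseteq>\<T>'. card F \<le> N \<and> K = \<Union>F)"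

definition inradius :: "(real^2) set \<Rightarrow> real" where
  "inradius T = Sup {\<rho>. 0 \<le> \<rho> \<and> (\<exists>x. cball x \<rho> \<subseteq> T)}"

definition cond_A2 :: "real \<Rightarrow> (real^2) set set \<Rightarrow> bool" where
  "cond_A2 \<sigma> \<T>' \<longleftrightarrow> (\<forall>T\<in>\<T>'. diameter T / inradius T \<le> \<sigma>)"

section \<open>Sampling nodes and element patches\<close>

text \<open>A patch is given by the set \<open>patch K\<close> of elements that are agglomerated; the patch as a
  subset of the plane is \<open>S(K) = \<Union>(patch K)\<close>.\<close>

definition sampling_nodes :: "(real^2) set set \<Rightarrow> ((real^2) set \<Rightarrow> real^2) \<Rightarrow> bool" where
  "sampling_nodes \<T> node \<longleftrightarrow> (\<forall>K\<in>\<T>. node K \<in> K)"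

definition element_patches ::
    "(real^2) set set \<Rightarrow> ((real^2) set \<Rightarrow> (real^2) set set) \<Rightarrow> bool" where
  "element_patches \<T> patch \<longleftrightarrow> (\<forall>K\<in>\<T>. patch K \<subseteq> \<T> \<and> K \<in> patch K)"

definition patch_domain ::
    "((real^2) set \<Rightarrow> (real^2) set set) \<Rightarrow> (real^2) set \<Rightarrow> (real^2) set" where
  "patch_domain patch K = \<Union>(patch K)"

definition patch_nodes ::
    "((real^2) set \<Rightarrow> real^2) \<Rightarrow> ((real^2) set \<Rightarrow> (real^2) set set) \<Rightarrow> (real^2) set \<Rightarrow> (real^2) set" where
  "patch_nodes node patch K = node ` patch K"

definition star_shaped_wrt :: "(real^2) set \<Rightarrow> (real^2) set \<Rightarrow> bool" where
  "star_shaped_wrt S B \<longleftrightarrow> (\<forall>x\<in>S. convex hull (insert x B) \<subseteq> S)"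

definition assumption_A ::
    "real \<Rightarrow> real \<Rightarrow> (real^2) set set \<Rightarrow> ((real^2) set \<Rightarrow> (real^2) set set) \<Rightarrow> bool" where
  "assumption_A r R \<T> patch \<longleftrightarrow> R \<ge> 2 * r \<and> r > 0 \<and>
     (\<forall>K\<in>\<T>. \<exists>c c'. cball c r \<subseteq> patch_domain patch K \<and> patch_domain patch K \<subseteq> cball c' R \<and>
        star_shaped_wrt (patch_domain patch K) (cball c r))"

section \<open>Polynomials and the reconstruction\<close>

text \<open>Polynomials are functions on the whole plane. On a set with nonempty interior, such as every
  \<open>S(K)\<close>, a polynomial is determined by its restriction.\<close>

definition polys :: "nat \<Rightarrow> (real^2 \<Rightarrow> real) set" where
  "polys m = {p. \<exists>c :: nat \<Rightarrow> nat \<Rightarrow> real.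
     p = (\<lambda>x. \<Sum>(i,j)\<in>{(i,j). i + j \<le> m}. c i j * (x$1)^i * (x$2)^j)}"

definition assumption_B ::
    "nat \<Rightarrow> (real^2) set set \<Rightarrow> ((real^2) set \<Rightarrow> real^2) \<Rightarrow> ((real^2) set \<Rightarrow> (real^2) set set) \<Rightarrow> bool" where
  "assumption_B m \<T> node patch \<longleftrightarrow>
     (\<forall>K\<in>\<T>. \<forall>p\<in>polys m. (\<forall>x\<in>patch_nodes node patch K. p x = 0) \<longrightarrow>
        (\<forall>x\<in>patch_domain patch K. p x = 0))"

definition reconstruction :: "nat \<Rightarrow> (real^2) set \<Rightarrow> (real^2 \<Rightarrow> real) \<Rightarrow> (real^2 \<Rightarrow> real)" where
  "reconstruction m I g =
     (THE p. p \<in> polys m \<and> (\<forall>q\<in>polys m. (\<Sum>x\<in>I. \<bar>g x - p x\<bar>\<^sup>2) \<le> (\<Sum>x\<in>I. \<bar>g x - q x\<bar>\<^sup>2)))"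

definition Linf_norm :: "(real^2) set \<Rightarrow> (real^2 \<Rightarrow> real) \<Rightarrow> real" where
  "Linf_norm D f = real_of_ereal (esssup (lebesgue_on D) (\<lambda>x. ereal \<bar>f x\<bar>))"

text \<open>The supremum is a maximum whenever the nodes \<open>I\<close> are finitely many and unisolvent as in
  \<^const>\<open>assumption_B\<close>.\<close>

definition Lambda_nodes :: "nat \<Rightarrow> (real^2) set \<Rightarrow> (real^2) set \<Rightarrow> real" where
  "Lambda_nodes m I S =
     (SUP p\<in>{p\<in>polys m. \<exists>x\<in>S. p x \<noteq> 0}. Linf_norm S p / Max ((\<lambda>x. \<bar>p x\<bar>) ` I))"

definition Lambda_mesh ::
    "nat \<Rightarrow> (real^2) set set \<Rightarrow> ((real^2) set \<Rightarrow> real^2) \<Rightarrow> ((real^2) set \<Rightarrow> (real^2) set set) \<Rightarrow> real" where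
  "Lambda_mesh m \<T> node patch = Max ((\<lambda>K.
     1 + Lambda_nodes m (patch_nodes node patch K) (patch_domain patch K)
         * sqrt (real (card (patch_nodes node patch K)))) ` \<T>)"

section \<open>Sobolev spaces\<close>

definition partial_deriv :: "2 \<Rightarrow> (real^2 \<Rightarrow> real) \<Rightarrow> (real^2 \<Rightarrow> real)" where
  "partial_deriv i f = (\<lambda>x. frechet_derivative f (at x) (axis i 1))"

definition multi_deriv :: "nat \<times> nat \<Rightarrow> (real^2 \<Rightarrow> real) \<Rightarrow> (real^2 \<Rightarrow> real)" where
  "multi_deriv \<alpha> f = (partial_deriv 1 ^^ fst \<alpha>) ((partial_deriv 2 ^^ snd \<alpha>) f)"

definition smooth :: "(real^2 \<Rightarrow> real) \<Rightarrow> bool" where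
  "smooth f \<longleftrightarrow> (\<forall>is x. foldr partial_deriv is f differentiable (at x))"

definition test_functions :: "(real^2) set \<Rightarrow> (real^2 \<Rightarrow> real) set" where
  "test_functions D =
     {\<phi>. smooth \<phi> \<and> compact (closure {x. \<phi> x \<noteq> 0}) \<and> closure {x. \<phi> x \<noteq> 0} \<subseteq> D}"

definition L2 :: "(real^2) set \<Rightarrow> (real^2 \<Rightarrow> real) set" where
  "L2 D = {f. f \<in> borel_measurable (lebesgue_on D) \<and> integrable (lebesgue_on D) (\<lambda>x. (f x)\<^sup>2)}"

definition L2_norm :: "(real^2) set \<Rightarrow> (real^2 \<Rightarrow> 'a::real_normed_vector) \<Rightarrow> real" where
  "L2_norm D f = sqrt (LINT x|lebesgue_on D. (norm (f x))\<^sup>2)"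

definition has_weak_deriv ::
    "(real^2) set \<Rightarrow> nat \<times> nat \<Rightarrow> (real^2 \<Rightarrow> real) \<Rightarrow> (real^2 \<Rightarrow> real) \<Rightarrow> bool" where
  "has_weak_deriv D \<alpha> f v \<longleftrightarrow> f \<in> L2 D \<and> v \<in> L2 D \<and>
     (\<forall>\<phi>\<in>test_functions D.
        (LINT x|lebesgue_on D. f x * multi_deriv \<alpha> \<phi> x)
        = (-1) ^ (fst \<alpha> + snd \<alpha>) * (LINT x|lebesgue_on D. v x * \<phi> x))"

text \<open>Weak derivatives are unique up to a null set of \<open>D\<close>, so the choice is immaterial under integrals.\<close>

definition weak_deriv :: "(real^2) set \<Rightarrow> nat \<times> nat \<Rightarrow> (real^2 \<Rightarrow> real) \<Rightarrow> (real^2 \<Rightarrow> real)" where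
  "weak_deriv D \<alpha> f = (SOME v. has_weak_deriv D \<alpha> f v)"

definition weak_gradient :: "(real^2) set \<Rightarrow> (real^2 \<Rightarrow> real) \<Rightarrow> (real^2 \<Rightarrow> real^2)" where
  "weak_gradient D f = (\<lambda>x. vector [weak_deriv D (1,0) f x, weak_deriv D (0,1) f x])"

text \<open>A Sobolev space over a closed set such as \<open>S(K)\<close> is the one over its interior.\<close>

definition sobolev :: "nat \<Rightarrow> (real^2) set \<Rightarrow> (real^2 \<Rightarrow> real) set" where
  "sobolev k D = {f. f \<in> L2 (interior D) \<and>
     (\<forall>\<alpha>. fst \<alpha> + snd \<alpha> \<le> k \<longrightarrow> (\<exists>v. has_weak_deriv (interior D) \<alpha> f v))}"

definition sobolev_seminorm :: "nat \<Rightarrow> (real^2) set \<Rightarrow> (real^2 \<Rightarrow> real) \<Rightarrow> real" where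
  "sobolev_seminorm k D f =
     sqrt (\<Sum>\<alpha>\<in>{\<alpha>. fst \<alpha> + snd \<alpha> = k}. (L2_norm (interior D) (weak_deriv (interior D) \<alpha> f))\<^sup>2)"

end

theory Submission
  imports Defs
begin

text \<open>On a star-shaped patch \<open>S\<close> one subtracts from a smooth function the polynomial with the same
  mean derivatives up to order \<open>m\<close> on the ball. Iterating the Poincare inequality and applying a
  Sobolev inequality, both obtained by averaging Taylor expansions along segments that end in the
  ball, gives a Bramble--Hilbert estimate in the maximum norm and for the gradient in \<open>L\<^sup>2\<close>. It
  passes to \<open>H\<^bsup>m+1\<^esup>\<close> by mollification. The least squares reconstruction is stable in the
  maximum norm with constant \<open>\<Lambda>\<^sub>m\<close>, and an inverse estimate on the shape-regular triangles that
  make up \<open>K\<close> controls the gradient of the polynomial part of the error.\<close>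

subsection \<open>Polynomials of two variables\<close>

text \<open>The reconstruction samples point values, so the polynomial approximation error is needed
  in the maximum norm. In the plane, square integrable second derivatives control point values, and
  \<open>m \<ge> 1\<close> makes them available. The constant may see the patch only through
  \<gamma>, so no compactness argument over patches is possible: the Bramble-Hilbert constant is
  explicit, and the patch enters it through the ratio of the areas of \<open>S\<close> and the ball,
  at most \<open>\<gamma>\<^sup>2 / 4\<close>, and through \<open>d / r \<le> \<gamma>\<close>.
  Compactness is used only for the inverse estimate, on a fixed reference disk. There a gradient
  costs the inverse of the radius of an inscribed disk, while the area of the triangle is of the
  order of the squared radius; in \<open>L2\<close> the two cancel, so no power of the mesh size is
  lost. The smooth function and the polynomial depend on an accuracy \<delta>, but neither occurs in
  the final inequality, so the passage to zero takes place between real numbers only.\<close>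

lemma finite_indices [simp]: "finite {(i::nat, j). i + j \<le> m}"
  by (rule finite_subset[of _ "{..m} \<times> {..m}"]) auto

lemma polys_zero: "(\<lambda>x. 0) \<in> polys m"
  unfolding polys_def by (auto intro!: exI[of _ "\<lambda>_ _. 0"])

lemma polys_add: "(\<lambda>x. p x + q x) \<in> polys m" if "p \<in> polys m" "q \<in> polys m"
proof -
  from that obtain c e where "p = (\<lambda>x. \<Sum>(i,j)\<in>{(i,j). i + j \<le> m}. c i j * (x$1)^i * (x$2)^j)"
    "q = (\<lambda>x. \<Sum>(i,j)\<in>{(i,j). i + j \<le> m}. e i j * (x$1)^i * (x$2)^j)"
    unfolding polys_def by blast
  then have "(\<lambda>x. p x + q x) = (\<lambda>x. \<Sum>(i,j)\<in>{(i,j). i + j \<le> m}. (c i j + e i j) * (x$1)^i * (x$2)^j)"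
    by (simp add: sum.distrib[symmetric] case_prod_unfold algebra_simps)
  then show ?thesis unfolding polys_def by (intro CollectI exI[of _ "\<lambda>i j. c i j + e i j"])
qed

lemma polys_scale: "(\<lambda>x. a * p x) \<in> polys m" if "p \<in> polys m"
proof -
  from that obtain c where "p = (\<lambda>x. \<Sum>(i,j)\<in>{(i,j). i + j \<le> m}. c i j * (x$1)^i * (x$2)^j)"
    unfolding polys_def by blast
  then have "(\<lambda>x. a * p x) = (\<lambda>x. \<Sum>(i,j)\<in>{(i,j). i + j \<le> m}. (a * c i j) * (x$1)^i * (x$2)^j)"
    by (simp add: sum_distrib_left case_prod_unfold algebra_simps)
  then show ?thesis unfolding polys_def by (intro CollectI exI[of _ "\<lambda>i j. a * c i j"])
qed

lemma polys_diff: "(\<lambda>x. p x - q x) \<in> polys m" if "p \<in> polys m" "q \<in> polys m"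
  using polys_add[OF that(1) polys_scale[OF that(2), of "-1"]] by simp

lemma polys_sum: "(\<lambda>x. \<Sum>k\<in>A. p k x) \<in> polys m" if "\<And>k. k \<in> A \<Longrightarrow> p k \<in> polys m"
  using that by (induction A rule: infinite_finite_induct) (auto intro: polys_zero polys_add)

lemma polys_monomial: "(\<lambda>x. (x$1)^a * (x$2)^b) \<in> polys m" if "a + b \<le> m"
proof -
  have "(\<Sum>(i,j)\<in>{(i,j). i + j \<le> m}. (if (i,j) = (a,b) then 1 else 0) * (x$1)^i * (x$2)^j)
      = (\<Sum>k\<in>{(i,j). i + j \<le> m}. if k = (a,b) then (x$1)^a * (x$2)^b else 0)" for x :: "real^2"
    by (rule sum.cong) (auto split: if_splits)
  then have "(\<lambda>x::real^2. (x$1)^a * (x$2)^b) = (\<lambda>x. \<Sum>(i,j)\<in>{(i,j). i + j \<le> m}.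
      (if (i,j) = (a,b) then 1 else 0) * (x$1)^i * (x$2)^j)"
    using that by simp
  then show ?thesis
    unfolding polys_def
    by (intro CollectI exI[of _ "\<lambda>i j. if (i,j) = (a,b) then 1 else 0"]) simp
qed

lemma polys_induct [consumes 1, case_names monomial add scale]:
  assumes "p \<in> polys m"
    and mono: "\<And>a b. a + b \<le> m \<Longrightarrow> P (\<lambda>x. (x$1)^a * (x$2)^b)"
    and add: "\<And>p q. P p \<Longrightarrow> P q \<Longrightarrow> P (\<lambda>x. p x + q x)"
    and scale: "\<And>p a. P p \<Longrightarrow> P (\<lambda>x. a * p x)"
  shows "P p"
proof -
  obtain c where p: "p = (\<lambda>x. \<Sum>(i,j)\<in>{(i,j). i + j \<le> m}. c i j * (x$1)^i * (x$2)^j)"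
    using assms(1) unfolding polys_def by blast
  have zero: "P (\<lambda>x. 0)" using scale[OF mono[of 0 0], of 0] by simp
  have "P (\<lambda>x. \<Sum>(i,j)\<in>J. c i j * (x$1)^i * (x$2)^j)" if "finite J" "J \<subseteq> {(i,j). i + j \<le> m}" for J
    using that
  proof (induction J)
    case (insert k J)
    obtain i j where k: "k = (i,j)" "i + j \<le> m" using insert.prems by (cases k) auto
    have "P (\<lambda>x. c i j * ((x$1)^i * (x$2)^j))" using scale[OF mono[OF k(2)]] .
    from add[OF this insert.IH] insert show ?case by (simp add: k mult.assoc)
  qed (simp add: zero)
  then show ?thesis unfolding p by simp
qed

lemma polys_mono: "p \<in> polys n" if "p \<in> polys m" "m \<le> n"
  using that(1) by (induction rule: polys_induct)
    (use that(2) in \<open>auto intro: polys_monomial polys_add polys_scale\<close>)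

lemma polys_mult_linear:
  assumes "p \<in> polys m"
  shows "(\<lambda>x. (u + v * x$1) * p x) \<in> polys (Suc m)" "(\<lambda>x. (u + v * x$2) * p x) \<in> polys (Suc m)"
proof -
  have s: "(\<lambda>x. x$1 * p x) \<in> polys (Suc m) \<and> (\<lambda>x. x$2 * p x) \<in> polys (Suc m)"
    using assms
  proof (induction rule: polys_induct)
    case (monomial a b)
    show ?case
      using polys_monomial[of "Suc a" b "Suc m"] polys_monomial[of a "Suc b" "Suc m"] monomial
      by (auto simp: mult_ac)
  next
    case (add p q) then show ?case using polys_add by (auto simp: ring_distribs)
  next
    case (scale p a) then show ?case using polys_scale[of _ _ a] by (fastforce simp: mult.left_commute)
  qed
  have p: "p \<in> polys (Suc m)" using polys_mono[OF assms] by simp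
  show "(\<lambda>x. (u + v * x$1) * p x) \<in> polys (Suc m)"
    using polys_add[OF polys_scale[OF p, of u] polys_scale[of _ _ v]] s by (auto simp: algebra_simps)
  show "(\<lambda>x. (u + v * x$2) * p x) \<in> polys (Suc m)"
    using polys_add[OF polys_scale[OF p, of u] polys_scale[of _ _ v]] s by (auto simp: algebra_simps)
qed

lemma polys_affine_monomial:
  assumes "a + b \<le> m"
  shows "(\<lambda>x. (u + v * x$1)^a * (u' + v' * x$2)^b) \<in> polys m"
proof -
  have b: "(\<lambda>x. (u' + v' * x$2)^b) \<in> polys b"
  proof (induction b)
    case 0 show ?case using polys_monomial[of 0 0 0] by simp
  next
    case (Suc b) then show ?case using polys_mult_linear(2) by simp
  qed
  have "(\<lambda>x. (u + v * x$1)^a * (u' + v' * x$2)^b) \<in> polys (a + b)"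
  proof (induction a)
    case 0 show ?case using b by simp
  next
    case (Suc a) then show ?case using polys_mult_linear(1)[OF Suc] by (simp add: mult.assoc)
  qed
  then show ?thesis using polys_mono assms by blast
qed

lemma polys_affine: "(\<lambda>x. p (z + s *\<^sub>R x)) \<in> polys m" if "p \<in> polys m"
  using that
proof (induction rule: polys_induct)
  case (monomial a b) then show ?case using polys_affine_monomial by simp
qed (auto intro: polys_add polys_scale)

lemma polys_has_derivative:
  assumes "p \<in> polys m"
  shows "\<exists>p1\<in>polys m. \<exists>p2\<in>polys m. \<forall>x. (p has_derivative (\<lambda>h. p1 x * h$1 + p2 x * h$2)) (at x)"
  using assms
proof (induction rule: polys_induct)
  case (monomial a b)
  have d: "((\<lambda>x::real^2. x$k ^ n) has_derivative (\<lambda>h. real n * x$k^(n-1) * h$k)) (at x)" for k n x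
    by (rule derivative_eq_intros bounded_linear.has_derivative bounded_linear_vec_nth has_derivative_ident)+ auto
  have "((\<lambda>x::real^2. x$1^a * x$2^b) has_derivative
     (\<lambda>h. (real a * (x$1^(a-1) * x$2^b)) * h$1 + (real b * (x$1^a * x$2^(b-1))) * h$2)) (at x)" for x
    by (rule has_derivative_eq_rhs[OF has_derivative_mult[OF d d]]) (auto simp: algebra_simps)
  moreover have "(\<lambda>x. real a * (x$1^(a-1) * x$2^b)) \<in> polys m" "(\<lambda>x. real b * (x$1^a * x$2^(b-1))) \<in> polys m"
    using monomial by (auto intro!: polys_scale polys_monomial)
  ultimately show ?case
    by (intro bexI[of _ "\<lambda>x. real a * (x$1^(a-1) * x$2^b)"]
          bexI[of _ "\<lambda>x. real b * (x$1^a * x$2^(b-1))"] allI)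
next
  case (add p q)
  then obtain p1 p2 q1 q2 where "p1\<in>polys m" "p2\<in>polys m" "q1\<in>polys m" "q2\<in>polys m"
    "\<forall>x. (p has_derivative (\<lambda>h. p1 x * h$1 + p2 x * h$2)) (at x)"
    "\<forall>x. (q has_derivative (\<lambda>h. q1 x * h$1 + q2 x * h$2)) (at x)" by blast
  then show ?case
    by (intro bexI[of _ "\<lambda>x. p1 x + q1 x"] bexI[of _ "\<lambda>x. p2 x + q2 x"])
      (auto intro!: polys_add has_derivative_eq_rhs[OF has_derivative_add] simp: algebra_simps)
next
  case (scale p a)
  then obtain p1 p2 where "p1\<in>polys m" "p2\<in>polys m"
    "\<forall>x. (p has_derivative (\<lambda>h. p1 x * h$1 + p2 x * h$2)) (at x)" by blast
  then show ?case
    by (intro bexI[of _ "\<lambda>x. a * p1 x"] bexI[of _ "\<lambda>x. a * p2 x"])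
      (auto intro!: polys_scale has_derivative_eq_rhs[OF has_derivative_mult_right] simp: algebra_simps)
qed

lemma polys_continuous: "continuous_on A p" if "p \<in> polys m"
  using polys_has_derivative[OF that]
  by (meson differentiable_imp_continuous_on differentiableI has_derivative_at_withinI differentiable_on_def)

text \<open>One-variable root counting is applied twice. For a fixed second coordinate in
  \<open>B\<close> the polynomial in the first coordinate has more than \<open>m\<close> roots, so
  its coefficients vanish; these are polynomials in the second coordinate and have more than
  \<open>m\<close> roots in turn.\<close>

lemma polys_unisolvent_grid:
  assumes p: "p \<in> polys m" and A: "card A > m" and B: "card B > m"
    and z: "\<And>x. x$1 \<in> A \<Longrightarrow> x$2 \<in> B \<Longrightarrow> p x = 0"
  shows "p = (\<lambda>x. 0)"
proof -
  obtain c where pc: "p = (\<lambda>x. \<Sum>(i,j)\<in>{(i,j). i + j \<le> m}. c i j * (x$1)^i * (x$2)^j)"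
    using p unfolding polys_def by blast
  \<comment> \<open>Padding by zero turns the triangular index set into a square, so that the sum
    becomes an iterated one-variable sum.\<close>
  define e where "e i j = (if i + j \<le> m then c i j else 0)" for i j
  have pe: "p x = (\<Sum>i\<le>m. (\<Sum>j\<le>m. e i j * (x$2)^j) * (x$1)^i)" for x
  proof -
    have "(\<Sum>i\<le>m. (\<Sum>j\<le>m. e i j * (x$2)^j) * (x$1)^i)
        = (\<Sum>(i,j)\<in>{..m}\<times>{..m}. e i j * (x$1)^i * (x$2)^j)"
      by (simp add: sum_distrib_left sum_distrib_right sum.cartesian_product mult_ac)
    also have "\<dots> = (\<Sum>(i,j)\<in>{(i,j). i + j \<le> m}. e i j * (x$1)^i * (x$2)^j)"
      by (rule sum.mono_neutral_right) (auto simp: e_def split: if_splits)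
    also have "\<dots> = p x" unfolding pc by (rule sum.cong) (auto simp: e_def)
    finally show ?thesis by simp
  qed
  have root: "\<forall>k\<le>m. f k = 0" if "\<And>a. a \<in> X \<Longrightarrow> (\<Sum>i\<le>m. f i * a^i) = 0" "card X > m" for f :: "nat \<Rightarrow> real" and X
  proof (rule ccontr)
    assume "\<not> ?thesis"
    then have fin: "finite {z. (\<Sum>i\<le>m. f i * z^i) = 0}" and cd: "card {z. (\<Sum>i\<le>m. f i * z^i) = 0} \<le> m"
      using polyfun_rootbound[of m f] by auto
    have "card X \<le> card {z. (\<Sum>i\<le>m. f i * z^i) = 0}"
      by (rule card_mono[OF fin]) (use that in auto)
    then show False using cd that by simp
  qed
  have "e i j = 0" if "i \<le> m" "j \<le> m" for i j
  proof -
    have "(\<Sum>j\<le>m. e i j * b^j) = 0" if "b \<in> B" for b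
    proof -
      have "(\<Sum>i\<le>m. (\<Sum>j\<le>m. e i j * b^j) * a^i) = 0" if "a \<in> A" for a
      proof -
        have "p (vector [a,b]) = 0" by (rule z) (unfold vector_2, rule that, rule \<open>b \<in> B\<close>)
        then show ?thesis unfolding pe vector_2 .
      qed
      then have "\<forall>i\<le>m. (\<Sum>j\<le>m. e i j * b^j) = 0" by (rule root[OF _ A])
      then show ?thesis using \<open>i \<le> m\<close> by simp
    qed
    then have "\<forall>j\<le>m. e i j = 0" by (rule root[OF _ B])
    then show ?thesis using \<open>j \<le> m\<close> by simp
  qed
  then have "p x = 0" for x unfolding pe by (simp add: sum.neutral)
  then show ?thesis by blast
qed

lemma polys_eq_0_if_vanishing_on_ball:
  assumes "p \<in> polys m" "r > 0" "\<And>x. x \<in> ball c r \<Longrightarrow> p x = 0"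
  shows "p = (\<lambda>x. 0)"
proof -
  \<comment> \<open>A grid in the open square of half side \<open>r/2\<close> lies in the ball,
    because the norm is at most the sum of the absolute coordinates.\<close>
  have "infinite {u - r/2<..<u + r/2}" for u :: real using assms(2) by (simp add: infinite_Ioo)
  then obtain A B where A: "A \<subseteq> {c$1 - r/2<..<c$1 + r/2}" "finite A" "card A = Suc m"
    and B: "B \<subseteq> {c$2 - r/2<..<c$2 + r/2}" "finite B" "card B = Suc m"
    by (meson infinite_arbitrarily_large)
  show ?thesis
  proof (rule polys_unisolvent_grid[OF assms(1), of A B])
    fix x :: "real^2" assume x: "x$1 \<in> A" "x$2 \<in> B"
    have "dist c x \<le> \<bar>(c-x)$1\<bar> + \<bar>(c-x)$2\<bar>"
      using norm_le_l1_cart[of "c-x"] by (simp add: dist_norm UNIV_2)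
    moreover have "\<bar>(c-x)$1\<bar> < r/2" "\<bar>(c-x)$2\<bar> < r/2"
      using subsetD[OF A(1) x(1)] subsetD[OF B(1) x(2)]
      unfolding vector_minus_component abs_less_iff greaterThanLessThan_iff
      by (intro conjI; linarith)+
    ultimately show "p x = 0" using assms(3)[of x] by simp
  qed (simp_all add: A(3) B(3))
qed

section \<open>Least squares and interpolation on finitely many nodes\<close>

lemma least_squares_orthogonality:
  fixes f :: "'k \<Rightarrow> 'a \<Rightarrow> real"
  assumes "finite J" "finite I"
  shows "\<exists>c. \<forall>k\<in>J. (\<Sum>x\<in>I. (g x - (\<Sum>l\<in>J. c l * f l x)) * f k x) = 0"
  using assms(1)
proof (induction J arbitrary: g)
  case (insert k J)
  \<comment> \<open>A Gram-Schmidt step: the new function \<open>f k\<close> and the target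
    \<open>g\<close> are both projected onto the span over \<open>J\<close>, which is why the
    induction runs over arbitrary targets.\<close>
  obtain e where e: "\<forall>l\<in>J. (\<Sum>x\<in>I. (f k x - (\<Sum>l\<in>J. e l * f l x)) * f l x) = 0"
    using insert.IH by blast
  obtain c where c: "\<forall>l\<in>J. (\<Sum>x\<in>I. (g x - (\<Sum>l\<in>J. c l * f l x)) * f l x) = 0"
    using insert.IH by blast
  define F where "F x = f k x - (\<Sum>l\<in>J. e l * f l x)" for x
  define G where "G x = g x - (\<Sum>l\<in>J. c l * f l x)" for x
  \<comment> \<open>The functions may be dependent on \<open>I\<close>, so \<open>F\<close> may
    vanish there. The quotient is then 0 by default, and any value of \<open>a\<close> would
    do.\<close>
  define a where "a = (\<Sum>x\<in>I. G x * F x) / (\<Sum>x\<in>I. F x * F x)"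
  have Fk: "(\<Sum>x\<in>I. H x * F x) = (\<Sum>x\<in>I. H x * f k x)" if "\<forall>l\<in>J. (\<Sum>x\<in>I. H x * f l x) = 0" for H
  proof -
    have "(\<Sum>x\<in>I. H x * (\<Sum>l\<in>J. e l * f l x)) = (\<Sum>l\<in>J. e l * (\<Sum>x\<in>I. H x * f l x))"
      unfolding sum_distrib_left by (subst sum.swap) (simp add: mult_ac)
    also have "\<dots> = 0" using that by simp
    finally show ?thesis unfolding F_def by (simp add: right_diff_distrib sum_subtractf)
  qed
  have orth: "(\<Sum>x\<in>I. (G x - a * F x) * f l x) = 0" if "l \<in> J" for l
  proof -
    have "(\<Sum>x\<in>I. (G x - a * F x) * f l x) = (\<Sum>x\<in>I. G x * f l x) - a * (\<Sum>x\<in>I. F x * f l x)"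
      by (simp add: algebra_simps sum_subtractf sum_distrib_left)
    then show ?thesis using c e that unfolding G_def F_def by simp
  qed
  have "(\<Sum>x\<in>I. (G x - a * F x) * F x) = 0"
  proof (cases "(\<Sum>x\<in>I. F x * F x) = 0")
    case True
    then have "\<forall>x\<in>I. F x = 0" using assms(2) by (simp add: sum_nonneg_eq_0_iff)
    then show ?thesis by simp
  next
    case False
    have "(\<Sum>x\<in>I. (G x - a * F x) * F x) = (\<Sum>x\<in>I. G x * F x) - a * (\<Sum>x\<in>I. F x * F x)"
      by (simp add: algebra_simps sum_subtractf sum_distrib_left)
    then show ?thesis using False by (simp add: a_def)
  qed
  then have orthk: "(\<Sum>x\<in>I. (G x - a * F x) * f k x) = 0" using Fk[of "\<lambda>x. G x - a * F x"] orth by simp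
  define c' where "c' l = (if l = k then a else c l - a * e l)" for l
  have "g x - (\<Sum>l\<in>insert k J. c' l * f l x) = G x - a * F x" for x
  proof -
    have "(\<Sum>l\<in>J. c' l * f l x) = (\<Sum>l\<in>J. (c l - a * e l) * f l x)"
      by (rule sum.cong) (use insert(2) in \<open>auto simp: c'_def\<close>)
    then show ?thesis using insert(1,2)
      by (simp add: G_def F_def c'_def algebra_simps sum_subtractf sum_distrib_left)
  qed
  then show ?case using orth orthk by (intro exI[of _ c']) auto
qed simp

text \<open>These are the normal equations of the least squares problem. They are solvable for every
  finite node set; unisolvence later yields uniqueness.\<close>

lemma polys_projection:
  assumes "finite I"
  shows "\<exists>p\<in>polys m. \<forall>q\<in>polys m. (\<Sum>x\<in>I. (g x - p x) * q x) = 0"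
proof -
  define f where "f = (\<lambda>(i,j) (x::real^2). (x$1)^i * (x$2)^j)"
  define J where "J = {(i::nat,j). i + j \<le> m}"
  obtain c where c: "\<forall>k\<in>J. (\<Sum>x\<in>I. (g x - (\<Sum>l\<in>J. c l * f l x)) * f k x) = 0"
    using least_squares_orthogonality[of J I g f] assms by (auto simp: J_def)
  have p: "(\<lambda>x. \<Sum>l\<in>J. c l * f l x) \<in> polys m"
    by (intro polys_sum polys_scale) (auto simp: J_def f_def intro: polys_monomial)
  have "(\<Sum>x\<in>I. (g x - (\<Sum>l\<in>J. c l * f l x)) * q x) = 0" if "q \<in> polys m" for q
    using that
  proof (induction rule: polys_induct)
    case (monomial a b)
    have fab: "f (a,b) x = (x$1)^a * (x$2)^b" for x by (simp add: f_def)
    have "(a,b) \<in> J" using monomial by (simp add: J_def)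
    from bspec[OF c this] show ?case unfolding fab .
  next
    case (scale p a)
    have "(\<Sum>x\<in>I. (g x - (\<Sum>l\<in>J. c l * f l x)) * (a * p x))
        = a * (\<Sum>x\<in>I. (g x - (\<Sum>l\<in>J. c l * f l x)) * p x)"
      unfolding sum_distrib_left by (rule sum.cong) (auto simp only: mult_ac)
    then show ?case using scale by simp
  qed (simp add: distrib_left sum.distrib)
  then show ?thesis by (intro bexI[OF _ p] ballI)
qed

text \<open>With more nodes than the dimension there is no Lagrange basis. The least squares
  projections of the indicators of single nodes take its place.\<close>

lemma polys_interpolation:
  assumes "finite I" and uni: "\<And>p. p \<in> polys m \<Longrightarrow> (\<forall>x\<in>I. p x = 0) \<Longrightarrow> p = (\<lambda>x. 0)"
  shows "\<exists>L. (\<forall>z. L z \<in> polys m) \<and> (\<forall>p\<in>polys m. \<forall>x. p x = (\<Sum>z\<in>I. p z * L z x))"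
proof -
  have "\<forall>z. \<exists>p. p \<in> polys m \<and> (\<forall>q\<in>polys m. (\<Sum>x\<in>I. ((if x = z then 1 else 0) - p x) * q x) = 0)"
    using polys_projection[OF assms(1)] unfolding Bex_def by (intro allI)
  from choice[OF this] obtain L where L: "\<forall>z. L z \<in> polys m \<and>
      (\<forall>q\<in>polys m. (\<Sum>x\<in>I. ((if x = z then 1 else 0) - L z x) * q x) = 0)"
    by (rule exE)
  have l: "L z \<in> polys m" for z using spec[OF L, of z] by (rule conjunct1)
  have orth: "(\<Sum>x\<in>I. ((if x = z then 1 else 0) - L z x) * q x) = 0" if "q \<in> polys m" for z q
    using conjunct2[OF spec[OF L, of z]] that by (rule bspec)
  have "p x = (\<Sum>z\<in>I. p z * L z x)" if p: "p \<in> polys m" for p x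
  proof -
    \<comment> \<open>On the nodes \<open>w\<close> is a combination of residuals of these
      projections, each of which is orthogonal to every polynomial, in particular to
      \<open>w\<close> itself.\<close>
    define w where "w x = p x - (\<Sum>z\<in>I. p z * L z x)" for x
    have w: "w \<in> polys m" unfolding w_def by (intro polys_diff p polys_sum polys_scale l)
    have w': "w x = (\<Sum>z\<in>I. p z * ((if x = z then 1 else 0) - L z x))" if "x \<in> I" for x
      using that assms(1) by (simp add: w_def right_diff_distrib sum_subtractf if_distrib[of "\<lambda>u. _ * u"] cong: if_cong)
    have "(\<Sum>x\<in>I. w x * w x) = (\<Sum>x\<in>I. (\<Sum>z\<in>I. p z * ((if x = z then 1 else 0) - L z x)) * w x)"
      using w' by (intro sum.cong) auto
    also have "\<dots> = (\<Sum>z\<in>I. p z * (\<Sum>x\<in>I. ((if x = z then 1 else 0) - L z x) * w x))"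
      unfolding sum_distrib_left sum_distrib_right by (subst sum.swap) (simp add: mult_ac)
    also have "\<dots> = 0" using orth[OF w] by simp
    finally have "\<forall>x\<in>I. w x = 0" using assms(1) by (simp add: sum_nonneg_eq_0_iff)
    then have "w = (\<lambda>x. 0)" by (intro uni w)
    from fun_cong[OF this, of x] show ?thesis unfolding w_def by simp
  qed
  then show ?thesis using l by (intro exI[of _ L] conjI allI ballI)
qed

text \<open>By the normal equations the sum of squares splits, as in Pythagoras, into its minimum
  and the squared distance to the projection on the nodes. Unisolvence then makes the minimizer
  unique, so that the \<open>THE\<close> in \<open>reconstruction\<close> denotes it.\<close>

lemma reconstruction_properties:
  assumes "finite I" and uni: "\<And>p. p \<in> polys m \<Longrightarrow> (\<forall>x\<in>I. p x = 0) \<Longrightarrow> p = (\<lambda>x. 0)"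
  shows "reconstruction m I g \<in> polys m"
    and "\<And>q. q \<in> polys m \<Longrightarrow>
      (\<Sum>x\<in>I. \<bar>g x - reconstruction m I g x\<bar>\<^sup>2) \<le> (\<Sum>x\<in>I. \<bar>g x - q x\<bar>\<^sup>2)"
proof -
  obtain p where p: "p \<in> polys m" and orth': "\<forall>q\<in>polys m. (\<Sum>x\<in>I. (g x - p x) * q x) = 0"
    using polys_projection[OF assms(1), of m g] by (rule bexE)
  note orth = bspec[OF orth']
  have pyth: "(\<Sum>x\<in>I. \<bar>g x - q x\<bar>\<^sup>2) = (\<Sum>x\<in>I. \<bar>g x - p x\<bar>\<^sup>2) + (\<Sum>x\<in>I. (p x - q x)\<^sup>2)" if "q \<in> polys m" for q
  proof -
    have "(\<Sum>x\<in>I. \<bar>g x - q x\<bar>\<^sup>2)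
      = (\<Sum>x\<in>I. \<bar>g x - p x\<bar>\<^sup>2 + (p x - q x)\<^sup>2 + 2 * ((g x - p x) * (p x - q x)))"
      by (rule sum.cong) (auto simp: power2_eq_square algebra_simps)
    then show ?thesis
      using orth[OF polys_diff[OF p that]] by (simp add: sum.distrib sum_distrib_left[symmetric])
  qed
  let ?P = "\<lambda>p. p \<in> polys m \<and> (\<forall>q\<in>polys m. (\<Sum>x\<in>I. \<bar>g x - p x\<bar>\<^sup>2) \<le> (\<Sum>x\<in>I. \<bar>g x - q x\<bar>\<^sup>2))"
  have "(\<Sum>x\<in>I. \<bar>g x - p x\<bar>\<^sup>2) \<le> (\<Sum>x\<in>I. \<bar>g x - q x\<bar>\<^sup>2)" if "q \<in> polys m" for q
    unfolding pyth[OF that] by (simp add: sum_nonneg)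
  then have "?P p" using p by (intro conjI ballI)
  moreover have "q = p" if q: "?P q" for q
  proof -
    have "(\<Sum>x\<in>I. \<bar>g x - q x\<bar>\<^sup>2) \<le> (\<Sum>x\<in>I. \<bar>g x - p x\<bar>\<^sup>2)" using bspec[OF conjunct2[OF q] p] .
    then have "(\<Sum>x\<in>I. (p x - q x)\<^sup>2) \<le> 0" unfolding pyth[OF conjunct1[OF q]] by simp
    then have "(\<Sum>x\<in>I. (p x - q x)\<^sup>2) = 0" by (intro antisym) (simp_all add: sum_nonneg)
    then have "\<forall>x\<in>I. p x - q x = 0" using assms(1) by (simp add: sum_nonneg_eq_0_iff)
    then have "(\<lambda>x. p x - q x) = (\<lambda>x. 0)" by (intro uni polys_diff p conjunct1[OF q])
    from fun_cong[OF this] show ?thesis by (intro ext) simp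
  qed
  ultimately have "?P (THE p. ?P p)" by (rule theI)
  then show "reconstruction m I g \<in> polys m"
    and "\<And>q. q \<in> polys m \<Longrightarrow>
      (\<Sum>x\<in>I. \<bar>g x - reconstruction m I g x\<bar>\<^sup>2) \<le> (\<Sum>x\<in>I. \<bar>g x - q x\<bar>\<^sup>2)"
    unfolding reconstruction_def by (rule conjunct1, rule conjunct2[THEN bspec])
qed

lemma polys_bounded_on_compact:
  assumes "\<And>z. L z \<in> polys m" "compact S" "finite I"
  shows "\<exists>C\<ge>0. \<forall>x\<in>S. (\<Sum>z\<in>I. \<bar>L z x\<bar>) \<le> C"
proof -
  have "compact ((\<lambda>x. \<Sum>z\<in>I. \<bar>L z x\<bar>) ` S)"
    by (intro compact_continuous_image assms continuous_intros polys_continuous[OF assms(1)])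
  then have "bounded ((\<lambda>x. \<Sum>z\<in>I. \<bar>L z x\<bar>) ` S)" by (rule compact_imp_bounded)
  then obtain C where "\<forall>x\<in>S. norm (\<Sum>z\<in>I. \<bar>L z x\<bar>) \<le> C" by (auto simp: bounded_iff)
  then show ?thesis by (intro exI[of _ "max C 0"]) fastforce
qed

lemma gradient_unique:
  fixes f :: "real^2 \<Rightarrow> real"
  assumes "(f has_derivative (\<lambda>h. a * h$1 + b * h$2)) (at x)" "(f has_derivative (\<lambda>h. a' * h$1 + b' * h$2)) (at x)"
  shows "a = a'" "b = b'"
proof -
  have eq: "(\<lambda>h::real^2. a * h$1 + b * h$2) = (\<lambda>h. a' * h$1 + b' * h$2)"
    using has_derivative_unique[OF assms] .
  show "a = a'" using fun_cong[OF eq, of "axis 1 1"] by (simp add: axis_def)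
  show "b = b'" using fun_cong[OF eq, of "axis 2 1"] by (simp add: axis_def)
qed

text \<open>After rescaling to the unit disk a polynomial is reproduced from its values on a fixed
  grid, so these values bound its gradient with a constant depending on \<open>m\<close> and
  \<open>s\<close> only. The gradient is evaluated on a disk enlarged by \<open>s\<close>, because
  the inscribed disk of a triangle covers the triangle only after such an enlargement.\<close>

lemma polys_inverse_estimate:
  assumes "s \<ge> 0"
  shows "\<exists>C\<ge>0. \<forall>q\<in>polys m. \<forall>z \<rho> M y a b. \<rho> > 0 \<and> (\<forall>x\<in>cball z \<rho>. \<bar>q x\<bar> \<le> M) \<and> y \<in> cball z (s * \<rho>)
    \<and> (q has_derivative (\<lambda>h. a * h$1 + b * h$2)) (at y) \<longrightarrow> \<bar>a\<bar> \<le> C * M / \<rho> \<and> \<bar>b\<bar> \<le> C * M / \<rho>"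
proof -
  \<comment> \<open>The square of half side \<open>1/2\<close> lies in the unit disk, and
    \<open>m + 1\<close> values per coordinate make the grid unisolvent.\<close>
  obtain A :: "real set" where A: "A \<subseteq> {-1/2<..<1/2}" "finite A" "card A = Suc m"
    using infinite_arbitrarily_large[of "{-1/2<..<1/2::real}" "Suc m"] by (auto simp: infinite_Ioo)
  define I where "I = (\<lambda>(a,b). vector [a,b] :: real^2) ` (A \<times> A)"
  have mem: "x \<in> I" if "x$1 \<in> A" "x$2 \<in> A" for x
  proof -
    have "x = vector [x$1, x$2]" by (simp add: vec_eq_iff forall_2)
    then show ?thesis unfolding I_def using that by (intro image_eqI[of _ _ "(x$1,x$2)"]) auto
  qed
  have fin: "finite I" unfolding I_def using A by auto
  have uni: "p = (\<lambda>x. 0)" if "p \<in> polys m" "\<forall>x\<in>I. p x = 0" for p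
    by (rule polys_unisolvent_grid[OF that(1), of A A]) (use A(3) in simp, use A(3) in simp, use mem that(2) in blast)
  have I1: "norm x \<le> 1" if "x \<in> I" for x
  proof -
    have "\<bar>x$1\<bar> \<le> 1/2" "\<bar>x$2\<bar> \<le> 1/2" using that A(1) by (force simp: I_def)+
    then show ?thesis using norm_le_l1_cart[of x] by (simp add: UNIV_2)
  qed
  obtain L where L: "\<forall>z. L z \<in> polys m" and lp': "\<forall>p\<in>polys m. \<forall>x. p x = (\<Sum>z\<in>I. p z * L z x)"
  proof -
    have "\<exists>L. (\<forall>z. L z \<in> polys m) \<and> (\<forall>p\<in>polys m. \<forall>x. p x = (\<Sum>z\<in>I. p z * L z x))"
      by (rule polys_interpolation[OF fin]) (rule uni)
    then show ?thesis using that by (elim exE conjE)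
  qed
  note l = spec[OF L] and lp = spec[OF bspec[OF lp']]
  have "\<forall>z. \<exists>D. fst D \<in> polys m \<and> snd D \<in> polys m \<and>
      (\<forall>x. (L z has_derivative (\<lambda>h. fst D x * h$1 + snd D x * h$2)) (at x))"
  proof
    fix z
    obtain p1 p2 where "p1 \<in> polys m" "p2 \<in> polys m"
      "\<forall>x. (L z has_derivative (\<lambda>h. p1 x * h$1 + p2 x * h$2)) (at x)"
      using polys_has_derivative[OF l, of z] by (elim bexE)
    then show "\<exists>D. fst D \<in> polys m \<and> snd D \<in> polys m \<and>
      (\<forall>x. (L z has_derivative (\<lambda>h. fst D x * h$1 + snd D x * h$2)) (at x))"
      by (intro exI[of _ "(p1,p2)"]) simp
  qed
  from choice[OF this] obtain D where D: "\<forall>z. fst (D z) \<in> polys m \<and> snd (D z) \<in> polys m \<and>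
      (\<forall>x. (L z has_derivative (\<lambda>h. fst (D z) x * h$1 + snd (D z) x * h$2)) (at x))"
    by (rule exE)
  define d1 where "d1 z = fst (D z)" for z
  define d2 where "d2 z = snd (D z)" for z
  have d1: "d1 z \<in> polys m" for z
    unfolding d1_def using spec[OF D, of z] by (rule conjunct1)
  have d2: "d2 z \<in> polys m" for z
    unfolding d2_def using conjunct2[OF spec[OF D, of z]] by (rule conjunct1)
  have d: "(L z has_derivative (\<lambda>h. d1 z x * h$1 + d2 z x * h$2)) (at x)" for z x
    unfolding d1_def d2_def using conjunct2[OF conjunct2[OF spec[OF D, of z]]] by (rule spec)
  have "\<exists>C\<ge>0. \<forall>x\<in>cball 0 s. (\<Sum>z\<in>I. \<bar>d1 z x\<bar>) \<le> C"
    by (rule polys_bounded_on_compact[where m=m and L=d1]) (rule d1 compact_cball fin)+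
  then obtain C1 where C1: "C1 \<ge> 0" "\<forall>x\<in>cball 0 s. (\<Sum>z\<in>I. \<bar>d1 z x\<bar>) \<le> C1"
    by (elim exE conjE)
  have "\<exists>C\<ge>0. \<forall>x\<in>cball 0 s. (\<Sum>z\<in>I. \<bar>d2 z x\<bar>) \<le> C"
    by (rule polys_bounded_on_compact[where m=m and L=d2]) (rule d2 compact_cball fin)+
  then obtain C2 where C2: "C2 \<ge> 0" "\<forall>x\<in>cball 0 s. (\<Sum>z\<in>I. \<bar>d2 z x\<bar>) \<le> C2"
    by (elim exE conjE)
  have main: "\<bar>a\<bar> \<le> max C1 C2 * M / \<rho> \<and> \<bar>b\<bar> \<le> max C1 C2 * M / \<rho>"
    if q: "q \<in> polys m" and \<rho>: "\<rho> > 0" and M: "\<forall>x\<in>cball z \<rho>. \<bar>q x\<bar> \<le> M" and y: "y \<in> cball z (s * \<rho>)"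
      and dq: "(q has_derivative (\<lambda>h. a * h$1 + b * h$2)) (at y)" for q z \<rho> M y a b
  proof -
    define Q where "Q x = q (z + \<rho> *\<^sub>R x)" for x
    have Q: "Q \<in> polys m" unfolding Q_def by (rule polys_affine[OF q])
    define u where "u = (1/\<rho>) *\<^sub>R (y - z)"
    have yu: "y = z + \<rho> *\<^sub>R u" using \<rho> by (simp add: u_def)
    have u: "u \<in> cball 0 s"
      using y \<rho> by (simp add: u_def dist_norm norm_minus_commute[of z y] pos_divide_le_eq)
    have QM: "\<bar>Q x\<bar> \<le> M" if "x \<in> I" for x
      using M I1[OF that] \<rho> by (auto simp: Q_def dist_norm)
    have M0: "0 \<le> M" using bspec[OF M, of z] \<rho> by (simp add: order_trans[OF abs_ge_zero])
    \<comment> \<open>The gradient of the rescaled polynomial is computed twice, by the chain rule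
      and from the reproduction formula; comparing the two gives the factor
      \<open>1 / \<rho>\<close>.\<close>
    have "(Q has_derivative (\<lambda>h. (\<rho> * a) * h$1 + (\<rho> * b) * h$2)) (at u)"
      unfolding Q_def
    proof (rule has_derivative_eq_rhs)
      show "((\<lambda>x. q (z + \<rho> *\<^sub>R x)) has_derivative (\<lambda>h. a * (\<rho> *\<^sub>R h)$1 + b * (\<rho> *\<^sub>R h)$2)) (at u)"
        by (rule has_derivative_compose[where g=q and f="\<lambda>x. z + \<rho> *\<^sub>R x"])
          (auto intro!: derivative_eq_intros dq[unfolded yu])
    qed (auto simp: algebra_simps)
    moreover have "((\<lambda>x. \<Sum>z\<in>I. Q z * L z x) has_derivative
        (\<lambda>h. (\<Sum>z\<in>I. Q z * d1 z u) * h$1 + (\<Sum>z\<in>I. Q z * d2 z u) * h$2)) (at u)"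
      by (rule has_derivative_eq_rhs, rule has_derivative_sum, rule has_derivative_mult_right, rule d)
        (auto simp: algebra_simps sum.distrib sum_distrib_left)
    moreover have "Q = (\<lambda>x. \<Sum>z\<in>I. Q z * L z x)" by (rule ext) (rule lp[OF Q])
    ultimately have "(Q has_derivative
        (\<lambda>h. (\<Sum>z\<in>I. Q z * d1 z u) * h$1 + (\<Sum>z\<in>I. Q z * d2 z u) * h$2)) (at u)"
      "(Q has_derivative (\<lambda>h. (\<rho> * a) * h$1 + (\<rho> * b) * h$2)) (at u)" by (simp_all only:)
    from gradient_unique[OF this(2,1)]
    have e: "\<rho> * a = (\<Sum>z\<in>I. Q z * d1 z u)" "\<rho> * b = (\<Sum>z\<in>I. Q z * d2 z u)" .
    have bd: "\<bar>\<Sum>z\<in>I. Q z * D z\<bar> \<le> M * (\<Sum>z\<in>I. \<bar>D z\<bar>)" for D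
      unfolding sum_distrib_left
      by (rule order_trans[OF sum_abs]) (auto intro!: sum_mono mult_right_mono QM simp: abs_mult)
    have "\<rho> * \<bar>a\<bar> \<le> M * max C1 C2"
    proof -
      have "\<rho> * \<bar>a\<bar> = \<bar>\<rho> * a\<bar>" using \<rho> by (simp add: abs_mult)
      also have "\<dots> \<le> M * (\<Sum>z\<in>I. \<bar>d1 z u\<bar>)" unfolding e using bd[of "\<lambda>z. d1 z u"] .
      also have "\<dots> \<le> M * max C1 C2" using bspec[OF C1(2) u] M0 by (intro mult_left_mono) auto
      finally show ?thesis .
    qed
    moreover have "\<rho> * \<bar>b\<bar> \<le> M * max C1 C2"
    proof -
      have "\<rho> * \<bar>b\<bar> = \<bar>\<rho> * b\<bar>" using \<rho> by (simp add: abs_mult)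
      also have "\<dots> \<le> M * (\<Sum>z\<in>I. \<bar>d2 z u\<bar>)" unfolding e using bd[of "\<lambda>z. d2 z u"] .
      also have "\<dots> \<le> M * max C1 C2" using bspec[OF C2(2) u] M0 by (intro mult_left_mono) auto
      finally show ?thesis .
    qed
    ultimately show ?thesis using \<rho> by (simp add: field_simps)
  qed
  have nn: "max C1 C2 \<ge> 0" using C1(1) by simp
  show ?thesis
    by (intro exI[of _ "max C1 C2"] conjI[OF nn] ballI allI impI, elim conjE) (rule main; assumption)
qed

subsection \<open>Families of partial derivatives\<close>

text \<open>\<open>U i j\<close> plays the role of the mixed derivative \<open>\<partial>\<^sub>1\<^sup>i \<partial>\<^sub>2\<^sup>j\<close> of \<open>U 0 0\<close>;
  recording all of them at once makes the symmetry of mixed derivatives part of the definition.\<close>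

definition jet :: "(nat \<Rightarrow> nat \<Rightarrow> real^2 \<Rightarrow> real) \<Rightarrow> bool" where
  "jet U \<longleftrightarrow> (\<forall>i j x. (U i j has_derivative (\<lambda>h. U (Suc i) j x * h$1 + U i (Suc j) x * h$2)) (at x))"

lemma jetD: "jet U \<Longrightarrow> (U i j has_derivative (\<lambda>h. U (Suc i) j x * h$1 + U i (Suc j) x * h$2)) (at x)"
  by (simp add: jet_def)

lemma jet_continuous: "jet U \<Longrightarrow> continuous_on A (U i j)"
  by (meson jetD has_derivative_at_withinI has_derivative_continuous continuous_on_eq_continuous_within)

lemma jet_measurable: "jet U \<Longrightarrow> U i j \<in> borel_measurable borel"
  by (rule borel_measurable_continuous_onI) (rule jet_continuous)

lemma jet_diff: "jet U \<Longrightarrow> jet V \<Longrightarrow> jet (\<lambda>i j x. U i j x - V i j x)"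
  unfolding jet_def by (intro allI) (auto intro!: has_derivative_eq_rhs[OF has_derivative_diff] simp: algebra_simps)

lemma jet_add: "jet U \<Longrightarrow> jet V \<Longrightarrow> jet (\<lambda>i j x. U i j x + V i j x)"
  unfolding jet_def by (intro allI) (auto intro!: has_derivative_eq_rhs[OF has_derivative_add] simp: algebra_simps)

lemma jet_cmult: "jet U \<Longrightarrow> jet (\<lambda>i j x. c * U i j x)"
  unfolding jet_def by (intro allI) (auto intro!: has_derivative_eq_rhs[OF has_derivative_mult_right] simp: algebra_simps)

lemma jet_zero: "jet (\<lambda>i j x. 0)"
  unfolding jet_def by auto

lemma jet_along_segment:
  assumes "jet U"
  shows "((\<lambda>s. U i j (y + s *\<^sub>R v)) has_real_derivative
     (U (Suc i) j (y + s *\<^sub>R v) * v$1 + U i (Suc j) (y + s *\<^sub>R v) * v$2)) (at s)"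
proof -
  have "((\<lambda>s. U i j (y + s *\<^sub>R v)) has_derivative
      (\<lambda>h. U (Suc i) j (y + s *\<^sub>R v) * (h *\<^sub>R v)$1 + U i (Suc j) (y + s *\<^sub>R v) * (h *\<^sub>R v)$2)) (at s)"
    by (rule has_derivative_compose[where g="U i j" and f="\<lambda>s. y + s *\<^sub>R v"])
      (auto intro!: derivative_eq_intros jetD[OF assms])
  then show ?thesis unfolding has_field_derivative_def
    by (rule has_derivative_eq_rhs) (auto simp: algebra_simps)
qed

text \<open>Jensen's inequality on the unit interval, from expanding the integral of the square of
  \<open>\<phi> s - I\<close>.\<close>

lemma square_integral_le:
  fixes \<phi> :: "real \<Rightarrow> real"
  assumes c: "continuous_on UNIV \<phi>" and I: "(\<phi> has_integral I) {0..1}"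
  shows "ennreal (I\<^sup>2) \<le> (\<integral>\<^sup>+s. ennreal ((\<phi> s)\<^sup>2) * indicator {0..1} s \<partial>lborel)"
proof -
  have "(\<lambda>s. (\<phi> s)\<^sup>2) integrable_on {0..1}"
    by (intro integrable_continuous_interval continuous_intros continuous_on_subset[OF c]) auto
  then obtain J where J: "((\<lambda>s. (\<phi> s)\<^sup>2) has_integral J) {0..1}" by (auto simp: integrable_on_def)
  have one: "((\<lambda>s::real. I\<^sup>2) has_integral I\<^sup>2) {0..1}"
    using has_integral_const_real[of "I\<^sup>2" 0 1] by simp
  have "((\<lambda>s. (\<phi> s)\<^sup>2 - (2 * I) * \<phi> s + I\<^sup>2) has_integral (J - (2 * I) * I + I\<^sup>2)) {0..1}"
    by (intro has_integral_add has_integral_diff J has_integral_mult_right I one)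
  then have "0 \<le> J - (2 * I) * I + I\<^sup>2"
  proof (rule has_integral_nonneg)
    fix s
    have "(\<phi> s)\<^sup>2 - (2 * I) * \<phi> s + I\<^sup>2 = (\<phi> s - I)\<^sup>2" by (simp add: power2_diff mult_ac)
    then show "0 \<le> (\<phi> s)\<^sup>2 - (2 * I) * \<phi> s + I\<^sup>2" by simp
  qed
  then have "I\<^sup>2 \<le> J" by (simp add: power2_eq_square)
  moreover have "(\<integral>\<^sup>+s. ennreal ((\<phi> s)\<^sup>2) * indicator {0..1} s \<partial>lborel) = ennreal J"
    by (rule nn_integral_has_integral_lebesgue'[OF _ J]) simp
  ultimately show ?thesis by (simp add: ennreal_leI)
qed

section \<open>Changes of variables and averages along segments\<close>

lemma nn_integral_affine:
  fixes F :: "real^2 \<Rightarrow> ennreal"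
  assumes [measurable]: "F \<in> borel_measurable borel" and "s \<noteq> 0"
  shows "(\<integral>\<^sup>+x. F x \<partial>lborel) = ennreal (s\<^sup>2) * (\<integral>\<^sup>+x. F (v + s *\<^sub>R x) \<partial>lborel)"
  by (subst lborel_affine[OF assms(2), of v])
    (simp add: nn_integral_density nn_integral_distr nn_integral_cmult)

text \<open>The factor \<open>s\<^sup>2\<close> is the Jacobian in the plane; equality is lost
  because the image of \<open>A\<close> may be a proper part of \<open>S\<close>.\<close>

lemma nn_integral_affine_le:
  fixes G :: "real^2 \<Rightarrow> ennreal"
  assumes [measurable]: "G \<in> borel_measurable borel" "S \<in> sets borel" and s: "s \<noteq> 0"
    and sub: "\<And>x. x \<in> A \<Longrightarrow> v + s *\<^sub>R x \<in> S"
  shows "ennreal (s\<^sup>2) * (\<integral>\<^sup>+x. G (v + s *\<^sub>R x) * indicator A x \<partial>lborel) \<le> (\<integral>\<^sup>+x. G x * indicator S x \<partial>lborel)"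
proof -
  have "(\<integral>\<^sup>+x. G x * indicator S x \<partial>lborel)
      = ennreal (s\<^sup>2) * (\<integral>\<^sup>+x. G (v + s *\<^sub>R x) * indicator S (v + s *\<^sub>R x) \<partial>lborel)"
    by (rule nn_integral_affine[OF _ s]) measurable
  moreover have "(\<integral>\<^sup>+x. G (v + s *\<^sub>R x) * indicator A x \<partial>lborel)
      \<le> (\<integral>\<^sup>+x. G (v + s *\<^sub>R x) * indicator S (v + s *\<^sub>R x) \<partial>lborel)"
    by (rule nn_integral_mono) (auto split: split_indicator simp: sub)
  ultimately show ?thesis by (simp add: mult_left_mono)
qed

text \<open>The 4 is the inverse Jacobian at \<open>s = 1/2\<close>; it reappears in the Poincare
  inequality.\<close>

lemma nn_integral_affine_le4:
  fixes G :: "real^2 \<Rightarrow> ennreal"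
  assumes m: "G \<in> borel_measurable borel" "S \<in> sets borel" and s: "1/2 \<le> s"
    and sub: "\<And>x. x \<in> A \<Longrightarrow> v + s *\<^sub>R x \<in> S"
  shows "(\<integral>\<^sup>+x. G (v + s *\<^sub>R x) * indicator A x \<partial>lborel) \<le> 4 * (\<integral>\<^sup>+x. G x * indicator S x \<partial>lborel)"
proof -
  let ?I = "\<integral>\<^sup>+x. G (v + s *\<^sub>R x) * indicator A x \<partial>lborel"
  have "(1/2)\<^sup>2 \<le> s\<^sup>2" using s by (intro power_mono) auto
  then have "1 \<le> 4 * s\<^sup>2" by (simp add: power2_eq_square)
  then have "(1::ennreal) \<le> 4 * ennreal (s\<^sup>2)"
    using ennreal_leI[of 1 "4 * s\<^sup>2"] by (simp add: ennreal_mult)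
  then have "1 * ?I \<le> 4 * ennreal (s\<^sup>2) * ?I" by (rule mult_right_mono) simp
  also have "\<dots> \<le> 4 * (\<integral>\<^sup>+x. G x * indicator S x \<partial>lborel)"
    using nn_integral_affine_le[where s=s, OF m _ sub] s by (simp add: mult.assoc mult_left_mono)
  finally show ?thesis by simp
qed

text \<open>For \<open>s \<le> 1/2\<close> the point \<open>y + s (x - y)\<close> is substituted for \<open>y\<close>, otherwise for \<open>x\<close>. The Jacobian
  is then at least \<open>1/4\<close>, so the singular kernel of a Riesz potential never appears.\<close>

lemma segment_average_bound:
  fixes G :: "real^2 \<Rightarrow> ennreal"
  assumes [measurable]: "G \<in> borel_measurable borel" "S \<in> sets borel" "B \<in> sets borel"
    and seg: "\<And>x y s. x \<in> S \<Longrightarrow> y \<in> B \<Longrightarrow> 0 \<le> s \<Longrightarrow> s \<le> 1 \<Longrightarrow> y + s *\<^sub>R (x - y) \<in> S"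
  shows "(\<integral>\<^sup>+x. (\<integral>\<^sup>+y. (\<integral>\<^sup>+s. G (y + s *\<^sub>R (x - y)) * indicator {0..1} s \<partial>lborel) * indicator B y \<partial>lborel) * indicator S x \<partial>lborel)
     \<le> 4 * (emeasure lborel S + emeasure lborel B) * (\<integral>\<^sup>+x. G x * indicator S x \<partial>lborel)"
proof -
  let ?I = "\<integral>\<^sup>+x. G x * indicator S x \<partial>lborel"
  let ?K = "\<lambda>x y s. G (y + s *\<^sub>R (x - y)) * indicator {0..1::real} s * indicator B y * indicator S x"
  have "(\<integral>\<^sup>+x. (\<integral>\<^sup>+y. (\<integral>\<^sup>+s. G (y + s *\<^sub>R (x - y)) * indicator {0..1} s \<partial>lborel) * indicator B y \<partial>lborel) * indicator S x \<partial>lborel)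
     = (\<integral>\<^sup>+x. \<integral>\<^sup>+y. \<integral>\<^sup>+s. ?K x y s \<partial>lborel \<partial>lborel \<partial>lborel)"
    by (simp add: nn_integral_multc[symmetric] del: nn_integral_multc)
  \<comment> \<open>Tonelli moves the parameter \<open>s\<close> outside, so that a single
    substitution can be chosen for each \<open>s\<close>.\<close>
  also have "\<dots> = (\<integral>\<^sup>+x. \<integral>\<^sup>+s. \<integral>\<^sup>+y. ?K x y s \<partial>lborel \<partial>lborel \<partial>lborel)"
    by (intro nn_integral_cong lborel_pair.Fubini') measurable
  also have "\<dots> = (\<integral>\<^sup>+s. \<integral>\<^sup>+x. \<integral>\<^sup>+y. ?K x y s \<partial>lborel \<partial>lborel \<partial>lborel)"
    by (intro lborel_pair.Fubini') measurable
  also have "\<dots> \<le> (\<integral>\<^sup>+s. 4 * (emeasure lborel S + emeasure lborel B) * ?I * indicator {0..1::real} s \<partial>lborel)"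
  proof (rule nn_integral_mono)
    fix s :: real
    show "(\<integral>\<^sup>+x. \<integral>\<^sup>+y. ?K x y s \<partial>lborel \<partial>lborel) \<le> 4 * (emeasure lborel S + emeasure lborel B) * ?I * indicator {0..1} s"
    proof (cases "s \<in> {0..1}")
      case s01: True
      show ?thesis
      proof (cases "s \<le> 1/2")
        case True
        have "(\<integral>\<^sup>+x. \<integral>\<^sup>+y. ?K x y s \<partial>lborel \<partial>lborel) \<le> (\<integral>\<^sup>+x. 4 * ?I * indicator S x \<partial>lborel)"
        proof (rule nn_integral_mono)
          fix x
          show "(\<integral>\<^sup>+y. ?K x y s \<partial>lborel) \<le> 4 * ?I * indicator S x"
          proof (cases "x \<in> S")
            case x: True
            have eq: "y + s *\<^sub>R (x - y) = s *\<^sub>R x + (1 - s) *\<^sub>R y" for y by (simp add: algebra_simps)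
            have "(\<integral>\<^sup>+y. G (s *\<^sub>R x + (1 - s) *\<^sub>R y) * indicator B y \<partial>lborel) \<le> 4 * ?I"
              by (rule nn_integral_affine_le4) (use True s01 seg[OF x] in \<open>auto simp: eq[symmetric]\<close>)
            then show ?thesis using x s01 by (simp add: eq)
          qed simp
        qed
        also have "\<dots> = 4 * ?I * emeasure lborel S" by (simp add: nn_integral_cmult_indicator)
        also have "\<dots> \<le> 4 * (emeasure lborel S + emeasure lborel B) * ?I"
          by (simp add: mult_ac mult_left_mono distrib_left)
        finally show ?thesis using s01 by simp
      next
        case False
        have "(\<integral>\<^sup>+x. \<integral>\<^sup>+y. ?K x y s \<partial>lborel \<partial>lborel) = (\<integral>\<^sup>+y. \<integral>\<^sup>+x. ?K x y s \<partial>lborel \<partial>lborel)"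
          by (intro lborel_pair.Fubini') measurable
        also have "\<dots> \<le> (\<integral>\<^sup>+y. 4 * ?I * indicator B y \<partial>lborel)"
        proof (rule nn_integral_mono)
          fix y
          show "(\<integral>\<^sup>+x. ?K x y s \<partial>lborel) \<le> 4 * ?I * indicator B y"
          proof (cases "y \<in> B")
            case y: True
            have eq: "y + s *\<^sub>R (x - y) = (1 - s) *\<^sub>R y + s *\<^sub>R x" for x by (simp add: algebra_simps)
            have "(\<integral>\<^sup>+x. G ((1 - s) *\<^sub>R y + s *\<^sub>R x) * indicator S x \<partial>lborel) \<le> 4 * ?I"
              by (rule nn_integral_affine_le4) (use False s01 seg[OF _ y] in \<open>auto simp: eq[symmetric]\<close>)
            then show ?thesis using y s01 by (simp add: eq)
          qed simp
        qed
        also have "\<dots> = 4 * ?I * emeasure lborel B" by (simp add: nn_integral_cmult_indicator)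
        also have "\<dots> \<le> 4 * (emeasure lborel S + emeasure lborel B) * ?I"
          by (simp add: mult_ac mult_left_mono distrib_left)
        finally show ?thesis using s01 by simp
      qed
    qed simp
  qed
  also have "\<dots> = 4 * (emeasure lborel S + emeasure lborel B) * ?I"
    by (simp add: nn_integral_cmult_indicator)
  finally show ?thesis .
qed

subsection \<open>Poincare and Sobolev inequalities on star-shaped sets\<close>

text \<open>With extended nonnegative values no integrability has to be carried along; finiteness
  enters only with the bound by the Sobolev seminorm.\<close>

definition sq_integral :: "(real^2) set \<Rightarrow> (real^2 \<Rightarrow> real) \<Rightarrow> ennreal" where
  "sq_integral A f = (\<integral>\<^sup>+x. ennreal ((f x)\<^sup>2) * indicator A x \<partial>lborel)"

lemma norm_sq_2: "(norm (v::real^2))\<^sup>2 = (v$1)\<^sup>2 + (v$2)\<^sup>2"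
  by (simp only: power2_norm_eq_inner) (simp add: inner_vec_def UNIV_2 power2_eq_square)

lemma cauchy_2: "(a * x + b * y)\<^sup>2 \<le> (a\<^sup>2 + b\<^sup>2) * (x\<^sup>2 + y\<^sup>2)" for a b x y :: real
proof -
  have "(a\<^sup>2 + b\<^sup>2) * (x\<^sup>2 + y\<^sup>2) - (a * x + b * y)\<^sup>2 = (a * y - b * x)\<^sup>2"
    by (simp add: power2_eq_square algebra_simps)
  moreover have "0 \<le> (a * y - b * x)\<^sup>2" by simp
  ultimately show ?thesis by linarith
qed

lemma three_square_sum: "(a + b + c)\<^sup>2 \<le> 3 * a\<^sup>2 + 3 * b\<^sup>2 + 3 * c\<^sup>2" for a b c :: real
  using zero_le_power2[of "a - b"] zero_le_power2[of "b - c"] zero_le_power2[of "a - c"]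
  by (simp add: power2_eq_square algebra_simps)

text \<open>The cross term in \<open>(a - f y)\<^sup>2\<close> integrates to zero, and the square of
  \<open>f\<close> only adds. A single value is thus dominated by its differences to the values on
  \<open>B\<close>.\<close>

lemma mean_zero_pointwise:
  fixes f :: "real^2 \<Rightarrow> real"
  assumes c: "continuous_on UNIV f" and B: "compact B" and mean: "(\<integral>y. indicator B y * f y \<partial>lborel) = 0"
  shows "emeasure lborel B * ennreal (a\<^sup>2) \<le> (\<integral>\<^sup>+y. ennreal ((a - f y)\<^sup>2) * indicator B y \<partial>lborel)"
proof -
  have i1: "integrable lborel (\<lambda>y. indicator B y * f y)"
    using borel_integrable_compact[OF B continuous_on_subset[OF c]] by simp
  have i2: "integrable lborel (\<lambda>y. indicator B y * (f y)\<^sup>2)"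
    using borel_integrable_compact[OF B continuous_on_power[OF continuous_on_subset[OF c]]] by simp
  have i0: "integrable lborel (\<lambda>y. indicator B y * a\<^sup>2)"
    using borel_integrable_compact[OF B continuous_on_const[of B "a\<^sup>2"]] by simp
  have eq: "(a - f y)\<^sup>2 * indicator B y = indicator B y * a\<^sup>2 - 2 * a * (indicator B y * f y) + indicator B y * (f y)\<^sup>2" for y
    by (simp add: power2_diff algebra_simps)
  have int: "integrable lborel (\<lambda>y. (a - f y)\<^sup>2 * indicator B y)"
    unfolding eq by (intro Bochner_Integration.integrable_add Bochner_Integration.integrable_diff i0 i2 integrable_mult_right i1)
  have "(\<integral>y. (a - f y)\<^sup>2 * indicator B y \<partial>lborel)
      = (\<integral>y. indicator B y * a\<^sup>2 \<partial>lborel) - 2 * a * (\<integral>y. indicator B y * f y \<partial>lborel) + (\<integral>y. indicator B y * (f y)\<^sup>2 \<partial>lborel)"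
    unfolding eq using i0 i1 i2 by simp
  also have "\<dots> \<ge> measure lborel B * a\<^sup>2"
    using mean B by (simp add: integral_nonneg_AE mult.commute)
  finally have "measure lborel B * a\<^sup>2 \<le> (\<integral>y. (a - f y)\<^sup>2 * indicator B y \<partial>lborel)" .
  then have "ennreal (measure lborel B * a\<^sup>2) \<le> ennreal (\<integral>y. (a - f y)\<^sup>2 * indicator B y \<partial>lborel)"
    by (rule ennreal_leI)
  also have "\<dots> = (\<integral>\<^sup>+y. ennreal ((a - f y)\<^sup>2 * indicator B y) \<partial>lborel)"
    by (rule nn_integral_eq_integral[OF int, symmetric]) auto
  finally have "ennreal (measure lborel B * a\<^sup>2) \<le> (\<integral>\<^sup>+y. ennreal ((a - f y)\<^sup>2) * indicator B y \<partial>lborel)"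
    unfolding nn_integral_set_ennreal .
  moreover have "emeasure lborel B = ennreal (measure lborel B)"
    using emeasure_compact_finite[OF B] by (simp add: emeasure_eq_ennreal_measure less_top)
  ultimately show ?thesis by (simp add: ennreal_mult)
qed

text \<open>The difference is the integral of the derivative along the segment. Jensen moves the
  square under the integral, and Cauchy-Schwarz separates the length of the segment from the
  gradient.\<close>

lemma first_order_pointwise:
  assumes U: "jet U" and d: "dist x y \<le> d"
  shows "ennreal ((U i j x - U i j y)\<^sup>2)
     \<le> ennreal (d\<^sup>2) * (\<integral>\<^sup>+s. ennreal ((U (Suc i) j (y + s *\<^sub>R (x - y)))\<^sup>2 + (U i (Suc j) (y + s *\<^sub>R (x - y)))\<^sup>2) * indicator {0..1} s \<partial>lborel)"
proof -
  define v where "v = x - y"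
  define \<phi> where "\<phi> s = U (Suc i) j (y + s *\<^sub>R v) * v$1 + U i (Suc j) (y + s *\<^sub>R v) * v$2" for s
  define G where "G s = (U (Suc i) j (y + s *\<^sub>R v))\<^sup>2 + (U i (Suc j) (y + s *\<^sub>R v))\<^sup>2" for s
  have cont: "continuous_on UNIV (\<lambda>s. U a b (y + s *\<^sub>R v))" for a b
    by (rule continuous_on_compose2[OF jet_continuous[OF U, of UNIV]]) (auto intro!: continuous_intros)
  have c\<phi>: "continuous_on UNIV \<phi>" unfolding \<phi>_def by (intro continuous_intros cont)
  have [measurable]: "G \<in> borel_measurable borel"
    unfolding G_def by (rule borel_measurable_continuous_onI) (intro continuous_intros cont)
  have "(\<phi> has_integral (U i j (y + 1 *\<^sub>R v) - U i j (y + 0 *\<^sub>R v))) {0..1}"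
    unfolding \<phi>_def
    by (rule fundamental_theorem_of_calculus)
      (auto simp: has_real_derivative_iff_has_vector_derivative[symmetric]
        intro!: DERIV_subset[OF jet_along_segment[OF U]])
  then have "(\<phi> has_integral (U i j x - U i j y)) {0..1}" by (simp add: v_def)
  from square_integral_le[OF c\<phi> this]
  have "ennreal ((U i j x - U i j y)\<^sup>2) \<le> (\<integral>\<^sup>+s. ennreal ((\<phi> s)\<^sup>2) * indicator {0..1} s \<partial>lborel)" .
  also have "\<dots> \<le> (\<integral>\<^sup>+s. ennreal (d\<^sup>2) * (ennreal (G s) * indicator {0..1} s) \<partial>lborel)"
  proof (rule nn_integral_mono)
    fix s
    have "(norm v)\<^sup>2 \<le> d\<^sup>2" using d by (intro power_mono) (auto simp: v_def dist_norm)
    then have "(\<phi> s)\<^sup>2 \<le> G s * d\<^sup>2"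
      unfolding \<phi>_def G_def using cauchy_2[of _ "v$1" _ "v$2"]
      by (intro order_trans[OF cauchy_2] mult_left_mono) (auto simp: norm_sq_2)
    then have "ennreal ((\<phi> s)\<^sup>2) \<le> ennreal (d\<^sup>2) * ennreal (G s)"
      by (subst ennreal_mult[symmetric]) (auto simp: G_def mult.commute intro!: ennreal_leI)
    then show "ennreal ((\<phi> s)\<^sup>2) * indicator {0..1} s \<le> ennreal (d\<^sup>2) * (ennreal (G s) * indicator {0..1} s)"
      by (simp add: mult.assoc[symmetric] mult_right_mono)
  qed
  also have "\<dots> = ennreal (d\<^sup>2) * (\<integral>\<^sup>+s. ennreal (G s) * indicator {0..1} s \<partial>lborel)"
    by (rule nn_integral_cmult) measurable
  finally show ?thesis unfolding G_def v_def .
qed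

text \<open>Mean zero replaces the value at \<open>x\<close> by differences to the points of
  \<open>B\<close>, these become averages of the gradient along segments, and
  \<open>segment_average_bound\<close> removes the segments. The area of \<open>B\<close> is kept as
  a factor and cancelled only when its ratio to the area of \<open>S\<close> is known.\<close>

lemma poincare:
  assumes U: "jet U" and S[measurable]: "S \<in> sets borel" and B: "compact B"
    and seg: "\<And>x y s. x \<in> S \<Longrightarrow> y \<in> B \<Longrightarrow> 0 \<le> s \<Longrightarrow> s \<le> 1 \<Longrightarrow> y + s *\<^sub>R (x - y) \<in> S"
    and d: "\<And>x y. x \<in> S \<Longrightarrow> y \<in> B \<Longrightarrow> dist x y \<le> d"
    and mean: "(\<integral>y. indicator B y * U i j y \<partial>lborel) = 0"
  shows "emeasure lborel B * sq_integral S (U i j)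
    \<le> ennreal (d\<^sup>2) * (4 * (emeasure lborel S + emeasure lborel B) * (sq_integral S (U (Suc i) j) + sq_integral S (U i (Suc j))))"
proof -
  note [measurable] = jet_measurable[OF U] borel_compact[OF B]
  define G where "G x = ennreal ((U (Suc i) j x)\<^sup>2 + (U i (Suc j) x)\<^sup>2)" for x
  have [measurable]: "G \<in> borel_measurable borel" unfolding G_def by measurable
  have "emeasure lborel B * sq_integral S (U i j)
      = (\<integral>\<^sup>+x. (emeasure lborel B * ennreal ((U i j x)\<^sup>2)) * indicator S x \<partial>lborel)"
    unfolding sq_integral_def by (subst nn_integral_cmult[symmetric]) (auto simp: mult.assoc)
  also have "\<dots> \<le> (\<integral>\<^sup>+x. (\<integral>\<^sup>+y. ennreal ((U i j x - U i j y)\<^sup>2) * indicator B y \<partial>lborel) * indicator S x \<partial>lborel)"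
    by (intro nn_integral_mono mult_right_mono mean_zero_pointwise jet_continuous U B mean) auto
  also have "\<dots> \<le> (\<integral>\<^sup>+x. (\<integral>\<^sup>+y. ennreal (d\<^sup>2) * ((\<integral>\<^sup>+s. G (y + s *\<^sub>R (x - y)) * indicator {0..1} s \<partial>lborel) * indicator B y) \<partial>lborel) * indicator S x \<partial>lborel)"
  proof (rule nn_integral_mono)
    fix x
    show "(\<integral>\<^sup>+y. ennreal ((U i j x - U i j y)\<^sup>2) * indicator B y \<partial>lborel) * indicator S x
      \<le> (\<integral>\<^sup>+y. ennreal (d\<^sup>2) * ((\<integral>\<^sup>+s. G (y + s *\<^sub>R (x - y)) * indicator {0..1} s \<partial>lborel) * indicator B y) \<partial>lborel) * indicator S x"
    proof (cases "x \<in> S")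
      case x: True
      have "(\<integral>\<^sup>+y. ennreal ((U i j x - U i j y)\<^sup>2) * indicator B y \<partial>lborel)
        \<le> (\<integral>\<^sup>+y. ennreal (d\<^sup>2) * ((\<integral>\<^sup>+s. G (y + s *\<^sub>R (x - y)) * indicator {0..1} s \<partial>lborel) * indicator B y) \<partial>lborel)"
      proof (rule nn_integral_mono)
        fix y
        show "ennreal ((U i j x - U i j y)\<^sup>2) * indicator B y
          \<le> ennreal (d\<^sup>2) * ((\<integral>\<^sup>+s. G (y + s *\<^sub>R (x - y)) * indicator {0..1} s \<partial>lborel) * indicator B y)"
        proof (cases "y \<in> B")
          case True
          then show ?thesis unfolding G_def using first_order_pointwise[OF U d[OF x True], of i j] by simp
        qed simp
      qed
      then show ?thesis using x by simp
    qed simp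
  qed
  also have "\<dots> = ennreal (d\<^sup>2) * (\<integral>\<^sup>+x. (\<integral>\<^sup>+y. (\<integral>\<^sup>+s. G (y + s *\<^sub>R (x - y)) * indicator {0..1} s \<partial>lborel) * indicator B y \<partial>lborel) * indicator S x \<partial>lborel)"
    by (simp add: nn_integral_cmult mult.assoc)
  also have "\<dots> \<le> ennreal (d\<^sup>2) * (4 * (emeasure lborel S + emeasure lborel B) * (\<integral>\<^sup>+x. G x * indicator S x \<partial>lborel))"
    by (intro mult_left_mono segment_average_bound seg) (auto)
  also have "(\<integral>\<^sup>+x. G x * indicator S x \<partial>lborel) = sq_integral S (U (Suc i) j) + sq_integral S (U i (Suc j))"
    unfolding G_def sq_integral_def
    by (subst nn_integral_add[symmetric]) (auto simp: ring_distribs intro!: nn_integral_cong)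
  finally show ?thesis .
qed

text \<open>Taylor's formula with integral remainder, squared. The weight
  \<open>(1 - s)\<^sup>2\<close> is kept under the integral because it is the Jacobian of
  \<open>y \<mapsto> y + s (x - y)\<close>, the substitution made afterwards.\<close>

lemma second_order_pointwise:
  assumes U: "jet U" and d: "dist x y \<le> d"
  shows "ennreal ((U i j x)\<^sup>2) \<le> 3 * (ennreal ((U i j y)\<^sup>2)
      + ennreal (d\<^sup>2) * ennreal ((U (Suc i) j y)\<^sup>2 + (U i (Suc j) y)\<^sup>2)
      + 2 * ennreal (d^4) * (\<integral>\<^sup>+s. ennreal ((1 - s)\<^sup>2) * ennreal ((U (Suc (Suc i)) j (y + s *\<^sub>R (x - y)))\<^sup>2
           + (U (Suc i) (Suc j) (y + s *\<^sub>R (x - y)))\<^sup>2 + (U i (Suc (Suc j)) (y + s *\<^sub>R (x - y)))\<^sup>2) * indicator {0..1} s \<partial>lborel))"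
proof -
  define v where "v = x - y"
  define u where "u a b s = U a b (y + s *\<^sub>R v)" for a b s
  have der: "(u a b has_real_derivative (u (Suc a) b s * v$1 + u a (Suc b) s * v$2)) (at s)" for a b s
    unfolding u_def by (rule jet_along_segment[OF U])
  have cont: "continuous_on UNIV (u a b)" for a b
    using der by (meson DERIV_isCont continuous_at_imp_continuous_on)
  define \<phi> where "\<phi> s = (1 - s) * ((u (Suc (Suc i)) j s * v$1 + u (Suc i) (Suc j) s * v$2) * v$1
      + (u (Suc i) (Suc j) s * v$1 + u i (Suc (Suc j)) s * v$2) * v$2)" for s
  define G where "G s = (u (Suc (Suc i)) j s)\<^sup>2 + (u (Suc i) (Suc j) s)\<^sup>2 + (u i (Suc (Suc j)) s)\<^sup>2" for s
  \<comment> \<open>In the derivative of \<open>\<psi>\<close> the first derivatives of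
    \<open>u i j\<close> cancel, so its increment over the unit interval is exactly the second-order
    remainder.\<close>
  define \<psi> where "\<psi> s = u i j s + (1 - s) * (u (Suc i) j s * v$1 + u i (Suc j) s * v$2)" for s
  have c\<phi>: "continuous_on UNIV \<phi>" unfolding \<phi>_def by (intro continuous_intros cont)
  have [measurable]: "G \<in> borel_measurable borel"
    unfolding G_def by (rule borel_measurable_continuous_onI) (intro continuous_intros cont)
  have d\<psi>: "(\<psi> has_real_derivative \<phi> s) (at s)" for s
  proof -
    define p where "p s = u (Suc i) j s * v$1 + u i (Suc j) s * v$2" for s
    define q where "q s = (u (Suc (Suc i)) j s * v$1 + u (Suc i) (Suc j) s * v$2) * v$1
      + (u (Suc i) (Suc j) s * v$1 + u i (Suc (Suc j)) s * v$2) * v$2" for s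
    have dp: "(p has_real_derivative q s) (at s)"
      unfolding p_def q_def by (intro DERIV_add DERIV_cmult_right der)
    have d1: "((\<lambda>s::real. 1 - s) has_real_derivative 0 - 1) (at s)"
      by (intro DERIV_diff DERIV_const DERIV_ident)
    have "((\<lambda>s. u i j s + (1 - s) * p s) has_real_derivative
        p s + ((0 - 1) * p s + q s * (1 - s))) (at s)"
      using DERIV_add[OF der[of i j s] DERIV_mult[OF d1 dp]] unfolding p_def .
    moreover have "p s + ((0 - 1) * p s + q s * (1 - s)) = \<phi> s"
      unfolding \<phi>_def q_def[symmetric] by simp
    moreover have "(\<lambda>s. u i j s + (1 - s) * p s) = \<psi>" unfolding \<psi>_def p_def ..
    ultimately show ?thesis by simp
  qed
  have "(\<phi> has_integral (\<psi> 1 - \<psi> 0)) {0..1}"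
    by (rule fundamental_theorem_of_calculus)
      (auto simp: has_real_derivative_iff_has_vector_derivative[symmetric] intro!: DERIV_subset[OF d\<psi>])
  from square_integral_le[OF c\<phi> this]
  have I: "ennreal ((\<psi> 1 - \<psi> 0)\<^sup>2) \<le> (\<integral>\<^sup>+s. ennreal ((\<phi> s)\<^sup>2) * indicator {0..1} s \<partial>lborel)" .
  have vd: "(norm v)\<^sup>2 \<le> d\<^sup>2" using d by (intro power_mono) (auto simp: v_def dist_norm)
  have "(\<integral>\<^sup>+s. ennreal ((\<phi> s)\<^sup>2) * indicator {0..1} s \<partial>lborel)
      \<le> (\<integral>\<^sup>+s. 2 * ennreal (d^4) * (ennreal ((1 - s)\<^sup>2) * ennreal (G s) * indicator {0..1} s) \<partial>lborel)"
  proof (rule nn_integral_mono)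
    fix s
    define p where "p = u (Suc (Suc i)) j s * v$1 + u (Suc i) (Suc j) s * v$2"
    define q where "q = u (Suc i) (Suc j) s * v$1 + u i (Suc (Suc j)) s * v$2"
    have n: "(v$1)\<^sup>2 + (v$2)\<^sup>2 \<le> d\<^sup>2" using vd by (simp add: norm_sq_2)
    \<comment> \<open>The mixed derivative occurs in both rows of the Hessian, whence the factor 2
      in front of \<open>G\<close>.\<close>
    have "p\<^sup>2 + q\<^sup>2 \<le> ((u (Suc (Suc i)) j s)\<^sup>2 + (u (Suc i) (Suc j) s)\<^sup>2) * d\<^sup>2
        + ((u (Suc i) (Suc j) s)\<^sup>2 + (u i (Suc (Suc j)) s)\<^sup>2) * d\<^sup>2"
      unfolding p_def q_def using n
      by (intro add_mono order_trans[OF cauchy_2] mult_left_mono) auto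
    also have "\<dots> \<le> (2 * G s) * d\<^sup>2" unfolding G_def ring_distribs by simp
    finally have pq: "p\<^sup>2 + q\<^sup>2 \<le> (2 * G s) * d\<^sup>2" .
    have "(p * v$1 + q * v$2)\<^sup>2 \<le> (p\<^sup>2 + q\<^sup>2) * d\<^sup>2"
      using n by (intro order_trans[OF cauchy_2] mult_left_mono) auto
    also have "\<dots> \<le> ((2 * G s) * d\<^sup>2) * d\<^sup>2" using pq by (intro mult_right_mono) auto
    also have "\<dots> = 2 * d^4 * G s" by (simp add: power4_eq_xxxx power2_eq_square)
    finally have "(p * v$1 + q * v$2)\<^sup>2 \<le> 2 * d^4 * G s" .
    then have "(1 - s)\<^sup>2 * (p * v$1 + q * v$2)\<^sup>2 \<le> (1 - s)\<^sup>2 * (2 * d^4 * G s)" by (rule mult_left_mono) simp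
    then have "(\<phi> s)\<^sup>2 \<le> 2 * d^4 * ((1 - s)\<^sup>2 * G s)"
      unfolding \<phi>_def p_def q_def by (simp add: power_mult_distrib mult_ac)
    then have "ennreal ((\<phi> s)\<^sup>2) \<le> ennreal (2 * d^4 * ((1 - s)\<^sup>2 * G s))" by (rule ennreal_leI)
    also have "\<dots> = 2 * ennreal (d^4) * (ennreal ((1 - s)\<^sup>2) * ennreal (G s))"
      by (simp add: ennreal_mult G_def)
    finally show "ennreal ((\<phi> s)\<^sup>2) * indicator {0..1} s
      \<le> 2 * ennreal (d^4) * (ennreal ((1 - s)\<^sup>2) * ennreal (G s) * indicator {0..1} s)"
      by (simp add: mult.assoc[symmetric] mult_right_mono)
  qed
  also have "\<dots> = 2 * ennreal (d^4) * (\<integral>\<^sup>+s. ennreal ((1 - s)\<^sup>2) * ennreal (G s) * indicator {0..1} s \<partial>lborel)"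
    by (rule nn_integral_cmult) measurable
  finally have II: "ennreal ((\<psi> 1 - \<psi> 0)\<^sup>2) \<le> \<dots>" using I by (rule order_trans[rotated])
  define t where "t = u (Suc i) j 0 * v$1 + u i (Suc j) 0 * v$2"
  have t: "t\<^sup>2 \<le> d\<^sup>2 * ((U (Suc i) j y)\<^sup>2 + (U i (Suc j) y)\<^sup>2)"
  proof -
    have "t\<^sup>2 \<le> ((U (Suc i) j y)\<^sup>2 + (U i (Suc j) y)\<^sup>2) * ((v$1)\<^sup>2 + (v$2)\<^sup>2)"
      unfolding t_def u_def using cauchy_2 by simp
    also have "\<dots> \<le> ((U (Suc i) j y)\<^sup>2 + (U i (Suc j) y)\<^sup>2) * d\<^sup>2"
      by (rule mult_left_mono) (use vd in \<open>simp_all add: norm_sq_2\<close>)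
    finally show ?thesis by (simp add: mult.commute)
  qed
  have "U i j x = U i j y + t + (\<psi> 1 - \<psi> 0)"
    by (simp add: \<psi>_def t_def u_def v_def)
  then have "(U i j x)\<^sup>2 \<le> 3 * ((U i j y)\<^sup>2 + t\<^sup>2 + (\<psi> 1 - \<psi> 0)\<^sup>2)"
    using three_square_sum[of "U i j y" t "\<psi> 1 - \<psi> 0"] by simp
  also have "\<dots> \<le> 3 * ((U i j y)\<^sup>2 + d\<^sup>2 * ((U (Suc i) j y)\<^sup>2 + (U i (Suc j) y)\<^sup>2) + (\<psi> 1 - \<psi> 0)\<^sup>2)"
    using t by simp
  finally have "ennreal ((U i j x)\<^sup>2) \<le> ennreal (3 * ((U i j y)\<^sup>2 + d\<^sup>2 * ((U (Suc i) j y)\<^sup>2 + (U i (Suc j) y)\<^sup>2) + (\<psi> 1 - \<psi> 0)\<^sup>2))"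
    by (rule ennreal_leI)
  also have "\<dots> = 3 * (ennreal ((U i j y)\<^sup>2) + ennreal (d\<^sup>2) * ennreal ((U (Suc i) j y)\<^sup>2 + (U i (Suc j) y)\<^sup>2) + ennreal ((\<psi> 1 - \<psi> 0)\<^sup>2))"
    by (simp add: ennreal_mult ennreal_plus del: ennreal_plus[symmetric])
  also have "\<dots> \<le> 3 * (ennreal ((U i j y)\<^sup>2) + ennreal (d\<^sup>2) * ennreal ((U (Suc i) j y)\<^sup>2 + (U i (Suc j) y)\<^sup>2)
      + 2 * ennreal (d^4) * (\<integral>\<^sup>+s. ennreal ((1 - s)\<^sup>2) * ennreal (G s) * indicator {0..1} s \<partial>lborel))"
    by (intro mult_left_mono add_left_mono II) auto
  finally show ?thesis unfolding G_def u_def v_def .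
qed

text \<open>Taylor's formula at \<open>x\<close> is averaged over expansion points \<open>y\<close>
  in \<open>B\<close>. For fixed \<open>s\<close> the substitution
  \<open>y \<mapsto> y + s (x - y)\<close> has Jacobian \<open>(1 - s)\<^sup>2\<close>, precisely
  the weight of the squared remainder. This match is special to the plane and is the reason why two
  derivatives suffice.\<close>

lemma sobolev_sup:
  assumes U: "jet U" and S[measurable]: "S \<in> sets borel" and B[measurable]: "B \<in> sets borel" and BS: "B \<subseteq> S"
    and seg: "\<And>x y s. x \<in> S \<Longrightarrow> y \<in> B \<Longrightarrow> 0 \<le> s \<Longrightarrow> s \<le> 1 \<Longrightarrow> y + s *\<^sub>R (x - y) \<in> S"
    and d: "\<And>x y. x \<in> S \<Longrightarrow> y \<in> B \<Longrightarrow> dist x y \<le> d"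
    and x: "x \<in> S"
  shows "emeasure lborel B * ennreal ((U i j x)\<^sup>2)
    \<le> 3 * (sq_integral S (U i j) + ennreal (d\<^sup>2) * (sq_integral S (U (Suc i) j) + sq_integral S (U i (Suc j)))
      + 2 * ennreal (d^4) * (sq_integral S (U (Suc (Suc i)) j) + sq_integral S (U (Suc i) (Suc j)) + sq_integral S (U i (Suc (Suc j)))))"
proof -
  note [measurable] = jet_measurable[OF U]
  define G where "G z = ennreal ((U (Suc (Suc i)) j z)\<^sup>2 + (U (Suc i) (Suc j) z)\<^sup>2 + (U i (Suc (Suc j)) z)\<^sup>2)" for z
  define G1 where "G1 z = ennreal ((U (Suc i) j z)\<^sup>2 + (U i (Suc j) z)\<^sup>2)" for z
  have [measurable]: "G \<in> borel_measurable borel" "G1 \<in> borel_measurable borel" unfolding G_def G1_def by measurable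
  have GS: "(\<integral>\<^sup>+y. G y * indicator S y \<partial>lborel)
      = sq_integral S (U (Suc (Suc i)) j) + sq_integral S (U (Suc i) (Suc j)) + sq_integral S (U i (Suc (Suc j)))"
    unfolding G_def sq_integral_def
    by (subst nn_integral_add[symmetric], measurable)+ (auto simp: ring_distribs intro!: nn_integral_cong)
  have GS1: "(\<integral>\<^sup>+y. G1 y * indicator S y \<partial>lborel) = sq_integral S (U (Suc i) j) + sq_integral S (U i (Suc j))"
    unfolding G1_def sq_integral_def
    by (subst nn_integral_add[symmetric], measurable)+ (auto simp: ring_distribs intro!: nn_integral_cong)
  let ?T = "\<lambda>y. \<integral>\<^sup>+s. ennreal ((1 - s)\<^sup>2) * G (y + s *\<^sub>R (x - y)) * indicator {0..1} s \<partial>lborel"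
  have "emeasure lborel B * ennreal ((U i j x)\<^sup>2) = (\<integral>\<^sup>+y. ennreal ((U i j x)\<^sup>2) * indicator B y \<partial>lborel)"
    by (subst nn_integral_cmult_indicator) (simp_all add: mult.commute)
  also have "\<dots> \<le> (\<integral>\<^sup>+y. 3 * (ennreal ((U i j y)\<^sup>2) * indicator B y + ennreal (d\<^sup>2) * (G1 y * indicator B y)
      + 2 * ennreal (d^4) * (?T y * indicator B y)) \<partial>lborel)"
  proof (rule nn_integral_mono)
    fix y
    show "ennreal ((U i j x)\<^sup>2) * indicator B y \<le> 3 * (ennreal ((U i j y)\<^sup>2) * indicator B y + ennreal (d\<^sup>2) * (G1 y * indicator B y)
      + 2 * ennreal (d^4) * (?T y * indicator B y))"
      unfolding G_def G1_def
      by (cases "y \<in> B") (use second_order_pointwise[OF U d[OF x], of y i j] in auto)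
  qed
  also have "\<dots> = 3 * ((\<integral>\<^sup>+y. ennreal ((U i j y)\<^sup>2) * indicator B y \<partial>lborel) + ennreal (d\<^sup>2) * (\<integral>\<^sup>+y. G1 y * indicator B y \<partial>lborel)
      + 2 * ennreal (d^4) * (\<integral>\<^sup>+y. ?T y * indicator B y \<partial>lborel))"
    by (simp add: nn_integral_cmult nn_integral_add)
  also have "\<dots> \<le> 3 * (sq_integral S (U i j) + ennreal (d\<^sup>2) * (\<integral>\<^sup>+y. G1 y * indicator S y \<partial>lborel)
      + 2 * ennreal (d^4) * (\<integral>\<^sup>+y. G y * indicator S y \<partial>lborel))"
  proof -
    have "(\<integral>\<^sup>+y. ?T y * indicator B y \<partial>lborel)
        = (\<integral>\<^sup>+y. \<integral>\<^sup>+s. ennreal ((1 - s)\<^sup>2) * G (y + s *\<^sub>R (x - y)) * indicator {0..1::real} s * indicator B y \<partial>lborel \<partial>lborel)"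
      by (simp add: nn_integral_multc)
    also have "\<dots> = (\<integral>\<^sup>+s. \<integral>\<^sup>+y. ennreal ((1 - s)\<^sup>2) * G (y + s *\<^sub>R (x - y)) * indicator {0..1::real} s * indicator B y \<partial>lborel \<partial>lborel)"
      by (intro lborel_pair.Fubini') measurable
    also have "\<dots> \<le> (\<integral>\<^sup>+s. (\<integral>\<^sup>+y. G y * indicator S y \<partial>lborel) * indicator {0..1::real} s \<partial>lborel)"
    proof (rule nn_integral_mono)
      fix s :: real
      have eq: "y + s *\<^sub>R (x - y) = s *\<^sub>R x + (1 - s) *\<^sub>R y" for y by (simp add: algebra_simps)
      show "(\<integral>\<^sup>+y. ennreal ((1 - s)\<^sup>2) * G (y + s *\<^sub>R (x - y)) * indicator {0..1::real} s * indicator B y \<partial>lborel)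
        \<le> (\<integral>\<^sup>+y. G y * indicator S y \<partial>lborel) * indicator {0..1::real} s"
      \<comment> \<open>At \<open>s = 1\<close> the substitution degenerates, but there the weight
        is zero.\<close>
      proof (cases "s \<in> {0..1} \<and> s \<noteq> 1")
        case True
        have "(\<integral>\<^sup>+y. ennreal ((1 - s)\<^sup>2) * G (y + s *\<^sub>R (x - y)) * indicator {0..1::real} s * indicator B y \<partial>lborel)
          = ennreal ((1 - s)\<^sup>2) * (\<integral>\<^sup>+y. G (s *\<^sub>R x + (1 - s) *\<^sub>R y) * indicator B y \<partial>lborel)"
          using True by (simp add: nn_integral_cmult mult.assoc eq)
        also have "\<dots> \<le> (\<integral>\<^sup>+y. G y * indicator S y \<partial>lborel)"
          by (rule nn_integral_affine_le) (use True seg[OF x] in \<open>auto simp: eq[symmetric]\<close>)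
        finally show ?thesis using True by simp
      next
        case False
        then show ?thesis by (cases "s = 1") auto
      qed
    qed
    also have "\<dots> = (\<integral>\<^sup>+y. G y * indicator S y \<partial>lborel)" by (simp add: nn_integral_cmult_indicator)
    finally have T: "(\<integral>\<^sup>+y. ?T y * indicator B y \<partial>lborel) \<le> (\<integral>\<^sup>+y. G y * indicator S y \<partial>lborel)" .
    show ?thesis
      unfolding sq_integral_def using BS
      by (intro mult_left_mono add_mono T nn_set_integral_set_mono) auto
  qed
  finally show ?thesis unfolding GS GS1 .
qed

subsection \<open>Subtraction of a polynomial with prescribed mean derivatives\<close>

text \<open>Monomials and the smoothing kernel are both products of functions of one coordinate, so
  their jets come from two sequences of ordinary derivatives.\<close>

lemma jet_tensor:
  assumes f: "\<And>i s. (f i has_real_derivative f (Suc i) s) (at s)"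
    and g: "\<And>i s. (g i has_real_derivative g (Suc i) s) (at s)"
  shows "jet (\<lambda>i j x. f i (x$1) * g j (x$2))"
  unfolding jet_def
proof (intro allI)
  fix i j and x :: "real^2"
  have n: "((\<lambda>x::real^2. x$k) has_derivative (\<lambda>h. h$k)) (at x)" for k
    by (rule bounded_linear.has_derivative[OF bounded_linear_vec_nth has_derivative_ident])
  have f': "((\<lambda>x. f i (x$1)) has_derivative (\<lambda>h. f (Suc i) (x$1) * h$1)) (at x)"
    by (rule has_derivative_compose[OF n]) (use f[of i "x$1"] in \<open>simp add: has_field_derivative_def\<close>)
  have g': "((\<lambda>x. g j (x$2)) has_derivative (\<lambda>h. g (Suc j) (x$2) * h$2)) (at x)"
    by (rule has_derivative_compose[OF n]) (use g[of j "x$2"] in \<open>simp add: has_field_derivative_def\<close>)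
  show "((\<lambda>x. f i (x$1) * g j (x$2)) has_derivative
      (\<lambda>h. f (Suc i) (x$1) * g j (x$2) * h$1 + f i (x$1) * g (Suc j) (x$2) * h$2)) (at x)"
    by (rule has_derivative_eq_rhs[OF has_derivative_mult[OF f' g']]) (auto simp: algebra_simps)
qed

lemma jet_sum: "jet (\<lambda>i j x. \<Sum>k\<in>A. U k i j x)" if "\<And>k. k \<in> A \<Longrightarrow> jet (U k)"
  using that
proof (induction A rule: infinite_finite_induct)
  case (insert k A)
  then show ?case using jet_add[of "U k" "\<lambda>i j x. \<Sum>k\<in>A. U k i j x"] by simp
qed (simp_all add: jet_zero)

text \<open>The \<open>i\<close>-th derivative of \<open>s ^ a / fact a\<close>. The normalisation
  makes the derivative of order \<open>a\<close> equal to 1, so that prescribed means can be used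
  directly as coefficients.\<close>

definition power_deriv :: "nat \<Rightarrow> nat \<Rightarrow> real \<Rightarrow> real" where
  "power_deriv a i s = (if i \<le> a then s ^ (a - i) / fact (a - i) else 0)"

lemma power_deriv_has_derivative: "(power_deriv a i has_real_derivative power_deriv a (Suc i) s) (at s)"
proof (cases "i < a")
  case True
  then obtain k where k: "a - i = Suc k" by (metis Suc_diff_Suc)
  have "((\<lambda>s. s ^ Suc k / fact (Suc k)) has_real_derivative s ^ k / fact k) (at s)"
    by (rule DERIV_cong[OF DERIV_cdivide[OF DERIV_power[OF DERIV_ident]]]) (simp del: of_nat_Suc)
  moreover have "a - Suc i = k" using k by simp
  then have "power_deriv a i = (\<lambda>s. s ^ Suc k / fact (Suc k))" "power_deriv a (Suc i) s = s ^ k / fact k"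
    using True k by (auto simp: power_deriv_def fun_eq_iff)
  ultimately show ?thesis by simp
next
  case False
  then have "power_deriv a i = (\<lambda>_. if i = a then 1 else 0)" "power_deriv a (Suc i) s = 0"
    by (auto simp: power_deriv_def fun_eq_iff)
  then show ?thesis by simp
qed

text \<open>The homogeneous part of top order is fixed first: it alone determines the derivatives of
  that order. It disturbs the lower ones, which the induction hypothesis then corrects for
  \<open>U - H\<close> by a polynomial of lower degree. For \<open>n = 0\<close> the truncated
  degree \<open>n - 1\<close> is harmless, as the zero polynomial is taken.\<close>

lemma polynomial_with_mean_derivatives:
  assumes "jet U" and B: "compact B" and pos: "measure lborel B > 0"
  shows "\<exists>P. jet P \<and> P 0 0 \<in> polys (n - 1) \<and> (\<forall>i j. n \<le> i + j \<longrightarrow> P i j = (\<lambda>_. 0)) \<and>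
     (\<forall>i j. i + j < n \<longrightarrow> (\<integral>y. indicator B y * (U i j y - P i j y) \<partial>lborel) = 0)"
  using assms(1)
proof (induction n arbitrary: U)
  case 0
  show ?case by (intro exI[of _ "\<lambda>i j x. 0"]) (auto simp: jet_zero polys_zero)
next
  case (Suc n)
  have int: "integrable lborel (\<lambda>y. indicator B y * V i j y)" if "jet V" for V i j
    using borel_integrable_compact[OF B jet_continuous[OF that]] by simp
  \<comment> \<open>The mean over \<open>B\<close> of the derivative of order \<open>n\<close> with
    \<open>a\<close> differentiations in the first coordinate.\<close>
  define c where "c a = (\<integral>y. indicator B y * U a (n - a) y \<partial>lborel) / measure lborel B" for a
  define H where "H i j x = (\<Sum>a\<le>n. c a * (power_deriv a i (x$1) * power_deriv (n - a) j (x$2)))" for i j and x :: "real^2"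
  have H: "jet H" unfolding H_def
    by (intro jet_sum jet_cmult jet_tensor power_deriv_has_derivative)
  have H0: "H i j = (\<lambda>_. 0)" if "n < i + j" for i j
    using that by (auto simp: H_def power_deriv_def fun_eq_iff intro!: sum.neutral)
  have Hn: "H i j x = c i" if "i + j = n" for i j x
  proof -
    have "H i j x = (\<Sum>a\<le>n. if a = i then c a else 0)"
      unfolding H_def using that by (intro sum.cong) (auto simp: power_deriv_def)
    then show ?thesis using that by simp
  qed
  have H00: "H 0 0 \<in> polys n"
  proof -
    have "H 0 0 = (\<lambda>x. \<Sum>a\<le>n. (c a / (fact a * fact (n - a))) * ((x$1)^a * (x$2)^(n - a)))"
      unfolding H_def power_deriv_def by (intro ext sum.cong) auto
    moreover have "\<dots> \<in> polys n" by (intro polys_sum polys_scale polys_monomial) auto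
    ultimately show ?thesis by simp
  qed
  obtain P where P: "jet P" "P 0 0 \<in> polys (n - 1)" "\<forall>i j. n \<le> i + j \<longrightarrow> P i j = (\<lambda>_. 0)"
    "\<forall>i j. i + j < n \<longrightarrow> (\<integral>y. indicator B y * ((U i j y - H i j y) - P i j y) \<partial>lborel) = 0"
    using Suc.IH[OF jet_diff[OF Suc.prems H]] by (elim exE conjE)
  show ?case
  proof (intro exI[of _ "\<lambda>i j x. P i j x + H i j x"] conjI allI impI)
    show "jet (\<lambda>i j x. P i j x + H i j x)" by (rule jet_add[OF P(1) H])
    show "(\<lambda>x. P 0 0 x + H 0 0 x) \<in> polys (Suc n - 1)"
      using polys_add[OF polys_mono[OF P(2), of n] H00] by simp
    fix i j
    show "(\<lambda>x. P i j x + H i j x) = (\<lambda>_. 0)" if "Suc n \<le> i + j"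
      using P(3) H0[of i j] that by simp
    show "(\<integral>y. indicator B y * (U i j y - (P i j y + H i j y)) \<partial>lborel) = 0" if "i + j < Suc n"
    proof (cases "i + j < n")
      case True
      then show ?thesis using P(4) by (simp add: algebra_simps)
    next
      case False
      then have n: "i + j = n" using that by simp
      have "(\<integral>y. indicator B y * (U i j y - (P i j y + H i j y)) \<partial>lborel)
          = (\<integral>y. indicator B y * U i j y - indicator B y * c i \<partial>lborel)"
        using P(3) n by (simp add: Hn right_diff_distrib)
      also have "\<dots> = (\<integral>y. indicator B y * U i j y \<partial>lborel) - measure lborel B * c i"
        using int[OF Suc.prems, of i j] borel_integrable_compact[OF B continuous_on_const[of B "c i"]]
        by (simp add: mult.commute)
      also have "\<dots> = 0" using pos n by (auto simp: c_def)
      finally show ?thesis .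
    qed
  qed
qed

subsection \<open>The Bramble--Hilbert estimate for smooth functions\<close>

text \<open>The summands belong to the derivatives of order 0, 1 and 2 in the Sobolev inequality,
  with one factor \<open>8*\<kappa>\<close> for each Poincare step up to order \<open>m + 1\<close>.
  The 2 counts the first derivatives, the 6 is three second derivatives times the 2 of the Taylor
  remainder, and the outer 3 comes from squaring a sum of three terms.\<close>

definition bh_const :: "nat \<Rightarrow> real \<Rightarrow> real" where
  "bh_const m \<kappa> = 3 * ((8*\<kappa>)^(m+1) + 2 * (8*\<kappa>)^m + 6 * (8*\<kappa>)^(m-1))"

lemma bh_const_nonneg: "\<kappa> \<ge> 0 \<Longrightarrow> bh_const m \<kappa> \<ge> 0"
  by (simp add: bh_const_def)

text \<open>The Poincare inequality is iterated, by induction on the number of orders missing to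
  \<open>m + 1\<close>. A step costs \<open>8 * \<kappa> * d\<^sup>2\<close>: the 4 of that
  inequality, doubled because two derivatives of the next order appear, times the ratio of areas
  bounded by \<kappa>.\<close>

lemma mean_zero_jet_estimate:
  assumes U: "jet U" and S: "S \<in> sets borel" and B: "compact B" and BS: "B \<subseteq> S"
    and seg: "\<And>x y s. x \<in> S \<Longrightarrow> y \<in> B \<Longrightarrow> 0 \<le> s \<Longrightarrow> s \<le> 1 \<Longrightarrow> y + s *\<^sub>R (x - y) \<in> S"
    and d: "\<And>x y. x \<in> S \<Longrightarrow> y \<in> B \<Longrightarrow> dist x y \<le> d"
    and \<kappa>: "\<kappa> \<ge> 0" "emeasure lborel S + emeasure lborel B \<le> ennreal \<kappa> * emeasure lborel B"
    and pos: "emeasure lborel B \<noteq> 0"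
    and mean: "\<And>i j. i + j \<le> m \<Longrightarrow> (\<integral>y. indicator B y * U i j y \<partial>lborel) = 0"
  shows "i + j \<le> m + 1 \<Longrightarrow> sq_integral S (U i j)
    \<le> ennreal ((8 * \<kappa> * d\<^sup>2) ^ (m + 1 - (i + j))) * (\<Sum>a\<le>m+1. sq_integral S (U a (m + 1 - a)))"
proof (induction "m + 1 - (i + j)" arbitrary: i j)
  case 0
  then have "j = m + 1 - i" "i \<le> m + 1" by auto
  then have "sq_integral S (U i j) \<le> (\<Sum>a\<le>m+1. sq_integral S (U a (m + 1 - a)))"
    using member_le_sum[of i "{..m+1}" "\<lambda>a. sq_integral S (U a (m + 1 - a))"]
    by (simp del: sum.atMost_Suc)
  then show ?case using 0 by simp
next
  case (Suc n)
  let ?T = "\<Sum>a\<le>m+1. sq_integral S (U a (m + 1 - a))" and ?L = "8 * \<kappa> * d\<^sup>2"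
  have fin: "emeasure lborel B \<noteq> top" using emeasure_compact_finite[OF B] by auto
  have ih: "sq_integral S (U (Suc i) j) \<le> ennreal (?L ^ n) * ?T" "sq_integral S (U i (Suc j)) \<le> ennreal (?L ^ n) * ?T"
  proof -
    have n: "n = m + 1 - (Suc i + j)" "n = m + 1 - (i + Suc j)"
      and le: "Suc i + j \<le> m + 1" "i + Suc j \<le> m + 1"
      using Suc.hyps(2) by auto
    show "sq_integral S (U (Suc i) j) \<le> ennreal (?L ^ n) * ?T"
      using Suc.hyps(1)[OF n(1) le(1)] unfolding n(1)[symmetric] .
    show "sq_integral S (U i (Suc j)) \<le> ennreal (?L ^ n) * ?T"
      using Suc.hyps(1)[OF n(2) le(2)] unfolding n(2)[symmetric] .
  qed
  have "emeasure lborel B * sq_integral S (U i j)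
      \<le> ennreal (d\<^sup>2) * (4 * (emeasure lborel S + emeasure lborel B) * (sq_integral S (U (Suc i) j) + sq_integral S (U i (Suc j))))"
    by (rule poincare[OF U S B seg d mean]) (use Suc.hyps(2) in auto)
  also have "\<dots> \<le> ennreal (d\<^sup>2) * (4 * (ennreal \<kappa> * emeasure lborel B) * (ennreal (?L ^ n) * ?T + ennreal (?L ^ n) * ?T))"
    by (intro mult_left_mono mult_mono add_mono ih \<kappa>(2)) auto
  also have "\<dots> = emeasure lborel B * ((8 * ennreal \<kappa> * ennreal (d\<^sup>2)) * (ennreal (?L ^ n) * ?T))"
  proof -
    have e8: "(8::ennreal) = 4 * 2" by simp
    show ?thesis by (simp only: mult_2[symmetric] e8 mult_ac)
  qed
  also have "8 * ennreal \<kappa> * ennreal (d\<^sup>2) = ennreal ?L"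
    using \<kappa>(1) by (simp add: ennreal_mult)
  also have "ennreal ?L * (ennreal (?L ^ n) * ?T) = ennreal (?L ^ Suc n) * ?T"
    using \<kappa>(1) by (simp add: ennreal_mult mult.assoc)
  finally have "sq_integral S (U i j) \<le> ennreal (?L ^ Suc n) * ?T"
    using pos fin by (simp add: ennreal_mult_le_mult_iff)
  then show ?case using Suc.hyps(2) by simp
qed

text \<open>The derivatives of order \<open>m + 1\<close> of \<open>P\<close> vanish, so
  \<open>U - P\<close> has mean-zero derivatives up to order \<open>m\<close> while its top
  derivatives are still those of \<open>U\<close>.\<close>

theorem bramble_hilbert_jet:
  assumes U: "jet U" and S: "S \<in> sets borel" and B: "compact B" and BS: "B \<subseteq> S"
    and seg: "\<And>x y s. x \<in> S \<Longrightarrow> y \<in> B \<Longrightarrow> 0 \<le> s \<Longrightarrow> s \<le> 1 \<Longrightarrow> y + s *\<^sub>R (x - y) \<in> S"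
    and d: "\<And>x y. x \<in> S \<Longrightarrow> y \<in> B \<Longrightarrow> dist x y \<le> d"
    and \<kappa>: "\<kappa> \<ge> 0" "emeasure lborel S + emeasure lborel B \<le> ennreal \<kappa> * emeasure lborel B"
    and pos: "emeasure lborel B \<noteq> 0" and m: "m \<ge> 1"
  defines "T \<equiv> \<Sum>a\<le>m+1. sq_integral S (U a (m + 1 - a))"
  shows "\<exists>P. jet P \<and> P 0 0 \<in> polys m \<and>
    (\<forall>x\<in>S. emeasure lborel B * ennreal ((U 0 0 x - P 0 0 x)\<^sup>2) \<le> ennreal (bh_const m \<kappa> * d ^ (2*m+2)) * T) \<and>
    sq_integral S (\<lambda>x. U 1 0 x - P 1 0 x) + sq_integral S (\<lambda>x. U 0 1 x - P 0 1 x)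
      \<le> ennreal (bh_const m \<kappa> * d ^ (2*m)) * T"
proof -
  have fin: "emeasure lborel B \<noteq> top" using emeasure_compact_finite[OF B] by auto
  have "measure lborel B > 0" using pos fin by (simp add: measure_def enn2real_positive_iff less_top zero_less_iff_neq_zero)
  from polynomial_with_mean_derivatives[OF U B this, of "m + 1"]
  obtain P where P: "jet P" "P 0 0 \<in> polys m" and P0: "\<forall>i j. m + 1 \<le> i + j \<longrightarrow> P i j = (\<lambda>_. 0)"
    and mean: "\<forall>i j. i + j < m + 1 \<longrightarrow> (\<integral>y. indicator B y * (U i j y - P i j y) \<partial>lborel) = 0"
    unfolding add_diff_cancel_right' by (elim exE conjE)
  define W where "W i j x = U i j x - P i j x" for i j x
  have Wf: "W = (\<lambda>i j x. U i j x - P i j x)" by (intro ext) (rule W_def)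
  have W: "jet W" unfolding W_def by (rule jet_diff[OF U P(1)])
  have TW: "(\<Sum>a\<le>m+1. sq_integral S (W a (m + 1 - a))) = T"
    unfolding T_def W_def using P0 by (intro sum.cong) auto
  let ?L = "8 * \<kappa> * d\<^sup>2"
  have est: "sq_integral S (W i j) \<le> ennreal (?L ^ (m + 1 - (i + j))) * T" if "i + j \<le> m + 1" for i j
    unfolding TW[symmetric]
    by (rule mean_zero_jet_estimate[OF W S B BS seg d \<kappa> pos _ that]) (use mean in \<open>auto simp: W_def\<close>)
  have L: "?L \<ge> 0" using \<kappa> by simp
  \<comment> \<open>By \<open>m \<ge> 1\<close> the second derivatives have order at most
    \<open>m + 1\<close>; \<open>n\<close> is the number of Poincare steps that remain for
    them.\<close>
  obtain n where n: "m = Suc n" using m by (cases m) auto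
  have g: "sq_integral S (W 1 0) + sq_integral S (W 0 1) \<le> ennreal (2 * ?L ^ m) * T"
  proof -
    have "sq_integral S (W 1 0) + sq_integral S (W 0 1) \<le> ennreal (?L ^ m) * T + ennreal (?L ^ m) * T"
      using est[of 1 0] est[of 0 1] by (intro add_mono) auto
    also have "\<dots> = ennreal (2 * ?L ^ m) * T"
      using L by (simp add: ennreal_mult mult_2[symmetric] mult_ac)
    finally show ?thesis .
  qed
  have h: "sq_integral S (W 2 0) + sq_integral S (W 1 1) + sq_integral S (W 0 2) \<le> ennreal (3 * ?L ^ n) * T"
  proof -
    have "sq_integral S (W 2 0) + sq_integral S (W 1 1) + sq_integral S (W 0 2)
        \<le> ennreal (?L ^ n) * T + ennreal (?L ^ n) * T + ennreal (?L ^ n) * T"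
      using est[of 2 0] est[of 1 1] est[of 0 2] by (intro add_mono) (auto simp: n numeral_2_eq_2)
    also have "\<dots> = (ennreal (?L ^ n) + ennreal (?L ^ n) + ennreal (?L ^ n)) * T"
      by (simp only: ring_distribs)
    also have "ennreal (?L ^ n) + ennreal (?L ^ n) + ennreal (?L ^ n) = ennreal (3 * ?L ^ n)"
      using L by (simp flip: ennreal_plus)
    finally show ?thesis .
  qed
  have dL: "?L ^ k = (8*\<kappa>)^k * d^(2*k)" for k by (simp add: power_mult_distrib power_mult)
  have pw: "d\<^sup>2 * d ^ (2*m) = d ^ (2*m+2)" "d^4 * d^(2*n) = d ^ (2*m+2)" "d^(2*(m+1)) = d^(2*m+2)"
    unfolding power_add[symmetric] n by (rule arg_cong[of _ _ "power d"], simp)+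
  have sup: "emeasure lborel B * ennreal ((W 0 0 x)\<^sup>2) \<le> ennreal (bh_const m \<kappa> * d ^ (2*m+2)) * T" if "x \<in> S" for x
  proof -
    have "emeasure lborel B * ennreal ((W 0 0 x)\<^sup>2)
      \<le> 3 * (sq_integral S (W 0 0) + ennreal (d\<^sup>2) * (sq_integral S (W (Suc 0) 0) + sq_integral S (W 0 (Suc 0)))
      + 2 * ennreal (d^4) * (sq_integral S (W (Suc (Suc 0)) 0) + sq_integral S (W (Suc 0) (Suc 0)) + sq_integral S (W 0 (Suc (Suc 0)))))"
      by (rule sobolev_sup[OF W S borel_compact[OF B] BS seg d that]) auto
    also have "\<dots> \<le> 3 * (ennreal (?L ^ (m+1)) * T + ennreal (d\<^sup>2) * (ennreal (2 * ?L ^ m) * T)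
        + 2 * ennreal (d^4) * (ennreal (3 * ?L ^ n) * T))"
      using g h est[of 0 0] by (intro mult_left_mono add_mono) (auto simp: numeral_2_eq_2)
    also have "\<dots> = ennreal (3 * (?L ^ (m+1) + d\<^sup>2 * (2 * ?L ^ m) + 2 * d^4 * (3 * ?L ^ n))) * T"
    proof -
      have *: "3 * (ennreal a * t + ennreal e * (ennreal (2 * b) * t) + 2 * ennreal f * (ennreal (3 * c) * t))
        = ennreal (3 * (a + e * (2 * b) + 2 * f * (3 * c))) * t"
        if "a \<ge> 0" "b \<ge> 0" "c \<ge> 0" "e \<ge> 0" "f \<ge> 0" for a b c e f t
      proof -
        have "ennreal (3 * (a + e * (2 * b) + 2 * f * (3 * c)))
            = 3 * (ennreal a + ennreal e * ennreal (2 * b) + 2 * ennreal f * ennreal (3 * c))"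
          using that by (simp add: ennreal_mult[symmetric] ennreal_plus[symmetric] ennreal_numeral[symmetric]
            del: ennreal_plus ennreal_numeral)
        then show ?thesis by (simp only: ring_distribs mult.assoc)
      qed
      show ?thesis by (rule *) (use L in auto)
    qed
    also have "3 * (?L ^ (m+1) + d\<^sup>2 * (2 * ?L ^ m) + 2 * d^4 * (3 * ?L ^ n)) = bh_const m \<kappa> * d ^ (2*m+2)"
    proof -
      have "d\<^sup>2 * (2 * ((8*\<kappa>)^m * d^(2*m))) = 2 * (8*\<kappa>)^m * (d\<^sup>2 * d^(2*m))"
        "2 * d^4 * (3 * ((8*\<kappa>)^n * d^(2*n))) = 6 * (8*\<kappa>)^n * (d^4 * d^(2*n))" by simp_all
      moreover have "m - 1 = n" using n by simp
      ultimately show ?thesis unfolding dL bh_const_def pw by (simp only: ring_distribs mult.assoc)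
    qed
    finally show ?thesis .
  qed
  \<comment> \<open>The gradient needs no constant of its own: the middle summand of
    \<open>bh_const\<close> already provides \<open>2 * (8*\<kappa>)^m\<close>.\<close>
  have "ennreal (2 * ?L ^ m) \<le> ennreal (bh_const m \<kappa> * d ^ (2*m))"
  proof (rule ennreal_leI)
    have "2 * (8*\<kappa>)^m \<le> bh_const m \<kappa>" unfolding bh_const_def using \<kappa>(1) by simp
    then show "2 * ?L ^ m \<le> bh_const m \<kappa> * d ^ (2*m)"
      unfolding dL by (simp add: mult_right_mono mult.assoc[symmetric] del: mult.assoc)
  qed
  then have g': "sq_integral S (W 1 0) + sq_integral S (W 0 1) \<le> ennreal (bh_const m \<kappa> * d ^ (2*m)) * T"
    using g by (meson mult_right_mono order_trans zero_le)
  show ?thesis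
    by (intro exI[of _ P] conjI P ballI g'[unfolded Wf]) (rule sup[unfolded Wf])
qed

subsection \<open>Smooth kernels of small support\<close>

text \<open>The polynomial parameter collects the powers of \<open>1/s\<close> that differentiating
  \<open>exp (-1/s)\<close> produces; this keeps the class closed under differentiation.\<close>

definition flat :: "real poly \<Rightarrow> real \<Rightarrow> real" where
  "flat p s = (if s > 0 then poly p (1/s) * exp (- 1/s) else 0)"

text \<open>The product rule and the inner derivative of \<open>1/s\<close> give
  \<open>1/s\<^sup>2\<close> times the value of \<open>p - pderiv p\<close> at \<open>1/s\<close>;
  \<open>[:0, 0, 1:]\<close> is the square of the variable.\<close>

definition flat_step :: "real poly \<Rightarrow> real poly" where
  "flat_step p = [:0, 0, 1:] * (p - pderiv p)"

lemma poly_times_exp_tendsto_0: "((\<lambda>x::real. poly p x * exp (- x)) \<longlongrightarrow> 0) at_top"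
proof -
  have "((\<lambda>x::real. \<Sum>i\<le>degree p. coeff p i * (x ^ i / exp x)) \<longlongrightarrow> (\<Sum>i\<le>degree p. coeff p i * 0)) at_top"
    by (intro tendsto_sum tendsto_mult tendsto_const tendsto_power_div_exp_0)
  then show ?thesis
    by (simp add: poly_altdef sum_distrib_right exp_minus divide_inverse mult.assoc)
qed

lemma flat_has_derivative: "(flat p has_real_derivative flat (flat_step p) s) (at s)"
proof -
  consider "s > 0" | "s < 0" | "s = 0" by linarith
  then show ?thesis
  proof cases
    case 1
    have "((\<lambda>s. poly p (1/s) * exp (- 1/s)) has_real_derivative flat (flat_step p) s) (at s)"
      using 1 by (auto intro!: derivative_eq_intros simp: flat_def flat_step_def field_simps power2_eq_square)
    then show ?thesis
      by (rule has_field_derivative_transform_within_open[where S="{0<..}"]) (use 1 in \<open>auto simp: flat_def\<close>)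
  next
    case 2
    have "((\<lambda>s. 0) has_real_derivative flat (flat_step p) s) (at s)" using 2 by (simp add: flat_def)
    then show ?thesis
      by (rule has_field_derivative_transform_within_open[where S="{..<0}"]) (use 2 in \<open>auto simp: flat_def\<close>)
  next
    case 3
    \<comment> \<open>At the origin the right difference quotient is again a polynomial in
      \<open>1/h\<close> times \<open>exp (- 1/h)\<close>, and so tends to 0.\<close>
    have r: "((\<lambda>h. flat p h / h) \<longlongrightarrow> 0) (at_right 0)"
    proof (rule Lim_transform_eventually)
      show "((\<lambda>h. poly ([:0,1:] * p) (inverse h) * exp (- inverse h)) \<longlongrightarrow> 0) (at_right (0::real))"
        by (rule filterlim_compose[OF poly_times_exp_tendsto_0 filterlim_inverse_at_top_right])
      show "\<forall>\<^sub>F h in at_right (0::real). poly ([:0,1:] * p) (inverse h) * exp (- inverse h) = flat p h / h"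
        by (rule eventually_at_rightI[of 0 1]) (auto simp: flat_def field_simps)
    qed
    have l: "((\<lambda>h. flat p h / h) \<longlongrightarrow> 0) (at_left 0)"
    proof (rule Lim_transform_eventually[OF tendsto_const])
      show "\<forall>\<^sub>F h in at_left (0::real). 0 = flat p h / h"
        by (rule eventually_at_leftI[of "-1"]) (auto simp: flat_def)
    qed
    have "((\<lambda>h. flat p h / h) \<longlongrightarrow> 0) (at 0)" by (rule filterlim_split_at[OF l r])
    then show ?thesis using 3 by (simp add: DERIV_def flat_def)
  qed
qed

text \<open>A list of pairs stands for the corresponding sum of products; this class of functions is closed
  under differentiation.\<close>

fun bump_sum :: "(real poly \<times> real poly) list \<Rightarrow> real \<Rightarrow> real" where
  "bump_sum [] s = 0"
| "bump_sum ((p, q) # L) s = flat p (1 + s) * flat q (1 - s) + bump_sum L s"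

text \<open>The inner derivative -1 of \<open>1 - s\<close> is absorbed by negating the polynomial
  of the other factor.\<close>

fun bump_step :: "(real poly \<times> real poly) list \<Rightarrow> (real poly \<times> real poly) list" where
  "bump_step [] = []"
| "bump_step ((p, q) # L) = (flat_step p, q) # (- p, flat_step q) # bump_step L"

lemma bump_sum_has_derivative: "(bump_sum L has_real_derivative bump_sum (bump_step L) s) (at s)"
proof (induction L rule: bump_step.induct)
  case 1
  have "bump_sum [] = (\<lambda>s. 0)" by (intro ext) simp
  then show ?case by simp
next
  case (2 p q L)
  have a: "((\<lambda>s. flat p (1 + s)) has_real_derivative flat (flat_step p) (1 + s)) (at s)"
    using DERIV_chain2[OF flat_has_derivative DERIV_add[OF DERIV_const DERIV_ident], of p 1 s UNIV] by simp
  have b: "((\<lambda>s. flat q (1 - s)) has_real_derivative - flat (flat_step q) (1 - s)) (at s)"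
    using DERIV_chain2[OF flat_has_derivative DERIV_diff[OF DERIV_const DERIV_ident], of q 1 s UNIV] by simp
  have eq: "bump_sum ((p, q) # L) = (\<lambda>s. flat p (1 + s) * flat q (1 - s) + bump_sum L s)" by (intro ext) simp
  have "flat (- p) s = - flat p s" for s by (simp add: flat_def)
  then show ?case unfolding eq
    by (intro DERIV_cong[OF DERIV_add[OF DERIV_mult[OF a b] 2]]) (simp add: algebra_simps)
qed

text \<open>On the open interval from -1 to 1 the function \<open>bump 0\<close> is
  \<open>exp (-2 / (1 - s\<^sup>2))\<close>, and \<open>bump n\<close> is its \<open>n\<close>-th
  derivative.\<close>

definition bump :: "nat \<Rightarrow> real \<Rightarrow> real" where
  "bump n = bump_sum ((bump_step ^^ n) [(1, 1)])"

lemma bump_has_derivative: "(bump n has_real_derivative bump (Suc n) s) (at s)"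
  unfolding bump_def using bump_sum_has_derivative[of "(bump_step ^^ n) [(1, 1)]" s] by simp

lemma bump_support: "bump n s = 0" if "\<bar>s\<bar> \<ge> 1"
proof -
  have "bump_sum L s = 0" for L
    by (induction L rule: bump_step.induct) (use that in \<open>auto simp: flat_def abs_if split: if_splits\<close>)
  then show ?thesis by (simp add: bump_def)
qed

lemma bump_nonneg: "bump 0 s \<ge> 0"
  by (simp add: bump_def flat_def)

lemma bump_pos: "\<bar>s\<bar> < 1 \<Longrightarrow> bump 0 s > 0"
  by (simp add: bump_def flat_def abs_less_iff)

lemma compact_support_integrable:
  fixes f :: "real^2 \<Rightarrow> real"
  assumes "continuous_on UNIV f" "\<And>x. x \<notin> ball z r \<Longrightarrow> f x = 0"
  shows "integrable lborel f"
proof -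
  have "integrable lborel (\<lambda>x. indicator (cball z r) x *\<^sub>R f x)"
    by (rule borel_integrable_compact) (auto intro: continuous_on_subset[OF assms(1)])
  moreover have "(\<lambda>x. indicator (cball z r) x *\<^sub>R f x) = f"
    using assms(2) by (auto simp: fun_eq_iff indicator_def)
  ultimately show ?thesis by simp
qed

text \<open>All derivatives of the kernel are recorded together, because those of a convolution are
  obtained by replacing \<open>k 0 0\<close> by \<open>k i j\<close>. Sign and mass concern the
  kernel itself, the support condition every derivative.\<close>

definition mollifier :: "real \<Rightarrow> (nat \<Rightarrow> nat \<Rightarrow> real^2 \<Rightarrow> real) \<Rightarrow> bool" where
  "mollifier \<epsilon> k \<longleftrightarrow> jet k \<and> (\<forall>i j x. x \<notin> ball 0 \<epsilon> \<longrightarrow> k i j x = 0) \<and> (\<forall>x. 0 \<le> k 0 0 x) \<and>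
     (\<integral>x. k 0 0 x \<partial>lborel) = 1"

lemma mollifier_exists:
  assumes "\<epsilon> > 0"
  shows "\<exists>k. mollifier \<epsilon> k"
proof -
  \<comment> \<open>With half the radius in each coordinate the square of support fits into the
    ball: outside the ball some coordinate is at least \<open>\<epsilon> / 2\<close> in absolute
    value.\<close>
  define \<delta> where "\<delta> = \<epsilon> / 2"
  have \<delta>: "\<delta> > 0" using assms by (simp add: \<delta>_def)
  define b where "b n s = bump n (s / \<delta>) / \<delta> ^ n" for n s
  have b: "(b n has_real_derivative b (Suc n) s) (at s)" for n s
  proof -
    have "((\<lambda>s. s / \<delta>) has_real_derivative 1 / \<delta>) (at s)" by (intro DERIV_cdivide DERIV_ident)
    from DERIV_cdivide[OF DERIV_chain2[OF bump_has_derivative this], of n "\<delta> ^ n"]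
    show ?thesis unfolding b_def by (rule DERIV_cong) (simp add: mult.commute)
  qed
  define k where "k i j x = b i (x$1) * b j (x$2)" for i j and x :: "real^2"
  have k: "jet k" unfolding k_def by (rule jet_tensor) (rule b)+
  have supp: "k i j x = 0" if "x \<notin> ball 0 \<epsilon>" for i j x
  proof -
    have "\<epsilon> \<le> \<bar>x$1\<bar> + \<bar>x$2\<bar>" using that norm_le_l1_cart[of x] by (simp add: UNIV_2)
    then have "\<bar>x$1 / \<delta>\<bar> \<ge> 1 \<or> \<bar>x$2 / \<delta>\<bar> \<ge> 1" using \<delta> by (auto simp: \<delta>_def abs_divide)
    then show ?thesis by (auto simp: k_def b_def bump_support)
  qed
  have nn: "0 \<le> k 0 0 x" for x by (simp add: k_def b_def bump_nonneg)
  have int: "integrable lborel (k 0 0)"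
    by (rule compact_support_integrable[OF jet_continuous[OF k] supp])
  define Z where "Z = (\<integral>x. k 0 0 x \<partial>lborel)"
  \<comment> \<open>Mass zero would make the set where the kernel is nonzero a null set, although it
    contains a ball.\<close>
  have "Z \<noteq> 0"
  proof
    assume "Z = 0"
    then have "AE x in lborel. k 0 0 x = 0"
      using integral_nonneg_eq_0_iff_AE[OF int] nn by (simp add: Z_def)
    then have "emeasure lborel {x. k 0 0 x \<noteq> 0} = 0"
      using jet_measurable[OF k, of 0 0] by (subst (asm) AE_iff_measurable[OF _ refl]) auto
    moreover have "ball 0 \<delta> \<subseteq> {x. k 0 0 x \<noteq> 0}"
    proof
      fix x :: "real^2" assume "x \<in> ball 0 \<delta>"
      then have "\<bar>x$1\<bar> < \<delta>" "\<bar>x$2\<bar> < \<delta>"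
        using component_le_norm_cart[of x 1] component_le_norm_cart[of x 2] by auto
      then have "bump 0 (x$1 / \<delta>) > 0" "bump 0 (x$2 / \<delta>) > 0" using \<delta> by (auto intro!: bump_pos simp: abs_divide)
      then show "x \<in> {x. k 0 0 x \<noteq> 0}" by (simp add: k_def b_def)
    qed
    moreover have "{x. k 0 0 x \<noteq> 0} \<in> sets lborel" using jet_measurable[OF k, of 0 0] by simp
    ultimately have "emeasure lborel (ball (0::real^2) \<delta>) = 0"
      using emeasure_mono[of "ball 0 \<delta>" "{x. k 0 0 x \<noteq> 0}" lborel] by simp
    then have "measure lborel (ball (0::real^2) \<delta>) = 0" by (simp add: measure_def)
    then show False using content_ball_pos[OF \<delta>, of "0::real^2"] by simp
  qed
  moreover have "0 \<le> Z" unfolding Z_def by (rule integral_nonneg_AE) (simp add: nn)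
  ultimately have Z: "Z > 0" by simp
  show ?thesis unfolding mollifier_def
  proof (intro exI[of _ "\<lambda>i j x. (1/Z) * k i j x"] conjI allI impI)
    show "jet (\<lambda>i j x. (1/Z) * k i j x)" by (rule jet_cmult[OF k])
    show "(\<integral>x. (1/Z) * k 0 0 x \<partial>lborel) = 1" using Z unfolding integral_mult_right_zero by (simp add: Z_def)
  qed (use supp nn Z in auto)
qed

section \<open>Mollifiers as test functions\<close>

lemma partial_deriv_eq:
  assumes "\<And>x. (f has_derivative (\<lambda>h. f1 x * h$1 + f2 x * h$2)) (at x)"
  shows "partial_deriv 1 f = f1" "partial_deriv 2 f = f2"
proof -
  have "frechet_derivative f (at x) = (\<lambda>h. f1 x * h$1 + f2 x * h$2)" for x
    using frechet_derivative_at[OF assms] by simp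
  then show "partial_deriv 1 f = f1" "partial_deriv 2 f = f2"
    by (auto simp: partial_deriv_def axis_def fun_eq_iff)
qed

lemma jet_reflect_has_derivative:
  assumes "jet k"
  shows "((\<lambda>y. s * k i j (z - y)) has_derivative
     (\<lambda>h. (- s * k (Suc i) j (z - y)) * h$1 + (- s * k i (Suc j) (z - y)) * h$2)) (at y)"
proof -
  have "((\<lambda>y. k i j (z - y)) has_derivative (\<lambda>h. k (Suc i) j (z - y) * (- h)$1 + k i (Suc j) (z - y) * (- h)$2)) (at y)"
    by (rule has_derivative_compose[where g="k i j" and f="\<lambda>y. z - y", OF _ jetD[OF assms]])
      (auto intro!: derivative_eq_intros)
  from has_derivative_mult_right[OF this, of s] show ?thesis
    by (rule has_derivative_eq_rhs) (auto simp: algebra_simps)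
qed

lemma jet_reflect_partial:
  assumes "jet k"
  shows "partial_deriv 1 (\<lambda>y. s * k i j (z - y)) = (\<lambda>y. - s * k (Suc i) j (z - y))"
    "partial_deriv 2 (\<lambda>y. s * k i j (z - y)) = (\<lambda>y. - s * k i (Suc j) (z - y))"
  by (rule partial_deriv_eq[OF jet_reflect_has_derivative[OF assms]])+

text \<open>Every differentiation of the reflected kernel contributes a sign; altogether this is the
  sign in the definition of a weak derivative.\<close>

lemma multi_deriv_reflect:
  assumes "jet k"
  shows "multi_deriv (i, j) (\<lambda>y. k 0 0 (z - y)) = (\<lambda>y. (-1) ^ (i + j) * k i j (z - y))"
proof -
  have a: "(partial_deriv 2 ^^ j) (\<lambda>y. k 0 0 (z - y)) = (\<lambda>y. (-1) ^ j * k 0 j (z - y))"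
  proof (induction j)
    case (Suc j)
    then show ?case using jet_reflect_partial(2)[OF assms, of "(-1)^j" 0 j z] by simp
  qed simp
  have "(partial_deriv 1 ^^ i) (\<lambda>y. (-1) ^ j * k 0 j (z - y)) = (\<lambda>y. (-1) ^ (i + j) * k i j (z - y))"
  proof (induction i)
    case (Suc i)
    then show ?case using jet_reflect_partial(1)[OF assms, of "(-1)^(i+j)" i j z] by simp
  qed simp
  then show ?thesis unfolding multi_deriv_def by (simp add: a)
qed

text \<open>\<open>smooth\<close> quantifies over all sequences of partial derivatives, and each of
  them maps the reflected kernel to a multiple of a reflected member of its own jet.\<close>

lemma mollifier_test_function:
  assumes "mollifier \<epsilon> k" "cball z \<epsilon> \<subseteq> D"
  shows "(\<lambda>y. k 0 0 (z - y)) \<in> test_functions D"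
proof -
  have k: "jet k" and supp: "\<And>x. x \<notin> ball 0 \<epsilon> \<Longrightarrow> k 0 0 x = 0" using assms(1) by (auto simp: mollifier_def)
  have "smooth (\<lambda>y. k 0 0 (z - y))"
    unfolding smooth_def
  proof (intro allI)
    fix xs :: "2 list" and x
    have "\<exists>s i j. foldr partial_deriv xs (\<lambda>y. k 0 0 (z - y)) = (\<lambda>y. s * k i j (z - y))"
    proof (induction xs)
      case Nil
      show ?case by (intro exI[of _ 1] exI[of _ 0]) simp
    next
      case (Cons a xs)
      then obtain s i j where IH: "foldr partial_deriv xs (\<lambda>y. k 0 0 (z - y)) = (\<lambda>y. s * k i j (z - y))"
        by (elim exE)
      have "a = 1 \<or> a = 2" using exhaust_2 by blast
      then show ?case
      proof
        assume "a = 1"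
        then show ?thesis
          by (intro exI[of _ "- s"] exI[of _ "Suc i"] exI[of _ j]) (simp add: IH jet_reflect_partial[OF k])
      next
        assume "a = 2"
        then show ?thesis
          by (intro exI[of _ "- s"] exI[of _ i] exI[of _ "Suc j"]) (simp add: IH jet_reflect_partial[OF k])
      qed
    qed
    then obtain s i j where eq: "foldr partial_deriv xs (\<lambda>y. k 0 0 (z - y)) = (\<lambda>y. s * k i j (z - y))"
      by (elim exE)
    show "foldr partial_deriv xs (\<lambda>y. k 0 0 (z - y)) differentiable (at x)"
      unfolding eq by (rule differentiableI[OF jet_reflect_has_derivative[OF k]])
  qed
  moreover have "{x. k 0 0 (z - x) \<noteq> 0} \<subseteq> cball z \<epsilon>"
  proof
    fix x assume "x \<in> {x. k 0 0 (z - x) \<noteq> 0}"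
    then have "z - x \<in> ball 0 \<epsilon>" using supp by blast
    then have "norm (z - x) < \<epsilon>" by (simp only: mem_ball_0)
    then show "x \<in> cball z \<epsilon>" by (simp only: mem_cball dist_norm less_imp_le)
  qed
  then have cl: "closure {x. k 0 0 (z - x) \<noteq> 0} \<subseteq> cball z \<epsilon>" by (simp add: closure_minimal)
  moreover have "compact (closure {x. k 0 0 (z - x) \<noteq> 0})"
    using bounded_subset[OF bounded_cball cl] by (simp add: compact_eq_bounded_closed)
  ultimately show ?thesis using assms(2) by (auto simp: test_functions_def)
qed

text \<open>The reflected kernel is an admissible test function, and the sign of the reflection
  cancels the one of integration by parts. Derivatives thus pass from the kernel to the weak
  derivative.\<close>

lemma weak_deriv_mollifier:
  assumes "mollifier \<epsilon> k" "cball z \<epsilon> \<subseteq> D" "has_weak_deriv D (i, j) f v"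
  shows "(LINT y|lebesgue_on D. f y * k i j (z - y)) = (LINT y|lebesgue_on D. v y * k 0 0 (z - y))"
proof -
  have k: "jet k" using assms(1) by (simp add: mollifier_def)
  have "(LINT y|lebesgue_on D. f y * ((-1) ^ (i + j) * k i j (z - y)))
      = (-1) ^ (i + j) * (LINT y|lebesgue_on D. v y * k 0 0 (z - y))"
    using assms(3) mollifier_test_function[OF assms(1,2)]
    unfolding has_weak_deriv_def by (fastforce simp: multi_deriv_reflect[OF k])
  then have "(-1) ^ (i + j) * (LINT y|lebesgue_on D. f y * k i j (z - y))
      = (-1) ^ (i + j) * (LINT y|lebesgue_on D. v y * k 0 0 (z - y))"
    by (simp only: mult.left_commute[of "f _"] integral_mult_right_zero)
  then show ?thesis by simp
qed

subsection \<open>Mollification\<close>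

definition conv :: "(real^2 \<Rightarrow> real) \<Rightarrow> (real^2 \<Rightarrow> real) \<Rightarrow> real^2 \<Rightarrow> real" where
  "conv f \<kappa> w = (\<integral>y. f y * \<kappa> (w - y) \<partial>lborel)"

lemma mollifierD:
  assumes "mollifier \<epsilon> k"
  shows "jet k" "\<And>i j x. x \<notin> ball 0 \<epsilon> \<Longrightarrow> k i j x = 0" "\<And>x. 0 \<le> k 0 0 x" "(\<integral>x. k 0 0 x \<partial>lborel) = 1"
  using assms by (auto simp: mollifier_def)

lemma mollifier_bounded:
  assumes "mollifier \<epsilon> k"
  shows "\<exists>M\<ge>0. \<forall>x. \<bar>k i j x\<bar> \<le> M"
proof -
  have "compact (k i j ` cball 0 \<epsilon>)"
    by (intro compact_continuous_image jet_continuous[OF mollifierD(1)[OF assms]] compact_cball)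
  then obtain M where M: "\<forall>x\<in>cball 0 \<epsilon>. \<bar>k i j x\<bar> \<le> M"
    using compact_imp_bounded[of "k i j ` cball 0 \<epsilon>"] by (auto simp: bounded_iff)
  have "\<bar>k i j x\<bar> \<le> max M 0" for x
  proof (cases "x \<in> ball 0 \<epsilon>")
    case True
    then have "x \<in> cball 0 \<epsilon>" by simp
    then show ?thesis using bspec[OF M] by force
  next
    case False
    then show ?thesis using mollifierD(2)[OF assms] by simp
  qed
  then show ?thesis by (intro exI[of _ "max M 0"]) simp
qed

text \<open>The second derivatives of the kernel are bounded, so the quadratic remainder is uniform
  in the base point and can be integrated against any integrable function.\<close>

lemma mollifier_taylor:
  assumes "mollifier \<epsilon> k"
  shows "\<exists>C\<ge>0. \<forall>z h. \<bar>k i j (z + h) - k i j z - (k (Suc i) j z * h$1 + k i (Suc j) z * h$2)\<bar> \<le> C * (norm h)\<^sup>2"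
proof -
  note k = mollifierD(1)[OF assms]
  obtain M1 where M1: "M1 \<ge> 0" "\<forall>x. \<bar>k (Suc (Suc i)) j x\<bar> \<le> M1" using mollifier_bounded[OF assms, of "Suc (Suc i)" j] by (elim exE conjE)
  obtain M2 where M2: "M2 \<ge> 0" "\<forall>x. \<bar>k (Suc i) (Suc j) x\<bar> \<le> M2" using mollifier_bounded[OF assms, of "Suc i" "Suc j"] by (elim exE conjE)
  obtain M3 where M3: "M3 \<ge> 0" "\<forall>x. \<bar>k i (Suc (Suc j)) x\<bar> \<le> M3" using mollifier_bounded[OF assms, of i "Suc (Suc j)"] by (elim exE conjE)
  define M where "M = M1 + 2 * M2 + M3"
  have main: "\<bar>k i j (z + h) - k i j z - (k (Suc i) j z * h$1 + k i (Suc j) z * h$2)\<bar> \<le> M * (norm h)\<^sup>2" for z h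
  proof -
    define u where "u a b s = k a b (z + s *\<^sub>R h)" for a b s
    have der: "(u a b has_real_derivative (u (Suc a) b s * h$1 + u a (Suc b) s * h$2)) (at s)" for a b s
      unfolding u_def by (rule jet_along_segment[OF k])
    define u1 where "u1 s = u (Suc i) j s * h$1 + u i (Suc j) s * h$2" for s
    define u2 where "u2 s = (u (Suc (Suc i)) j s * h$1 + u (Suc i) (Suc j) s * h$2) * h$1
      + (u (Suc i) (Suc j) s * h$1 + u i (Suc (Suc j)) s * h$2) * h$2" for s
    have d1: "(u1 has_real_derivative u2 s) (at s)" for s
      unfolding u1_def u2_def by (intro DERIV_add DERIV_cmult_right der)
    \<comment> \<open>The derivatives of order 0, 1 and 2 along the segment, in the form that
      \<open>Maclaurin\<close> expects.\<close>
    define diff where "diff n = (if n = 0 then u i j else if n = 1 then u1 else u2)" for n :: nat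
    have "\<exists>t. 0 < t \<and> t < 1 \<and> u i j 1 = (\<Sum>m<2. diff m 0 / fact m * 1 ^ m) + diff 2 t / fact 2 * 1 ^ 2"
    proof (rule Maclaurin)
      show "\<forall>m t. m < 2 \<and> 0 \<le> t \<and> t \<le> 1 \<longrightarrow> DERIV (diff m) t :> diff (Suc m) t"
        using der[of i j] d1 by (auto simp: diff_def less_2_cases_iff u1_def)
    qed (auto simp: diff_def)
    then obtain t where t: "u i j 1 = u i j 0 + u1 0 + u2 t / 2"
      by (auto simp: diff_def numeral_2_eq_2)
    have n: "\<bar>h$1\<bar> \<le> norm h" "\<bar>h$2\<bar> \<le> norm h" by (rule component_le_norm_cart)+
    have p: "\<bar>a * h$p * h$q\<bar> \<le> N * (norm h)\<^sup>2" if "\<bar>a\<bar> \<le> N" for a N p q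
    proof -
      have "\<bar>a * h$p * h$q\<bar> = \<bar>a\<bar> * (\<bar>h$p\<bar> * \<bar>h$q\<bar>)" by (simp add: abs_mult)
      also have "\<dots> \<le> N * (norm h * norm h)"
        using that by (intro mult_mono component_le_norm_cart) auto
      finally show ?thesis by (simp add: power2_eq_square)
    qed
    have "u2 t = u (Suc (Suc i)) j t * h$1 * h$1 + u (Suc i) (Suc j) t * h$2 * h$1
        + u (Suc i) (Suc j) t * h$1 * h$2 + u i (Suc (Suc j)) t * h$2 * h$2"
      by (simp add: u2_def algebra_simps)
    also have "\<bar>\<dots>\<bar> \<le> M1 * (norm h)\<^sup>2 + M2 * (norm h)\<^sup>2 + M2 * (norm h)\<^sup>2 + M3 * (norm h)\<^sup>2"
      unfolding u_def
      by (intro order_trans[OF abs_triangle_ineq] add_mono p spec[OF M1(2)] spec[OF M2(2)] spec[OF M3(2)])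
    finally have "\<bar>u2 t\<bar> \<le> M1 * (norm h)\<^sup>2 + M2 * (norm h)\<^sup>2 + M2 * (norm h)\<^sup>2 + M3 * (norm h)\<^sup>2" .
    then have "\<bar>u2 t\<bar> \<le> M * (norm h)\<^sup>2" by (simp add: M_def algebra_simps)
    moreover have "k i j (z + h) - k i j z - (k (Suc i) j z * h$1 + k i (Suc j) z * h$2) = u2 t / 2"
      using t by (simp add: u_def u1_def)
    ultimately show ?thesis by simp
  qed
  have "M \<ge> 0" using M1 M2 M3 by (simp add: M_def)
  then show ?thesis using main by (intro exI[of _ M]) simp
qed

lemma conv_integrable:
  assumes "mollifier \<epsilon> k" "integrable lborel f"
  shows "integrable lborel (\<lambda>y. f y * k i j (w - y))"
proof -
  note [measurable] = jet_measurable[OF mollifierD(1)[OF assms(1)]]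
  have [measurable]: "f \<in> borel_measurable borel" using assms(2) by auto
  obtain M where M: "M \<ge> 0" "\<forall>x. \<bar>k i j x\<bar> \<le> M" using mollifier_bounded[OF assms(1), of i j] by (elim exE conjE)
  show ?thesis
  proof (rule Bochner_Integration.integrable_bound)
    show "integrable lborel (\<lambda>y. f y * M)" using assms(2) by simp
    show "AE y in lborel. norm (f y * k i j (w - y)) \<le> norm (f y * M)"
      using M by (auto simp: abs_mult intro!: mult_left_mono)
  qed measurable
qed

text \<open>Integrating the Taylor remainder of the kernel against \<open>f\<close> bounds the
  remainder of the convolution by a multiple of \<open>(norm h)\<^sup>2\<close>, which is
  differentiability.\<close>

lemma conv_jet:
  assumes m: "mollifier \<epsilon> k" and f: "integrable lborel f"
  shows "jet (\<lambda>i j. conv f (k i j))"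
  unfolding jet_def
proof (intro allI)
  fix i j w
  obtain C where C: "C \<ge> 0" "\<forall>z h. \<bar>k i j (z + h) - k i j z - (k (Suc i) j z * h$1 + k i (Suc j) z * h$2)\<bar> \<le> C * (norm h)\<^sup>2"
    using mollifier_taylor[OF m, of i j] by (elim exE conjE)
  define F where "F = (\<integral>y. \<bar>f y\<bar> \<partial>lborel)"
  let ?L = "\<lambda>h. conv f (k (Suc i) j) w * h$1 + conv f (k i (Suc j)) w * h$2"
  note int = conv_integrable[OF m f]
  have est: "\<bar>conv f (k i j) (w + h) - conv f (k i j) w - ?L h\<bar> \<le> C * F * (norm h)\<^sup>2" for h
  proof -
    have "conv f (k i j) (w + h) - conv f (k i j) w - ?L h
        = (\<integral>y. f y * k i j (w + h - y) - f y * k i j (w - y) - (f y * k (Suc i) j (w - y) * h$1 + f y * k i (Suc j) (w - y) * h$2) \<partial>lborel)"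
      unfolding conv_def by (simp add: int)
    also have "\<bar>\<dots>\<bar> \<le> (\<integral>y. C * (norm h)\<^sup>2 * \<bar>f y\<bar> \<partial>lborel)"
      unfolding real_norm_def[symmetric]
    proof (rule Bochner_Integration.integral_norm_bound_integral)
      show "integrable lborel (\<lambda>y. f y * k i j (w + h - y) - f y * k i j (w - y) - (f y * k (Suc i) j (w - y) * h$1 + f y * k i (Suc j) (w - y) * h$2))"
        by (intro Bochner_Integration.integrable_diff Bochner_Integration.integrable_add integrable_mult_left int)
      show "integrable lborel (\<lambda>y. C * (norm h)\<^sup>2 * norm (f y))" using f by simp
      fix y
      have "f y * k i j (w + h - y) - f y * k i j (w - y) - (f y * k (Suc i) j (w - y) * h$1 + f y * k i (Suc j) (w - y) * h$2)
        = f y * (k i j ((w - y) + h) - k i j (w - y) - (k (Suc i) j (w - y) * h$1 + k i (Suc j) (w - y) * h$2))"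
        by (simp add: algebra_simps)
      then show "norm (f y * k i j (w + h - y) - f y * k i j (w - y) - (f y * k (Suc i) j (w - y) * h$1 + f y * k i (Suc j) (w - y) * h$2))
        \<le> C * (norm h)\<^sup>2 * norm (f y)"
        using mult_left_mono[OF spec[OF spec[OF C(2), of "w - y"], of h], of "\<bar>f y\<bar>"]
        by (simp add: abs_mult mult_ac)
    qed
    also have "\<dots> = C * F * (norm h)\<^sup>2" by (simp add: F_def)
    finally show ?thesis .
  qed
  show "(conv f (k i j) has_derivative ?L) (at w)"
  proof (rule has_derivativeI_sandwich[of 1])
    show "bounded_linear ?L"
      by (intro bounded_linear_add bounded_linear_const_mult bounded_linear_vec_nth)
    show "((\<lambda>y. C * F * norm (y - w)) \<longlongrightarrow> 0) (at w)"
      by (auto intro!: tendsto_eq_intros)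
    fix y assume "y \<noteq> w"
    then show "norm (conv f (k i j) y - conv f (k i j) w - ?L (y - w)) / norm (y - w) \<le> C * F * norm (y - w)"
      using est[of "y - w"] by (simp add: divide_le_eq power2_eq_square mult.assoc)
  qed simp
qed

lemma integral_reflect:
  fixes \<kappa> :: "real^2 \<Rightarrow> real"
  assumes [measurable]: "\<kappa> \<in> borel_measurable borel" and "\<And>x. 0 \<le> \<kappa> x"
  shows "(\<integral>\<^sup>+y. ennreal (\<kappa> (w - y)) \<partial>lborel) = (\<integral>\<^sup>+y. ennreal (\<kappa> y) \<partial>lborel)"
    "(\<integral>\<^sup>+x. ennreal (\<kappa> (x - w)) \<partial>lborel) = (\<integral>\<^sup>+y. ennreal (\<kappa> y) \<partial>lborel)"
  using nn_integral_affine[of "\<lambda>y. ennreal (\<kappa> y)" "-1" w] nn_integral_affine[of "\<lambda>y. ennreal (\<kappa> y)" 1 "-w"]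
  by (auto simp: add.commute)

lemma mollifier_mass:
  assumes "mollifier \<epsilon> k"
  shows "integrable lborel (\<lambda>y. k 0 0 (w - y))" "(\<integral>y. k 0 0 (w - y) \<partial>lborel) = 1"
    "(\<integral>\<^sup>+x. ennreal (k 0 0 (x - w)) \<partial>lborel) = 1"
proof -
  note k = mollifierD[OF assms]
  note [measurable] = jet_measurable[OF k(1)]
  have i: "integrable lborel (k 0 0)" by (rule compact_support_integrable[OF jet_continuous[OF k(1)] k(2)])
  have n: "(\<integral>\<^sup>+x. ennreal (k 0 0 x) \<partial>lborel) = 1"
    using nn_integral_eq_integral[OF i] k(3,4) by simp
  have w: "(\<integral>\<^sup>+y. ennreal (k 0 0 (w - y)) \<partial>lborel) = 1"
    using integral_reflect(1)[of "k 0 0" w] k(3) n by simp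
  show "(\<integral>\<^sup>+x. ennreal (k 0 0 (x - w)) \<partial>lborel) = 1"
    using integral_reflect(2)[of "k 0 0" w] k(3) n by simp
  show "integrable lborel (\<lambda>y. k 0 0 (w - y))"
    by (rule integrableI_nonneg) (use k(3) w in auto)
  show "(\<integral>y. k 0 0 (w - y) \<partial>lborel) = 1"
    by (subst integral_eq_nn_integral) (use k(3) w in auto)
qed

text \<open>The convolution is an average over the ball with nonnegative weight of total mass 1, so
  it inherits any almost everywhere bound on the distance to \<open>a\<close>.\<close>

lemma conv_close:
  assumes m: "mollifier \<epsilon> k" and f: "integrable lborel f"
    and close: "AE y in lborel. y \<in> ball w \<epsilon> \<longrightarrow> \<bar>f y - a\<bar> \<le> \<delta>"
  shows "\<bar>conv f (k 0 0) w - a\<bar> \<le> \<delta>"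
proof -
  note k = mollifierD[OF m] and mass = mollifier_mass[OF m, of w] and int = conv_integrable[OF m f, of 0 0 w]
  have "conv f (k 0 0) w - a = (\<integral>y. f y * k 0 0 (w - y) - a * k 0 0 (w - y) \<partial>lborel)"
    unfolding conv_def using mass int by simp
  also have "\<bar>\<dots>\<bar> \<le> (\<integral>y. norm (f y * k 0 0 (w - y) - a * k 0 0 (w - y)) \<partial>lborel)"
    unfolding real_norm_def by (rule integral_abs_bound)
  also have "\<dots> \<le> (\<integral>y. \<delta> * k 0 0 (w - y) \<partial>lborel)"
  proof (rule integral_mono_AE)
    show "integrable lborel (\<lambda>y. norm (f y * k 0 0 (w - y) - a * k 0 0 (w - y)))" using mass int by simp
    show "integrable lborel (\<lambda>y. \<delta> * k 0 0 (w - y))" using mass by simp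
    show "AE y in lborel. norm (f y * k 0 0 (w - y) - a * k 0 0 (w - y)) \<le> \<delta> * k 0 0 (w - y)"
      using close
    proof (rule AE_mp, intro AE_I2 impI)
      fix y assume y: "y \<in> ball w \<epsilon> \<longrightarrow> \<bar>f y - a\<bar> \<le> \<delta>"
      show "norm (f y * k 0 0 (w - y) - a * k 0 0 (w - y)) \<le> \<delta> * k 0 0 (w - y)"
      proof (cases "y \<in> ball w \<epsilon>")
        case True
        have "norm (f y * k 0 0 (w - y) - a * k 0 0 (w - y)) = \<bar>f y - a\<bar> * k 0 0 (w - y)"
          using k(3)[of "w - y"] by (simp add: left_diff_distrib[symmetric] abs_mult)
        also have "\<dots> \<le> \<delta> * k 0 0 (w - y)" using y True k(3) by (intro mult_right_mono) auto
        finally show ?thesis .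
      next
        case False
        then have "k 0 0 (w - y) = 0" by (intro k(2)) (simp only: mem_ball dist_norm diff_0 norm_minus_cancel not_False_eq_True)
        then show ?thesis by simp
      qed
    qed
  qed
  also have "\<dots> = \<delta>" using mass by simp
  finally show ?thesis .
qed

text \<open>Jensen's inequality for the probability density \<open>k 0 0\<close>: the square of
  \<open>f y - a\<close>, where \<open>a\<close> is the convolution value, is integrated against the
  kernel and expanded.\<close>

lemma conv_square_le:
  assumes m: "mollifier \<epsilon> k" and f: "integrable lborel f" and f2: "integrable lborel (\<lambda>y. (f y)\<^sup>2)"
  shows "(conv f (k 0 0) w)\<^sup>2 \<le> (\<integral>y. (f y)\<^sup>2 * k 0 0 (w - y) \<partial>lborel)"
proof -
  note k = mollifierD[OF m] and mass = mollifier_mass[OF m, of w]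
  note int = conv_integrable[OF m f, of 0 0 w] conv_integrable[OF m f2, of 0 0 w]
  define a where "a = conv f (k 0 0) w"
  have "0 \<le> (\<integral>y. (f y - a)\<^sup>2 * k 0 0 (w - y) \<partial>lborel)" using k(3) by (intro integral_nonneg_AE) auto
  also have "(\<lambda>y. (f y - a)\<^sup>2 * k 0 0 (w - y))
      = (\<lambda>y. (f y)\<^sup>2 * k 0 0 (w - y) - (2 * a) * (f y * k 0 0 (w - y)) + a\<^sup>2 * k 0 0 (w - y))"
    by (intro ext) (simp add: power2_diff algebra_simps)
  also have "(\<integral>y. (f y)\<^sup>2 * k 0 0 (w - y) - (2 * a) * (f y * k 0 0 (w - y)) + a\<^sup>2 * k 0 0 (w - y) \<partial>lborel)
      = (\<integral>y. (f y)\<^sup>2 * k 0 0 (w - y) \<partial>lborel) - (2 * a) * a + a\<^sup>2"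
    using int mass by (simp add: a_def conv_def)
  finally show ?thesis by (simp add: a_def power2_eq_square)
qed

text \<open>Jensen, Tonelli and the unit mass of the kernel. The affine substitution is included
  because the mollification is later composed with a contraction of ratio \<open>t\<close>, whose
  Jacobian stays on the left.\<close>

lemma conv_L2_le:
  assumes m: "mollifier \<epsilon> k" and f: "integrable lborel f" and f2: "integrable lborel (\<lambda>y. (f y)\<^sup>2)" and t: "t \<noteq> 0"
  shows "ennreal (t\<^sup>2) * (\<integral>\<^sup>+x. ennreal ((conv f (k 0 0) (v + t *\<^sub>R x))\<^sup>2) \<partial>lborel) \<le> (\<integral>\<^sup>+y. ennreal ((f y)\<^sup>2) \<partial>lborel)"
proof -
  note k = mollifierD[OF m]
  note [measurable] = jet_measurable[OF k(1)] jet_measurable[OF conv_jet[OF m f], of 0 0]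
  have [measurable]: "f \<in> borel_measurable borel" using f by auto
  have "ennreal (t\<^sup>2) * (\<integral>\<^sup>+x. ennreal ((conv f (k 0 0) (v + t *\<^sub>R x))\<^sup>2) \<partial>lborel)
      = (\<integral>\<^sup>+w. ennreal ((conv f (k 0 0) w)\<^sup>2) \<partial>lborel)"
    by (rule nn_integral_affine[OF _ t, symmetric]) measurable
  also have "\<dots> \<le> (\<integral>\<^sup>+w. \<integral>\<^sup>+y. ennreal ((f y)\<^sup>2) * ennreal (k 0 0 (w - y)) \<partial>lborel \<partial>lborel)"
  proof (rule nn_integral_mono)
    fix w
    have "ennreal ((conv f (k 0 0) w)\<^sup>2) \<le> ennreal (\<integral>y. (f y)\<^sup>2 * k 0 0 (w - y) \<partial>lborel)"
      by (rule ennreal_leI[OF conv_square_le[OF m f f2]])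
    also have "\<dots> = (\<integral>\<^sup>+y. ennreal ((f y)\<^sup>2 * k 0 0 (w - y)) \<partial>lborel)"
      by (rule nn_integral_eq_integral[symmetric, OF conv_integrable[OF m f2]]) (simp add: k(3))
    also have "\<dots> = (\<integral>\<^sup>+y. ennreal ((f y)\<^sup>2) * ennreal (k 0 0 (w - y)) \<partial>lborel)"
      by (simp add: ennreal_mult k(3))
    finally show "ennreal ((conv f (k 0 0) w)\<^sup>2) \<le> (\<integral>\<^sup>+y. ennreal ((f y)\<^sup>2) * ennreal (k 0 0 (w - y)) \<partial>lborel)" .
  qed
  also have "\<dots> = (\<integral>\<^sup>+y. \<integral>\<^sup>+w. ennreal ((f y)\<^sup>2) * ennreal (k 0 0 (w - y)) \<partial>lborel \<partial>lborel)"
    by (rule lborel_pair.Fubini') measurable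
  also have "\<dots> = (\<integral>\<^sup>+y. ennreal ((f y)\<^sup>2) \<partial>lborel)"
    by (simp add: nn_integral_cmult mollifier_mass(3)[OF m])
  finally show ?thesis .
qed

text \<open>Weak derivatives are Lebesgue measurable on \<open>D\<close>, while substitution and
  Tonelli are used for Borel functions on the plane. The representative carries over the norm and
  all pairings with Borel functions.\<close>

lemma L2_borel_representative:
  assumes "v \<in> L2 D" and D[measurable]: "D \<in> sets borel"
  shows "\<exists>v'. v' \<in> borel_measurable borel \<and> (\<forall>x. x \<notin> D \<longrightarrow> v' x = 0) \<and> (AE x in lebesgue. x \<in> D \<longrightarrow> v x = v' x) \<and>
    integrable lborel (\<lambda>x. (v' x)\<^sup>2) \<and> (\<integral>\<^sup>+x. ennreal ((v' x)\<^sup>2) \<partial>lborel) = ennreal ((L2_norm D v)\<^sup>2) \<and>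
    (\<forall>\<phi>. \<phi> \<in> borel_measurable borel \<longrightarrow> (LINT x|lebesgue_on D. v x * \<phi> x) = (\<integral>x. v' x * \<phi> x \<partial>lborel))"
proof -
  have DL: "D \<in> sets lebesgue" using D by simp
  have vm: "v \<in> borel_measurable (lebesgue_on D)" and v2: "integrable (lebesgue_on D) (\<lambda>x. (v x)\<^sup>2)"
    using assms(1) by (auto simp: L2_def)
  define v0 where "v0 x = (if x \<in> D then v x else 0)" for x
  have "v0 \<in> borel_measurable (completion lborel)"
    using vm DL unfolding v0_def by (simp add: borel_measurable_if)
  from completion_ex_borel_measurable_real[OF this]
  obtain v1 where v1[measurable]: "v1 \<in> borel_measurable lborel" and ae: "AE x in lborel. v0 x = v1 x" by (elim bexE)
  have ae: "AE x in lebesgue. v0 x = v1 x" using ae by (rule AE_completion)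
  \<comment> \<open>\<open>v1\<close> agrees with the zero extension only almost everywhere; the
    indicator restores exact vanishing outside \<open>D\<close>.\<close>
  define v' where "v' x = v1 x * indicator D x" for x
  have [measurable]: "v' \<in> borel_measurable borel" using v1 unfolding v'_def by simp
  have ae': "AE x in lebesgue. v x * indicator D x = v' x"
    using ae by eventually_elim (auto simp: v0_def v'_def split: split_indicator)
  have int: "(LINT x|lebesgue_on D. v x * \<phi> x) = (\<integral>x. v' x * \<phi> x \<partial>lborel)"
    if [measurable]: "\<phi> \<in> borel_measurable borel" for \<phi>
  proof -
    have "(LINT x|lebesgue_on D. v x * \<phi> x) = (LINT x|lebesgue. indicator D x *\<^sub>R (v x * \<phi> x))"
      using DL by (simp add: integral_restrict_space)
    also have "\<dots> = (LINT x|lebesgue. v' x * \<phi> x)"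
    proof (rule integral_cong_AE)
      have "(\<lambda>x. indicator D x *\<^sub>R (v x * \<phi> x)) = (\<lambda>x. v0 x * \<phi> x)"
        by (auto simp: v0_def fun_eq_iff split: split_indicator)
      moreover have "\<phi> \<in> borel_measurable lebesgue" using that by (simp add: measurable_completion)
      ultimately show "(\<lambda>x. indicator D x *\<^sub>R (v x * \<phi> x)) \<in> borel_measurable lebesgue"
        using \<open>v0 \<in> borel_measurable (completion lborel)\<close> by simp
      show "(\<lambda>x. v' x * \<phi> x) \<in> borel_measurable lebesgue" by (rule measurable_completion) measurable
      show "AE x in lebesgue. indicator D x *\<^sub>R (v x * \<phi> x) = v' x * \<phi> x"
        using ae' by eventually_elim (auto simp: v'_def split: split_indicator)
    qed
    also have "\<dots> = (\<integral>x. v' x * \<phi> x \<partial>lborel)" by (rule integral_completion) measurable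
    finally show ?thesis .
  qed
  have v0sq: "integrable lebesgue (\<lambda>x. (v0 x)\<^sup>2)"
  proof -
    have "integrable lebesgue (\<lambda>x. indicator D x *\<^sub>R (v x)\<^sup>2)"
      using v2 DL by (simp add: integrable_restrict_space)
    moreover have "(\<lambda>x. indicator D x *\<^sub>R (v x)\<^sup>2) = (\<lambda>x. (v0 x)\<^sup>2)"
      by (auto simp: v0_def fun_eq_iff split: split_indicator)
    ultimately show ?thesis by simp
  qed
  have "AE x in lebesgue. (v0 x)\<^sup>2 = (v' x)\<^sup>2"
    using ae' by eventually_elim (auto simp: v0_def v'_def split: split_indicator split: if_splits)
  note sq_ae = this
  have m0: "(\<lambda>x. (v0 x)\<^sup>2) \<in> borel_measurable lebesgue" using v0sq by (rule borel_measurable_integrable)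
  have m': "(\<lambda>x. (v' x)\<^sup>2) \<in> borel_measurable lebesgue" by (rule measurable_completion) measurable
  have eqi: "(LINT x|lebesgue. (v0 x)\<^sup>2) = (LINT x|lebesgue. (v' x)\<^sup>2)"
    by (rule integral_cong_AE[OF m0 m' sq_ae])
  have v'i: "integrable lebesgue (\<lambda>x. (v' x)\<^sup>2)"
    using integrable_cong_AE[OF m0 m' sq_ae] v0sq by (rule iffD1)
  have "(\<lambda>x. (v' x)\<^sup>2) \<in> borel_measurable lborel" by measurable
  then have i: "integrable lborel (\<lambda>x. (v' x)\<^sup>2)" using v'i by (simp only: integrable_completion)
  have "(L2_norm D v)\<^sup>2 = (LINT x|lebesgue_on D. (v x)\<^sup>2)"
    by (simp add: L2_norm_def integral_nonneg_AE)
  also have "\<dots> = (LINT x|lebesgue. (v0 x)\<^sup>2)"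
    using DL by (simp add: integral_restrict_space) (auto simp: v0_def intro!: Bochner_Integration.integral_cong split: split_indicator)
  also have "\<dots> = (\<integral>x. (v' x)\<^sup>2 \<partial>lborel)" unfolding eqi by (rule integral_completion) measurable
  finally have "(\<integral>\<^sup>+x. ennreal ((v' x)\<^sup>2) \<partial>lborel) = ennreal ((L2_norm D v)\<^sup>2)"
    using nn_integral_eq_integral[OF i] by simp
  moreover have "AE x in lebesgue. x \<in> D \<longrightarrow> v x = v' x" using ae' by eventually_elim (auto simp: v'_def)
  ultimately show ?thesis using int i by (intro exI[of _ v']) (auto simp: v'_def)
qed

text \<open>On \<open>D\<close>, which has finite area, the function is dominated by
  \<open>1 + (f x)\<^sup>2\<close>.\<close>

lemma square_integrable_imp_integrable:
  fixes f :: "real^2 \<Rightarrow> real"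
  assumes [measurable]: "f \<in> borel_measurable borel" and f2: "integrable lborel (\<lambda>x. (f x)\<^sup>2)"
    and supp: "\<And>x. x \<notin> D \<Longrightarrow> f x = 0" and D: "D \<in> sets borel" "bounded D"
  shows "integrable lborel f"
proof (rule Bochner_Integration.integrable_bound)
  show "integrable lborel (\<lambda>x. indicator D x + (f x)\<^sup>2)"
    using f2 D by (intro Bochner_Integration.integrable_add integrable_real_indicator emeasure_bounded_finite) auto
  show "AE x in lborel. norm (f x) \<le> norm (indicator D x + (f x)\<^sup>2)"
  proof (intro AE_I2)
    fix x
    have "\<bar>f x\<bar> \<le> 1 + (f x)\<^sup>2"
      using zero_le_power2[of "\<bar>f x\<bar> - 1"] zero_le_power2[of "f x"] by (simp add: power2_diff)
    then show "norm (f x) \<le> norm (indicator D x + (f x)\<^sup>2)"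
      using supp[of x] by (cases "x \<in> D") auto
  qed
qed measurable

lemma square_sum_le: "(a + b)\<^sup>2 \<le> 2 * a\<^sup>2 + 2 * b\<^sup>2" for a b :: real
  using zero_le_power2[of "a - b"] by (simp add: power2_sum power2_diff)

lemma clamp_continuous:
  fixes g :: "real^2 \<Rightarrow> real"
  assumes "continuous_on UNIV g"
  shows "continuous_on UNIV (\<lambda>x. max (- N) (min N (g x)))"
  by (intro continuous_intros assms)

text \<open>Truncation reduces to a bounded function. \<open>measurable_on\<close> then supplies
  continuous functions that converge off a negligible set, and clamping them to the same bound
  permits dominated convergence.\<close>

lemma continuous_dense_in_L2:
  fixes f :: "real^2 \<Rightarrow> real"
  assumes f[measurable]: "f \<in> borel_measurable borel" and D[measurable]: "D \<in> sets borel" and bd: "bounded D"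
    and supp: "\<And>x. x \<notin> D \<Longrightarrow> f x = 0" and f2: "integrable lborel (\<lambda>x. (f x)\<^sup>2)" and \<delta>: "\<delta> > 0"
  shows "\<exists>\<psi> M. continuous_on UNIV \<psi> \<and> (\<forall>x. \<bar>\<psi> x\<bar> \<le> M) \<and>
     integrable lborel (\<lambda>x. (f x - \<psi> x * indicator D x)\<^sup>2) \<and> (\<integral>x. (f x - \<psi> x * indicator D x)\<^sup>2 \<partial>lborel) \<le> \<delta>"
proof -
  define T where "T n x = max (- real n) (min (real n) (f x))" for n x
  have [measurable]: "T n \<in> borel_measurable borel" for n unfolding T_def by measurable
  have Tsq: "(f x - T n x)\<^sup>2 \<le> (f x)\<^sup>2" for n x
    by (rule abs_le_square_iff[THEN iffD1]) (auto simp: T_def max_def min_def)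
  have "(\<lambda>n. \<integral>x. (f x - T n x)\<^sup>2 \<partial>lborel) \<longlonglongrightarrow> (\<integral>x. (0::real) \<partial>(lborel :: (real^2) measure))"
  proof (rule integral_dominated_convergence[where w="\<lambda>x. (f x)\<^sup>2"])
    show "AE x in lborel. (\<lambda>n. (f x - T n x)\<^sup>2) \<longlonglongrightarrow> 0"
    proof (rule AE_I2)
      fix x
      obtain n0 :: nat where n0: "\<bar>f x\<bar> \<le> real n0" using real_arch_simple by blast
      have "(f x - T n x)\<^sup>2 = 0" if "n \<ge> n0" for n
        using n0 of_nat_mono[OF that, where ?'a=real] by (simp add: T_def)
      then show "(\<lambda>n. (f x - T n x)\<^sup>2) \<longlonglongrightarrow> 0"
        by (intro tendsto_eventually eventually_sequentiallyI[of n0])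
    qed
    show "AE x in lborel. norm ((f x - T n x)\<^sup>2) \<le> (f x)\<^sup>2" for n using Tsq by simp
  qed (use f2 in measurable)
  then have "(\<lambda>n. \<integral>x. (f x - T n x)\<^sup>2 \<partial>lborel) \<longlonglongrightarrow> 0" by simp
  \<comment> \<open>Splitting the square of a sum doubles each of the two errors, hence a quarter of
    \<delta> for each.\<close>
  from order_tendstoD(2)[OF this, of "\<delta>/4"] \<delta> obtain n where n: "(\<integral>x. (f x - T n x)\<^sup>2 \<partial>lborel) < \<delta>/4"
    by (auto simp: eventually_sequentially)
  have Tb: "\<bar>T n x\<bar> \<le> real n" for x by (auto simp: T_def)
  have T0: "T n x = 0" if "x \<notin> D" for x using supp[OF that] by (simp add: T_def)
  have "T n \<in> borel_measurable lebesgue" by (rule measurable_completion) measurable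
  then have "T n measurable_on UNIV" by (intro lebesgue_measurable_imp_measurable_on) auto
  then obtain N g where N: "negligible N" and g: "\<And>k. continuous_on UNIV (g k)"
    and lim: "\<And>x. x \<notin> N \<Longrightarrow> (\<lambda>k. g k x) \<longlonglongrightarrow> T n x"
    unfolding measurable_on_def by auto
  define h where "h k x = max (- real n) (min (real n) (g k x))" for k :: nat and x
  have h: "continuous_on UNIV (h k)" for k unfolding h_def by (rule clamp_continuous[OF g])
  have [measurable]: "h k \<in> borel_measurable borel" for k by (rule borel_measurable_continuous_onI[OF h])
  have hb: "\<bar>h k x\<bar> \<le> real n" for k x by (auto simp: h_def)
  have hlim: "(\<lambda>k. h k x) \<longlonglongrightarrow> T n x" if "x \<notin> N" for x
  proof -
    have "(\<lambda>k. h k x) \<longlonglongrightarrow> max (- real n) (min (real n) (T n x))"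
      unfolding h_def by (intro tendsto_max tendsto_min tendsto_const lim that)
    moreover have "max (- real n) (min (real n) (T n x)) = T n x" using Tb[of x] by (simp add: abs_le_iff)
    ultimately show ?thesis by simp
  qed
  have iD: "integrable lborel (\<lambda>x. c * indicator D x :: real)" for c
    using emeasure_bounded_finite[OF bd] by (intro integrable_mult_right integrable_real_indicator) auto
  have bound: "(T n x - h k x * indicator D x)\<^sup>2 \<le> (2 * real n)\<^sup>2 * indicator D x" for k x
  proof (cases "x \<in> D")
    case True
    have "\<bar>T n x - h k x\<bar> \<le> \<bar>2 * real n\<bar>" using Tb[of x] hb[of k x] by linarith
    then have "(T n x - h k x)\<^sup>2 \<le> (2 * real n)\<^sup>2" by (simp only: abs_le_square_iff)
    then show ?thesis using True by simp
  next
    case False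
    then show ?thesis by (simp add: T0)
  qed
  have "(\<lambda>k. \<integral>x. (T n x - h k x * indicator D x)\<^sup>2 \<partial>lborel) \<longlonglongrightarrow> (\<integral>x. (0::real) \<partial>(lborel :: (real^2) measure))"
  proof (rule integral_dominated_convergence[where w="\<lambda>x. (2 * real n)\<^sup>2 * indicator D x"])
    show "integrable lborel (\<lambda>x. (2 * real n)\<^sup>2 * indicator D x :: real)" by (rule iD)
    have "AE x in lborel. x \<notin> N"
    proof -
      have "N \<in> null_sets lebesgue" using N by (simp add: negligible_iff_null_sets)
      then have "AE x in lebesgue. x \<notin> N" by (rule AE_not_in)
      then show ?thesis by (simp add: AE_completion_iff)
    qed
    then show "AE x in lborel. (\<lambda>k. (T n x - h k x * indicator D x)\<^sup>2) \<longlonglongrightarrow> 0"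
    proof (rule AE_mp, intro AE_I2 impI)
      fix x assume "x \<notin> N"
      show "(\<lambda>k. (T n x - h k x * indicator D x)\<^sup>2) \<longlonglongrightarrow> 0"
      proof (cases "x \<in> D")
        case True
        have "(\<lambda>k. (T n x - h k x * indicator D x)\<^sup>2) \<longlonglongrightarrow> (T n x - T n x * indicator D x)\<^sup>2"
          by (intro tendsto_intros hlim \<open>x \<notin> N\<close>)
        then show ?thesis using True by simp
      next
        case False
        then show ?thesis by (simp add: T0)
      qed
    qed
    show "AE x in lborel. norm ((T n x - h k x * indicator D x)\<^sup>2) \<le> (2 * real n)\<^sup>2 * indicator D x" for k
      using bound by simp
  qed measurable
  then have "(\<lambda>k. \<integral>x. (T n x - h k x * indicator D x)\<^sup>2 \<partial>lborel) \<longlonglongrightarrow> 0" by simp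
  from order_tendstoD(2)[OF this, of "\<delta>/4"] \<delta>
  obtain k where k: "(\<integral>x. (T n x - h k x * indicator D x)\<^sup>2 \<partial>lborel) < \<delta>/4"
    by (auto simp: eventually_sequentially)
  have i1: "integrable lborel (\<lambda>x. (f x - T n x)\<^sup>2)"
    by (rule Bochner_Integration.integrable_bound[OF f2]) (use Tsq in auto)
  have i2: "integrable lborel (\<lambda>x. (T n x - h k x * indicator D x)\<^sup>2)"
    by (rule Bochner_Integration.integrable_bound[OF iD[of "(2 * real n)\<^sup>2"]]) (use bound in auto)
  have le: "(f x - h k x * indicator D x)\<^sup>2 \<le> 2 * (f x - T n x)\<^sup>2 + 2 * (T n x - h k x * indicator D x)\<^sup>2" for x
    using square_sum_le[of "f x - T n x" "T n x - h k x * indicator D x"] by simp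
  have i3: "integrable lborel (\<lambda>x. 2 * (f x - T n x)\<^sup>2 + 2 * (T n x - h k x * indicator D x)\<^sup>2)"
    using i1 i2 by simp
  have i: "integrable lborel (\<lambda>x. (f x - h k x * indicator D x)\<^sup>2)"
    by (rule Bochner_Integration.integrable_bound[OF i3]) (use le in auto)
  have "(\<integral>x. (f x - h k x * indicator D x)\<^sup>2 \<partial>lborel) \<le> (\<integral>x. 2 * (f x - T n x)\<^sup>2 + 2 * (T n x - h k x * indicator D x)\<^sup>2 \<partial>lborel)"
    by (rule integral_mono[OF i i3 le])
  also have "\<dots> = 2 * (\<integral>x. (f x - T n x)\<^sup>2 \<partial>lborel) + 2 * (\<integral>x. (T n x - h k x * indicator D x)\<^sup>2 \<partial>lborel)"
    using i1 i2 by simp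
  also have "\<dots> \<le> \<delta>" using n k by simp
  finally show ?thesis using h hb i by (intro exI[of _ "h k"] exI[of _ "real n"] conjI allI)
qed

section \<open>Geometry of sets that are star-shaped with respect to a ball\<close>

lemma star_shaped_segment:
  assumes "star_shaped_wrt S B" "x \<in> S" "y \<in> B" "0 \<le> s" "s \<le> 1"
  shows "y + s *\<^sub>R (x - y) \<in> S"
proof -
  have "(1 - s) *\<^sub>R y + s *\<^sub>R x \<in> convex hull (insert x B)"
    by (intro convexD[OF convex_convex_hull] hull_inc) (use assms in auto)
  then have "(1 - s) *\<^sub>R y + s *\<^sub>R x \<in> S" using assms(1,2) unfolding star_shaped_wrt_def by blast
  then show ?thesis by (simp add: algebra_simps)
qed

text \<open>A point \<open>z\<close> this close to the contracted point divides, with weight \<eta>,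
  the segment from \<open>x\<close> to some \<open>y\<close> of the central ball, and this segment
  lies in \<open>S\<close>.\<close>

lemma star_shaped_shrink:
  assumes star: "star_shaped_wrt S (cball c r)" and x: "x \<in> S" and \<eta>: "0 < \<eta>" "\<eta> \<le> 1"
  shows "cball (c + (1 - \<eta>) *\<^sub>R (x - c)) (\<eta> * r) \<subseteq> S"
proof
  fix z assume z: "z \<in> cball (c + (1 - \<eta>) *\<^sub>R (x - c)) (\<eta> * r)"
  define y where "y = (1/\<eta>) *\<^sub>R (z - (1 - \<eta>) *\<^sub>R x)"
  have zy: "z = y + (1 - \<eta>) *\<^sub>R (x - y)"
  proof -
    have "y + (1 - \<eta>) *\<^sub>R (x - y) = \<eta> *\<^sub>R y + (1 - \<eta>) *\<^sub>R x" by (simp add: algebra_simps)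
    also have "\<eta> *\<^sub>R y = z - (1 - \<eta>) *\<^sub>R x" using \<eta> by (simp add: y_def)
    finally show ?thesis by simp
  qed
  have "\<eta> *\<^sub>R (c - y) = c + (1 - \<eta>) *\<^sub>R (x - c) - z"
    using \<eta> by (simp add: y_def algebra_simps)
  then have "\<eta> * norm (c - y) = dist (c + (1 - \<eta>) *\<^sub>R (x - c)) z"
    using \<eta> by (metis abs_of_pos dist_norm norm_scaleR)
  then have "\<eta> * norm (c - y) \<le> \<eta> * r" using z by simp
  then have "y \<in> cball c r" using \<eta> by (simp add: dist_norm)
  then show "z \<in> S" unfolding zy by (rule star_shaped_segment[OF star x]) (use \<eta> in auto)
qed

text \<open>Half of the radius leaves a closed ball inside an open ball contained in
  \<open>S\<close>, hence in the interior.\<close>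

lemma star_shaped_shrink_interior:
  assumes star: "star_shaped_wrt S (cball c r)" and x: "x \<in> S" and \<eta>: "0 < \<eta>" "\<eta> \<le> 1" and r: "r > 0"
  shows "cball (c + (1 - \<eta>) *\<^sub>R (x - c)) (\<eta> * r / 2) \<subseteq> interior S"
proof -
  have "ball (c + (1 - \<eta>) *\<^sub>R (x - c)) (\<eta> * r) \<subseteq> interior S"
    using star_shaped_shrink[OF star x \<eta>] ball_subset_cball by (intro interior_maximal) auto
  moreover have "cball (c + (1 - \<eta>) *\<^sub>R (x - c)) (\<eta> * r / 2) \<subseteq> ball (c + (1 - \<eta>) *\<^sub>R (x - c)) (\<eta> * r)"
    using mult_pos_pos[OF \<eta>(1) r] by (simp add: cball_subset_ball_iff)
  ultimately show ?thesis by blast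
qed

text \<open>Contracted points are interior and tend to the original point as the contraction tends
  to the identity.\<close>

lemma star_shaped_closure_interior:
  assumes "star_shaped_wrt S (cball c r)" "r > 0"
  shows "S \<subseteq> closure (interior S)"
proof
  fix x assume x: "x \<in> S"
  show "x \<in> closure (interior S)"
    unfolding closure_approachable
  proof (intro allI impI)
    fix e :: real assume e: "e > 0"
    \<comment> \<open>The added 1 keeps the denominator positive when \<open>x\<close> is the
      centre.\<close>
    define \<eta> where "\<eta> = min 1 (e / (2 * (norm (x - c) + 1)))"
    have \<eta>: "0 < \<eta>" "\<eta> \<le> 1" using e by (auto simp: \<eta>_def intro!: divide_pos_pos add_nonneg_pos)
    let ?z = "c + (1 - \<eta>) *\<^sub>R (x - c)"
    have "?z \<in> cball ?z (\<eta> * r / 2)" using \<eta> assms by simp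
    then have "?z \<in> interior S" using star_shaped_shrink_interior[OF assms(1) x \<eta> assms(2)] by blast
    moreover have "?z - x = (- \<eta>) *\<^sub>R (x - c)" by (simp add: algebra_simps)
    then have "dist ?z x = \<eta> * norm (x - c)" using \<eta> unfolding dist_norm by simp
    moreover have "\<eta> * norm (x - c) < e"
    proof -
      have "\<eta> * norm (x - c) \<le> (e / (2 * (norm (x - c) + 1))) * norm (x - c)"
        by (intro mult_right_mono) (auto simp: \<eta>_def)
      also have "\<dots> = e * (norm (x - c) / (2 * (norm (x - c) + 1)))" by simp
      also have "\<dots> < e * 1"
      proof (intro mult_strict_left_mono e)
        have "0 < 2 * (N + 1)" "N < 2 * (N + 1)" if "N \<ge> 0" for N :: real using that by auto
        from this[OF norm_ge_zero[of "x - c"]] show "norm (x - c) / (2 * (norm (x - c) + 1)) < 1" by (simp only: divide_less_eq_1_pos)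
      qed
      finally show ?thesis by simp
    qed
    ultimately show "\<exists>y\<in>interior S. dist y x < e" by (intro bexI[of _ ?z]) auto
  qed
qed

text \<open>A ray from the centre meets the frontier at most once, because on it every point
  strictly before a point of \<open>S\<close> is interior. Closed sets with this property are
  negligible.\<close>

lemma star_shaped_negligible_frontier:
  assumes star: "star_shaped_wrt S (cball c r)" and r: "r > 0" and S: "closed S"
  shows "negligible (frontier S)"
proof (rule starlike_negligible[where a=c])
  show "closed (frontier S)" by simp
  fix q x assume h: "c + q *\<^sub>R x \<in> frontier S" "0 \<le> q" "c + x \<in> frontier S"
  have in_S: "y \<in> S" if "y \<in> frontier S" for y using that S frontier_subset_closed by blast
  \<comment> \<open>The hypotheses on \<open>s\<close> contradict each other. The conclusion is
    phrased so that the instance \<open>s = q\<close> reads \<open>q \<noteq> q\<close>.\<close>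
  have small: "q \<noteq> s" if "0 \<le> s" "s < 1" "c + s *\<^sub>R y \<in> frontier S" "y + c \<in> S" for s y
    using that
  proof -
    have "cball (c + (1 - (1 - s)) *\<^sub>R ((y + c) - c)) ((1 - s) * r / 2) \<subseteq> interior S"
      by (rule star_shaped_shrink_interior[OF star that(4)]) (use that r in auto)
    then have "c + s *\<^sub>R y \<in> interior S" using that(2) r by auto
    then show ?thesis using that(3) by (simp add: frontier_def)
  qed
  show "q = 1"
  proof (rule ccontr)
    assume "q \<noteq> 1"
    then consider "q < 1" | "q > 1" by linarith
    then show False
    proof cases
      case 1
      then show False using small[OF h(2) 1 h(1)] in_S[OF h(3)] by (simp add: add.commute)
    next
      case 2
      \<comment> \<open>The roles are exchanged: \<open>c + x\<close> is the contraction of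
        \<open>c + q *\<^sub>R x\<close> by the factor \<open>1/q\<close>.\<close>
      have "cball (c + (1 - (1 - 1/q)) *\<^sub>R ((c + q *\<^sub>R x) - c)) ((1 - 1/q) * r / 2) \<subseteq> interior S"
        by (rule star_shaped_shrink_interior[OF star in_S[OF h(1)]]) (use 2 r in auto)
      moreover have "c + (1 - (1 - 1/q)) *\<^sub>R ((c + q *\<^sub>R x) - c) = c + x" using 2 by simp
      moreover have "0 \<le> (1 - 1/q) * r / 2" using 2 r by simp
      ultimately have "c + x \<in> interior S" by (metis centre_in_cball subsetD)
      then show False using h(3) by (simp add: frontier_def)
    qed
  qed
qed

subsection \<open>Weak derivatives of polynomials\<close>

text \<open>By translation invariance the difference quotients of \<open>F\<close> have integral
  zero, and they converge to \<open>G\<close> under a common integrable bound.\<close>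

lemma integral_directional_derivative_zero:
  fixes F G :: "real^2 \<Rightarrow> real"
  assumes F: "\<And>x s. ((\<lambda>s. F (x + s *\<^sub>R v)) has_real_derivative G (x + s *\<^sub>R v)) (at s)"
    and contF: "continuous_on UNIV F" and contG: "continuous_on UNIV G"
    and supp: "\<And>x. x \<notin> ball 0 \<rho> \<Longrightarrow> F x = 0" "\<And>x. x \<notin> ball 0 \<rho> \<Longrightarrow> G x = 0" and v: "norm v \<le> 1"
  shows "(\<integral>x. G x \<partial>lborel) = 0"
proof -
  note [measurable] = borel_measurable_continuous_onI[OF contF] borel_measurable_continuous_onI[OF contG]
  have iF: "integrable lborel F" by (rule compact_support_integrable[OF contF supp(1)])
  have iF': "integrable lborel (\<lambda>x. F (x + a))" "(\<integral>x. F (x + a) \<partial>lborel) = (\<integral>x. F x \<partial>lborel)" for a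
  proof -
    have eq: "distr lborel borel ((+) a) = (lborel :: (real^2) measure)" using lborel_distr_plus[of a] .
    show "integrable lborel (\<lambda>x. F (x + a))"
      using integrable_distr_eq[of "(+) a" lborel borel F] iF unfolding eq by (simp add: add.commute)
    show "(\<integral>x. F (x + a) \<partial>lborel) = (\<integral>x. F x \<partial>lborel)"
      using integral_distr[of "(+) a" lborel borel F] unfolding eq by (simp add: add.commute)
  qed
  obtain M where M: "\<And>x. \<bar>G x\<bar> \<le> M"
  proof -
    have "compact (G ` cball 0 \<rho>)"
      by (intro compact_continuous_image continuous_on_subset[OF contG] compact_cball) auto
    then obtain M where M: "\<forall>x\<in>cball 0 \<rho>. \<bar>G x\<bar> \<le> M"
      using compact_imp_bounded[of "G ` cball 0 \<rho>"] by (auto simp: bounded_iff)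
    have "\<bar>G x\<bar> \<le> max M 0" for x
    proof (cases "x \<in> ball 0 \<rho>")
      case True
      then have "x \<in> cball 0 \<rho>" by simp
      then show ?thesis using bspec[OF M] by force
    next
      case False
      then show ?thesis using supp(2) by simp
    qed
    then show ?thesis using that by blast
  qed
  define q where "q n x = (F (x + (1 / real (Suc n)) *\<^sub>R v) - F x) / (1 / real (Suc n))" for n x
  have [measurable]: "q n \<in> borel_measurable borel" for n unfolding q_def by measurable
  have "(\<lambda>n. \<integral>x. q n x \<partial>lborel) \<longlonglongrightarrow> (\<integral>x. G x \<partial>lborel)"
  \<comment> \<open>The mean value theorem bounds the quotients by the maximum of \<open>G\<close>,
    and increments of length at most 1 enlarge the support by at most 1.\<close>
  proof (rule integral_dominated_convergence[where w="\<lambda>x. M * indicator (ball 0 (\<rho> + 1)) x"])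
    show "integrable lborel (\<lambda>x. M * indicator (ball (0::real^2) (\<rho> + 1)) x)"
      by (intro integrable_mult_right integrable_real_indicator emeasure_bounded_finite) auto
    show "AE x in lborel. (\<lambda>n. q n x) \<longlonglongrightarrow> G x"
    proof (rule AE_I2)
      fix x
      have "((\<lambda>h. (F (x + h *\<^sub>R v) - F x) / h) \<longlongrightarrow> G x) (at 0)"
        using F[of x 0] by (simp add: DERIV_def)
      moreover have "filterlim (\<lambda>n. 1 / real (Suc n)) (at 0) sequentially"
        unfolding filterlim_at using LIMSEQ_inverse_real_of_nat by (auto simp: inverse_eq_divide)
      ultimately show "(\<lambda>n. q n x) \<longlonglongrightarrow> G x" unfolding q_def by (rule filterlim_compose)
    qed
    show "AE x in lborel. norm (q n x) \<le> M * indicator (ball 0 (\<rho> + 1)) x" for n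
    proof (rule AE_I2)
      fix x
      define h where "h = 1 / real (Suc n)"
      have h: "0 < h" "h \<le> 1" by (auto simp: h_def)
      show "norm (q n x) \<le> M * indicator (ball 0 (\<rho> + 1)) x"
      proof (cases "x \<in> ball 0 (\<rho> + 1)")
        case True
        have "\<exists>\<xi>>0. \<xi> < h \<and> F (x + h *\<^sub>R v) - F (x + 0 *\<^sub>R v) = (h - 0) * G (x + \<xi> *\<^sub>R v)"
          by (rule MVT2[OF h(1)]) (rule F)
        then obtain \<xi> where "F (x + h *\<^sub>R v) - F x = h * G (x + \<xi> *\<^sub>R v)" by auto
        then have "q n x = G (x + \<xi> *\<^sub>R v)" using h unfolding q_def h_def[symmetric] by simp
        then show ?thesis using M True by simp
      next
        case False
        have "norm (h *\<^sub>R v) \<le> 1" using h v by (simp add: mult_le_one)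
        then have "x \<notin> ball 0 \<rho>" "x + h *\<^sub>R v \<notin> ball 0 \<rho>"
          using False norm_triangle_ineq4[of "x + h *\<^sub>R v" "h *\<^sub>R v"] by auto
        then have "F x = 0" "F (x + h *\<^sub>R v) = 0" using supp(1) by blast+
        then have "q n x = 0" unfolding q_def h_def[symmetric] by simp
        then show ?thesis using False by simp
      qed
    qed
  qed measurable
  moreover have "(\<integral>x. q n x \<partial>lborel) = 0" for n
    unfolding q_def using iF iF' by simp
  ultimately show ?thesis using LIMSEQ_unique tendsto_const by (metis (no_types, lifting) ext)
qed

text \<open>\<open>partial_deriv\<close> evaluates the differential on the axis vectors, and
  linearity recovers the differential from these two values. Off the closed support the function is
  zero in a neighbourhood.\<close>

lemma test_function_gradient:
  assumes "\<phi> \<in> test_functions D"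
  shows "(\<phi> has_derivative (\<lambda>h. partial_deriv 1 \<phi> x * h$1 + partial_deriv 2 \<phi> x * h$2)) (at x)"
    "continuous_on UNIV (partial_deriv i \<phi>)" "x \<notin> closure {x. \<phi> x \<noteq> 0} \<Longrightarrow> partial_deriv i \<phi> x = 0"
proof -
  have s: "foldr partial_deriv is \<phi> differentiable (at x)" for "is" x
    using assms by (auto simp: test_functions_def smooth_def)
  have d: "(\<phi> has_derivative frechet_derivative \<phi> (at x)) (at x)"
    using s[of "[]"] by (simp add: frechet_derivative_works)
  have lin: "linear (frechet_derivative \<phi> (at x))" using d has_derivative_linear by blast
  have "frechet_derivative \<phi> (at x) h = partial_deriv 1 \<phi> x * h$1 + partial_deriv 2 \<phi> x * h$2" for h
  proof -
    have "h = h$1 *\<^sub>R axis 1 1 + h$2 *\<^sub>R axis 2 1"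
      by (simp add: vec_eq_iff forall_2 axis_def)
    then have "frechet_derivative \<phi> (at x) h = frechet_derivative \<phi> (at x) (h$1 *\<^sub>R axis 1 1 + h$2 *\<^sub>R axis 2 1)" by simp
    also have "\<dots> = partial_deriv 1 \<phi> x * h$1 + partial_deriv 2 \<phi> x * h$2"
      using lin by (simp add: linear_add linear_scale partial_deriv_def)
    finally show ?thesis .
  qed
  then show "(\<phi> has_derivative (\<lambda>h. partial_deriv 1 \<phi> x * h$1 + partial_deriv 2 \<phi> x * h$2)) (at x)"
    by (intro has_derivative_eq_rhs[OF d] ext)
  show "continuous_on UNIV (partial_deriv i \<phi>)"
    using s[of "[i]"] by (auto intro!: continuous_at_imp_continuous_on differentiable_imp_continuous_within)
  show "partial_deriv i \<phi> x = 0" if "x \<notin> closure {x. \<phi> x \<noteq> 0}"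
  proof -
    have "((\<lambda>x. 0) has_derivative (\<lambda>h. 0)) (at x)" by simp
    then have "(\<phi> has_derivative (\<lambda>h. 0)) (at x)"
      by (rule has_derivative_transform_within_open[where s="- closure {x. \<phi> x \<noteq> 0}"])
        (use that closure_subset[of "{x. \<phi> x \<noteq> 0}"] in auto)
    from frechet_derivative_at[OF this, symmetric] show ?thesis by (simp add: partial_deriv_def)
  qed
qed

lemma continuous_in_L2:
  assumes "continuous_on UNIV (q :: real^2 \<Rightarrow> real)" "bounded D" "D \<in> sets borel"
  shows "q \<in> L2 D"
proof -
  obtain \<rho> where "D \<subseteq> ball 0 \<rho>" using bounded_subset_ballD[OF assms(2), of 0] by auto
  then have \<rho>: "D \<subseteq> cball 0 \<rho>" using ball_subset_cball[of 0 \<rho>] by (rule order_trans)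
  have qm: "q \<in> borel_measurable lborel" using borel_measurable_continuous_onI[OF assms(1)] by simp
  then have q: "q \<in> borel_measurable lebesgue" by (rule measurable_completion)
  have "integrable lborel (\<lambda>x. indicator (cball 0 \<rho>) x *\<^sub>R (q x)\<^sup>2)"
    by (intro borel_integrable_compact compact_cball continuous_intros continuous_on_subset[OF assms(1)]) auto
  then have i: "integrable lborel (\<lambda>x. indicator D x *\<^sub>R (q x)\<^sup>2)"
  proof (rule Bochner_Integration.integrable_bound)
    show "(\<lambda>x. indicator D x *\<^sub>R (q x)\<^sup>2) \<in> borel_measurable lborel" using qm assms(3) by measurable
    show "AE x in lborel. norm (indicator D x *\<^sub>R (q x)\<^sup>2) \<le> norm (indicator (cball 0 \<rho>) x *\<^sub>R (q x)\<^sup>2)"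
    proof (rule AE_I2)
      fix x
      show "norm (indicator D x *\<^sub>R (q x)\<^sup>2) \<le> norm (indicator (cball 0 \<rho>) x *\<^sub>R (q x)\<^sup>2)"
        using subsetD[OF \<rho>, of x] by (cases "x \<in> D") simp_all
    qed
  qed
  have "integrable lebesgue (\<lambda>x. indicator D x *\<^sub>R (q x)\<^sup>2)"
    using i by (subst integrable_completion) auto
  then show ?thesis
    using assms(3) q by (auto simp: L2_def integrable_restrict_space measurable_restrict_space1)
qed

text \<open>Integration by parts: \<open>q x * \<phi> x\<close> has compact support, so the integral
  of its directional derivative over the plane is zero.\<close>

lemma polys_has_weak_deriv:
  assumes q: "\<And>x. (q has_derivative (\<lambda>h. q1 x * h$1 + q2 x * h$2)) (at x)"
    and cont: "continuous_on UNIV q" "continuous_on UNIV q1" "continuous_on UNIV q2" and D: "bounded D" "D \<in> sets borel"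
  shows "has_weak_deriv D (1, 0) q q1" "has_weak_deriv D (0, 1) q q2"
proof -
  have L2: "q \<in> L2 D" "q1 \<in> L2 D" "q2 \<in> L2 D" by (intro continuous_in_L2 cont D)+
  \<comment> \<open>Both coordinate directions are treated at once; \<open>qi\<close> is the
    derivative that belongs to direction \<open>i\<close>.\<close>
  have main: "(LINT x|lebesgue_on D. q x * partial_deriv i \<phi> x) = - (LINT x|lebesgue_on D. qi x * \<phi> x)"
    if \<phi>: "\<phi> \<in> test_functions D" and i: "i = 1 \<and> qi = q1 \<or> i = 2 \<and> qi = q2" for i qi \<phi>
  proof -
    let ?K = "closure {x. \<phi> x \<noteq> 0}"
    have K: "compact ?K" "?K \<subseteq> D" using \<phi> by (auto simp: test_functions_def)
    note g = test_function_gradient[OF \<phi>]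
    have c\<phi>: "continuous_on UNIV \<phi>"
      using g(1) by (meson has_derivative_continuous continuous_at_imp_continuous_on)
    have out: "\<phi> x = 0" "partial_deriv i \<phi> x = 0" if "x \<notin> ?K" for x
      using that g(3) closure_subset[of "{x. \<phi> x \<noteq> 0}"] by auto
    have cqi: "continuous_on UNIV qi" using i cont by auto
    obtain \<rho> where \<rho>: "?K \<subseteq> ball 0 \<rho>" using bounded_subset_ballD[OF compact_imp_bounded[OF K(1)], of 0] by auto
    have restrict: "(LINT x|lebesgue_on D. f x) = (\<integral>x. f x \<partial>lborel)"
      if "continuous_on UNIV f" "\<And>x. x \<notin> ?K \<Longrightarrow> f x = 0" for f :: "real^2 \<Rightarrow> real"
    proof -
      have "(LINT x|lebesgue_on D. f x) = (LINT x|lebesgue. indicator D x *\<^sub>R f x)"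
        using D by (simp add: integral_restrict_space)
      also have "(\<lambda>x. indicator D x *\<^sub>R f x) = f" using that(2) K(2) by (auto simp: fun_eq_iff indicator_def)
      also have "(LINT x|lebesgue. f x) = (\<integral>x. f x \<partial>lborel)"
        using borel_measurable_continuous_onI[OF that(1)] by (intro integral_completion) simp
      finally show ?thesis .
    qed
    have out': "\<phi> x = 0" "partial_deriv i \<phi> x = 0" if "x \<notin> ball 0 \<rho>" for x
      using out[of x] that \<rho> by blast+
    have cc: "continuous_on UNIV (\<lambda>x. qi x * \<phi> x)" "continuous_on UNIV (\<lambda>x. q x * partial_deriv i \<phi> x)"
      "continuous_on UNIV (\<lambda>x. q x * \<phi> x)"
      by (intro continuous_on_mult cqi cont(1) c\<phi> g(2))+
    have i1: "integrable lborel (\<lambda>x. qi x * \<phi> x)"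
      by (rule compact_support_integrable[where z=0 and r=\<rho>, OF cc(1)]) (simp only: out'(1) mult_zero_right not_False_eq_True)
    have i2: "integrable lborel (\<lambda>x. q x * partial_deriv i \<phi> x)"
      by (rule compact_support_integrable[where z=0 and r=\<rho>, OF cc(2)]) (simp only: out'(2) mult_zero_right not_False_eq_True)
    have "(\<integral>x. qi x * \<phi> x + q x * partial_deriv i \<phi> x \<partial>lborel) = 0"
    proof (rule integral_directional_derivative_zero[where F="\<lambda>x. q x * \<phi> x" and v="axis i 1" and \<rho>=\<rho>])
      fix x :: "real^2" and s
      let ?z = "x + s *\<^sub>R axis i 1"
      have ax: "(axis (1::2) (1::real))$1 = 1" "(axis (1::2) (1::real))$2 = 0" "(axis (2::2) (1::real))$1 = 0" "(axis (2::2) (1::real))$2 = 1"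
        by (simp_all add: axis_def)
      have l: "((\<lambda>s. x + s *\<^sub>R axis i 1) has_derivative (\<lambda>h. h *\<^sub>R axis i 1)) (at s)"
        by (auto intro!: derivative_eq_intros)
      have a: "((\<lambda>s. q (x + s *\<^sub>R axis i 1)) has_real_derivative qi ?z) (at s)"
        unfolding has_field_derivative_def
        by (rule has_derivative_eq_rhs[OF has_derivative_compose[OF l q]]) (use i ax in auto)
      have b: "((\<lambda>s. \<phi> (x + s *\<^sub>R axis i 1)) has_real_derivative partial_deriv i \<phi> ?z) (at s)"
        unfolding has_field_derivative_def
        by (rule has_derivative_eq_rhs[OF has_derivative_compose[OF l g(1)]]) (use i ax in auto)
      show "((\<lambda>s. q (x + s *\<^sub>R axis i 1) * \<phi> (x + s *\<^sub>R axis i 1)) has_real_derivative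
         qi ?z * \<phi> ?z + q ?z * partial_deriv i \<phi> ?z) (at s)"
        by (rule DERIV_cong[OF DERIV_mult[OF a b]]) simp
      show "continuous_on UNIV (\<lambda>x. qi x * \<phi> x + q x * partial_deriv i \<phi> x)" by (intro continuous_on_add cc)
    qed (simp_all only: cc out' mult_zero_right add_0 norm_axis_1 order_refl not_False_eq_True)
    then have "(\<integral>x. qi x * \<phi> x \<partial>lborel) + (\<integral>x. q x * partial_deriv i \<phi> x \<partial>lborel) = 0"
      using i1 i2 by simp
    moreover have "(LINT x|lebesgue_on D. q x * partial_deriv i \<phi> x) = (\<integral>x. q x * partial_deriv i \<phi> x \<partial>lborel)"
      by (rule restrict[OF cc(2)]) (simp only: out mult_zero_right not_False_eq_True)
    moreover have "(LINT x|lebesgue_on D. qi x * \<phi> x) = (\<integral>x. qi x * \<phi> x \<partial>lborel)"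
      by (rule restrict[OF cc(1)]) (simp only: out mult_zero_right not_False_eq_True)
    ultimately show ?thesis by simp
  qed
  show "has_weak_deriv D (1, 0) q q1" "has_weak_deriv D (0, 1) q q2"
    unfolding has_weak_deriv_def using L2 main by (auto simp: multi_deriv_def)
qed

text \<open>Splitting the integrals requires integrable products. On a bounded set test functions
  and their derivatives are square integrable, so these are products of two \<open>L2\<close>
  functions.\<close>

lemma has_weak_deriv_diff:
  assumes f: "has_weak_deriv D \<alpha> f v" and g: "has_weak_deriv D \<alpha> g w" and D: "D \<in> sets borel" "bounded D"
  shows "has_weak_deriv D \<alpha> (\<lambda>x. f x - g x) (\<lambda>x. v x - w x)"
proof -
  have L2_diff: "(\<lambda>x. a x - b x) \<in> L2 D" if "a \<in> L2 D" "b \<in> L2 D" for a b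
  proof -
    have [measurable]: "a \<in> borel_measurable (lebesgue_on D)" "b \<in> borel_measurable (lebesgue_on D)"
      and i: "integrable (lebesgue_on D) (\<lambda>x. (a x)\<^sup>2)" "integrable (lebesgue_on D) (\<lambda>x. (b x)\<^sup>2)"
      using that by (auto simp: L2_def)
    have "integrable (lebesgue_on D) (\<lambda>x. 2 * (a x)\<^sup>2 + 2 * (b x)\<^sup>2)" using i by simp
    then have "integrable (lebesgue_on D) (\<lambda>x. (a x - b x)\<^sup>2)"
    proof (rule Bochner_Integration.integrable_bound)
      show "AE x in lebesgue_on D. norm ((a x - b x)\<^sup>2) \<le> norm (2 * (a x)\<^sup>2 + 2 * (b x)\<^sup>2)"
        using square_sum_le[of "a _" "- b _"] by (intro AE_I2) simp
    qed measurable
    then show ?thesis by (simp add: L2_def)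
  qed
  have prod: "integrable (lebesgue_on D) (\<lambda>x. a x * b x)" if "a \<in> L2 D" "b \<in> L2 D" for a b
  proof -
    have [measurable]: "a \<in> borel_measurable (lebesgue_on D)" "b \<in> borel_measurable (lebesgue_on D)"
      and i: "integrable (lebesgue_on D) (\<lambda>x. (a x)\<^sup>2)" "integrable (lebesgue_on D) (\<lambda>x. (b x)\<^sup>2)"
      using that by (auto simp: L2_def)
    have "integrable (lebesgue_on D) (\<lambda>x. (a x)\<^sup>2 + (b x)\<^sup>2)" using i by simp
    then show ?thesis
    proof (rule Bochner_Integration.integrable_bound)
      have "\<bar>s * t\<bar> \<le> s\<^sup>2 + t\<^sup>2" for s t :: real
      proof -
        have "2 * (\<bar>s\<bar> * \<bar>t\<bar>) \<le> s\<^sup>2 + t\<^sup>2"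
          using zero_le_power2[of "\<bar>s\<bar> - \<bar>t\<bar>"] by (simp add: power2_diff)
        moreover have "0 \<le> \<bar>s\<bar> * \<bar>t\<bar>" by simp
        ultimately have "\<bar>s\<bar> * \<bar>t\<bar> \<le> s\<^sup>2 + t\<^sup>2" by linarith
        then show ?thesis by (simp add: abs_mult)
      qed
      then show "AE x in lebesgue_on D. norm (a x * b x) \<le> norm ((a x)\<^sup>2 + (b x)\<^sup>2)"
        by (intro AE_I2) simp
    qed measurable
  qed
  have test: "\<phi> \<in> L2 D \<and> multi_deriv \<alpha> \<phi> \<in> L2 D" if "\<phi> \<in> test_functions D" for \<phi>
  proof -
    have s: "foldr partial_deriv is \<phi> differentiable (at x)" for "is" x
      using that by (auto simp: test_functions_def smooth_def)
    then have c: "continuous_on UNIV (foldr partial_deriv is \<phi>)" for "is"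
      by (auto intro!: continuous_at_imp_continuous_on differentiable_imp_continuous_within)
    \<comment> \<open>This exhibits \<open>multi_deriv\<close> as one of the iterated derivatives
      that \<open>smooth\<close> speaks of.\<close>
    have fr: "foldr partial_deriv (replicate n i @ js) \<phi> = (partial_deriv i ^^ n) (foldr partial_deriv js \<phi>)" for n i js
      by (induction n) auto
    have "multi_deriv \<alpha> \<phi> = foldr partial_deriv (replicate (fst \<alpha>) 1 @ replicate (snd \<alpha>) 2 @ []) \<phi>"
      unfolding multi_deriv_def fr by simp
    then have "multi_deriv \<alpha> \<phi> \<in> L2 D" by (simp only: continuous_in_L2[OF c D(2,1)])
    moreover have "\<phi> \<in> L2 D" using continuous_in_L2[OF c[of "[]"] D(2,1)] by simp
    ultimately show ?thesis by simp
  qed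
  have eq: "(LINT x|lebesgue_on D. (f x - g x) * multi_deriv \<alpha> \<phi> x)
      = (-1) ^ (fst \<alpha> + snd \<alpha>) * (LINT x|lebesgue_on D. (v x - w x) * \<phi> x)" if \<phi>: "\<phi> \<in> test_functions D" for \<phi>
  proof -
    have L: "f \<in> L2 D" "g \<in> L2 D" "v \<in> L2 D" "w \<in> L2 D" using f g by (auto simp: has_weak_deriv_def)
    note t = test[OF \<phi>]
    have "(LINT x|lebesgue_on D. f x * multi_deriv \<alpha> \<phi> x) = (-1) ^ (fst \<alpha> + snd \<alpha>) * (LINT x|lebesgue_on D. v x * \<phi> x)"
      "(LINT x|lebesgue_on D. g x * multi_deriv \<alpha> \<phi> x) = (-1) ^ (fst \<alpha> + snd \<alpha>) * (LINT x|lebesgue_on D. w x * \<phi> x)"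
      using f g \<phi> by (auto simp: has_weak_deriv_def)
    then show ?thesis
      using prod[OF L(1) conjunct2[OF t]] prod[OF L(2) conjunct2[OF t]] prod[OF L(3) conjunct1[OF t]] prod[OF L(4) conjunct1[OF t]]
      by (simp add: left_diff_distrib right_diff_distrib)
  qed
  show ?thesis unfolding has_weak_deriv_def using f g eq
    by (auto simp: has_weak_deriv_def intro: L2_diff)
qed

subsection \<open>Smooth approximation on the whole of a star-shaped set\<close>

text \<open>Composing the mollification with a contraction towards the centre makes the smooth
  approximations live on all of \<open>S\<close>, so that no limit of approximating polynomials is needed.\<close>

lemma jet_affine:
  assumes "jet U"
  shows "jet (\<lambda>i j x. t ^ (i + j) * U i j (v + t *\<^sub>R x))"
  unfolding jet_def
proof (intro allI)
  fix i j x
  have "((\<lambda>x. U i j (v + t *\<^sub>R x)) has_derivative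
      (\<lambda>h. U (Suc i) j (v + t *\<^sub>R x) * (t *\<^sub>R h)$1 + U i (Suc j) (v + t *\<^sub>R x) * (t *\<^sub>R h)$2)) (at x)"
    by (rule has_derivative_compose[where g="U i j" and f="\<lambda>x. v + t *\<^sub>R x", OF _ jetD[OF assms]])
      (auto intro!: derivative_eq_intros)
  from has_derivative_mult_right[OF this, of "t ^ (i + j)"]
  show "((\<lambda>x. t ^ (i + j) * U i j (v + t *\<^sub>R x)) has_derivative
     (\<lambda>h. t ^ (Suc i + j) * U (Suc i) j (v + t *\<^sub>R x) * h$1 + t ^ (i + Suc j) * U i (Suc j) (v + t *\<^sub>R x) * h$2)) (at x)"
    by (rule has_derivative_eq_rhs) (auto simp: algebra_simps)
qed

locale star_shaped =
  fixes S :: "(real^2) set" and c :: "real^2" and r :: real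
  assumes S: "compact S" and r: "r > 0" and star: "star_shaped_wrt S (cball c r)"
begin

definition shrink :: "real \<Rightarrow> real^2 \<Rightarrow> real^2" where
  "shrink \<eta> x = c + (1 - \<eta>) *\<^sub>R (x - c)"

lemma shrink_affine: "shrink \<eta> x = (c - (1 - \<eta>) *\<^sub>R c) + (1 - \<eta>) *\<^sub>R x"
  by (simp add: shrink_def algebra_simps)

lemma shrink_cball:
  assumes "0 < \<eta>" "\<eta> \<le> 1" "x \<in> S"
  shows "cball (shrink \<eta> x) (\<eta> * r / 2) \<subseteq> interior S"
  unfolding shrink_def using star_shaped_shrink_interior[OF star assms(3,1,2) r] .

text \<open>The contraction moves \<open>x\<close> by at most \<eta> times its distance from
  \<open>c\<close>, and the radius of the ball is proportional to \<eta> as well.\<close>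

lemma shrink_close: "\<exists>d. 0 < d \<and> (\<forall>\<eta> x y. 0 < \<eta> \<longrightarrow> x \<in> S \<longrightarrow> y \<in> ball (shrink \<eta> x) (\<eta> * r / 2) \<longrightarrow> dist y x < \<eta> * d)"
proof -
  obtain d where d: "0 < d" "S \<subseteq> ball c d" using bounded_subset_ballD[OF compact_imp_bounded[OF S], of c] by auto
  have "dist y x < \<eta> * (d + r)" if "0 < \<eta>" "x \<in> S" "y \<in> ball (shrink \<eta> x) (\<eta> * r / 2)" for \<eta> x y
  proof -
    have "shrink \<eta> x - x = (- \<eta>) *\<^sub>R (x - c)" by (simp add: shrink_def algebra_simps)
    then have "dist (shrink \<eta> x) x = \<eta> * dist c x"
      using that(1) unfolding dist_norm by (simp add: norm_minus_commute)
    also have "\<dots> \<le> \<eta> * d" using subsetD[OF d(2) that(2)] that(1) by (intro mult_left_mono) auto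
    finally have "dist (shrink \<eta> x) x \<le> \<eta> * d" .
    moreover have "dist (shrink \<eta> x) y < \<eta> * r / 2" using that(3) by simp
    moreover have "0 < \<eta> * r" using that(1) r by simp
    ultimately show ?thesis
      using dist_triangle3[of y x "shrink \<eta> x"] by (simp add: ring_distribs)
  qed
  then show ?thesis using d(1) r by (intro exI[of _ "d + r"]) simp
qed

text \<open>Mollification at the contracted point sees only a ball in the interior whose points are
  all near \<open>x\<close>. Uniform continuity on the compact set \<open>S\<close> makes the
  estimate uniform up to the boundary.\<close>

lemma sup_approx:
  assumes g: "continuous_on S g" and f: "integrable lborel f"
    and ae: "AE y in lborel. y \<in> interior S \<longrightarrow> g y = f y" and \<delta>: "\<delta> > 0"
  shows "\<exists>\<eta>0>0. \<forall>\<eta> k. 0 < \<eta> \<longrightarrow> \<eta> \<le> \<eta>0 \<longrightarrow> \<eta> \<le> 1 \<longrightarrow> mollifier (\<eta> * r / 2) k \<longrightarrow>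
     (\<forall>x\<in>S. \<bar>conv f (k 0 0) (shrink \<eta> x) - g x\<bar> \<le> \<delta>)"
proof -
  obtain d where d: "0 < d" "\<forall>\<eta> x y. 0 < \<eta> \<longrightarrow> x \<in> S \<longrightarrow> y \<in> ball (shrink \<eta> x) (\<eta> * r / 2) \<longrightarrow> dist y x < \<eta> * d"
    using shrink_close by (elim exE conjE)
  have "uniformly_continuous_on S g" using g S by (rule compact_uniformly_continuous)
  then obtain e where e: "e > 0" "\<forall>x\<in>S. \<forall>y\<in>S. dist y x < e \<longrightarrow> dist (g y) (g x) < \<delta>"
    unfolding uniformly_continuous_on_def using \<delta> by (elim allE[of _ \<delta>] impE exE conjE) auto
  have "\<bar>conv f (k 0 0) (shrink \<eta> x) - g x\<bar> \<le> \<delta>"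
    if h: "0 < \<eta>" "\<eta> \<le> e / d" "\<eta> \<le> 1" "mollifier (\<eta> * r / 2) k" and x: "x \<in> S" for \<eta> k x
  proof (rule conv_close[OF h(4) f])
    show "AE y in lborel. y \<in> ball (shrink \<eta> x) (\<eta> * r / 2) \<longrightarrow> \<bar>f y - g x\<bar> \<le> \<delta>"
      using ae
    proof (rule AE_mp, intro AE_I2 impI)
      fix y assume y: "y \<in> interior S \<longrightarrow> g y = f y" "y \<in> ball (shrink \<eta> x) (\<eta> * r / 2)"
      have yS: "y \<in> interior S" using shrink_cball[OF h(1,3) x] y(2) by auto
      have "dist y x < \<eta> * d" using d(2) h(1) x y(2) by blast
      also have "\<dots> \<le> e" using h(2) d(1) by (simp add: pos_le_divide_eq)
      finally have "dist (g y) (g x) < \<delta>" using e(2) x yS interior_subset[of S] by blast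
      then show "\<bar>f y - g x\<bar> \<le> \<delta>" using y(1) yS by (simp add: dist_real_def)
    qed
  qed
  then show ?thesis using d(1) e(1) by (intro exI[of _ "e / d"]) simp
qed

text \<open>\<open>V\<close> is replaced by a continuous function on the interior: the error of this
  replacement survives mollification by \<open>conv_L2_le\<close>, and the continuous part converges
  uniformly by \<open>sup_approx\<close>. The factor \<open>1 - \<eta>\<close> is the one the chain
  rule produces for a first derivative.\<close>

lemma L2_approx:
  assumes V[measurable]: "V \<in> borel_measurable borel" and V2: "integrable lborel (\<lambda>x. (V x)\<^sup>2)"
    and supp: "\<And>x. x \<notin> interior S \<Longrightarrow> V x = 0" and \<delta>: "\<delta> > 0"
  shows "\<exists>\<eta>0>0. \<forall>\<eta> k. 0 < \<eta> \<longrightarrow> \<eta> \<le> \<eta>0 \<longrightarrow> \<eta> \<le> 1/2 \<longrightarrow> mollifier (\<eta> * r / 2) k \<longrightarrow>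
     (\<integral>\<^sup>+x. ennreal (((1 - \<eta>) * conv V (k 0 0) (shrink \<eta> x) - V x)\<^sup>2) * indicator (interior S) x \<partial>lborel) \<le> ennreal \<delta>"
proof -
  let ?D = "interior S"
  have Db: "?D \<in> sets borel" "bounded ?D" using compact_imp_bounded[OF S] bounded_interior by auto
  note [measurable] = Db(1)
  \<comment> \<open>Three squared errors, each weighted by 3, will add up to
    \<open>9 * \<delta>0\<close>.\<close>
  define \<delta>0 where "\<delta>0 = \<delta> / 12"
  have \<delta>0: "\<delta>0 > 0" using \<delta> by (simp add: \<delta>0_def)
  have "\<exists>\<psi> M. continuous_on UNIV \<psi> \<and> (\<forall>x. \<bar>\<psi> x\<bar> \<le> M) \<and>
     integrable lborel (\<lambda>x. (V x - \<psi> x * indicator ?D x)\<^sup>2) \<and> (\<integral>x. (V x - \<psi> x * indicator ?D x)\<^sup>2 \<partial>lborel) \<le> \<delta>0"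
    by (rule continuous_dense_in_L2[OF V Db _ V2 \<delta>0]) (rule supp)
  then obtain \<psi> M where \<psi>: "continuous_on UNIV \<psi>" and M: "\<forall>x. \<bar>\<psi> x\<bar> \<le> M"
    and d2: "integrable lborel (\<lambda>x. (V x - \<psi> x * indicator ?D x)\<^sup>2)"
    and dle: "(\<integral>x. (V x - \<psi> x * indicator ?D x)\<^sup>2 \<partial>lborel) \<le> \<delta>0" by (elim exE conjE)
  note [measurable] = borel_measurable_continuous_onI[OF \<psi>]
  define F where "F x = \<psi> x * indicator ?D x" for x
  have [measurable]: "F \<in> borel_measurable borel" unfolding F_def by measurable
  have F2: "integrable lborel (\<lambda>x. (F x)\<^sup>2)"
  proof (rule Bochner_Integration.integrable_bound)
    show "integrable lborel (\<lambda>x. M\<^sup>2 * indicator ?D x :: real)"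
      using emeasure_bounded_finite[OF Db(2)] by (intro integrable_mult_right integrable_real_indicator) auto
    show "AE x in lborel. norm ((F x)\<^sup>2) \<le> norm (M\<^sup>2 * indicator ?D x)"
    proof (rule AE_I2)
      fix x
      have "\<bar>\<psi> x\<bar> \<le> \<bar>M\<bar>" using spec[OF M, of x] by linarith
      then show "norm ((F x)\<^sup>2) \<le> norm (M\<^sup>2 * indicator ?D x)"
        by (cases "x \<in> ?D") (simp_all add: F_def abs_le_square_iff)
    qed
  qed measurable
  have Fi: "integrable lborel F"
    by (rule square_integrable_imp_integrable[OF _ F2 _ Db]) (auto simp: F_def)
  have Vi: "integrable lborel V" by (rule square_integrable_imp_integrable[OF V V2 _ Db]) (rule supp)
  have Wi: "integrable lborel (\<lambda>x. V x - F x)" using Vi Fi by simp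
  have W2: "integrable lborel (\<lambda>x. (V x - F x)\<^sup>2)" using d2 by (simp add: F_def)
  have Wle: "(\<integral>\<^sup>+x. ennreal ((V x - F x)\<^sup>2) \<partial>lborel) \<le> ennreal \<delta>0"
    using nn_integral_eq_integral[OF W2] dle by (simp add: F_def ennreal_leI)
  define A where "A = measure lborel ?D"
  have A: "emeasure lborel ?D = ennreal A" "A \<ge> 0"
    using emeasure_bounded_finite[OF Db(2)] by (auto simp: A_def emeasure_eq_ennreal_measure)
  \<comment> \<open>A uniform error \<beta> contributes at most \<open>\<delta>0\<close> after
    squaring and integrating; the added 1 avoids division by zero.\<close>
  define \<beta> where "\<beta> = sqrt (\<delta>0 / (A + 1))"
  have \<beta>: "\<beta> > 0" "\<beta>\<^sup>2 * A \<le> \<delta>0"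
    using \<delta>0 A by (auto simp: \<beta>_def real_sqrt_pow2 divide_le_eq algebra_simps)
  have M0: "M \<ge> 0" using spec[OF M, of 0] by linarith
  have "\<exists>\<eta>0>0. \<forall>\<eta> k. 0 < \<eta> \<longrightarrow> \<eta> \<le> \<eta>0 \<longrightarrow> \<eta> \<le> 1 \<longrightarrow> mollifier (\<eta> * r / 2) k \<longrightarrow>
     (\<forall>x\<in>S. \<bar>conv F (k 0 0) (shrink \<eta> x) - \<psi> x\<bar> \<le> \<beta> / 2)"
    by (rule sup_approx[OF continuous_on_subset[OF \<psi>] Fi]) (use \<beta> in \<open>auto simp: F_def\<close>)
  then obtain \<eta>1 where \<eta>1: "\<eta>1 > 0" "\<forall>\<eta> k. 0 < \<eta> \<longrightarrow> \<eta> \<le> \<eta>1 \<longrightarrow> \<eta> \<le> 1 \<longrightarrow> mollifier (\<eta> * r / 2) k \<longrightarrow>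
     (\<forall>x\<in>S. \<bar>conv F (k 0 0) (shrink \<eta> x) - \<psi> x\<bar> \<le> \<beta> / 2)" by (elim exE conjE)
  \<comment> \<open>The second bound keeps the error caused by the factor \<open>1 - \<eta>\<close>,
    which is \<eta> times the size of \<open>\<psi>\<close>, below half of \<beta>.\<close>
  define \<eta>0 where "\<eta>0 = min \<eta>1 (\<beta> / (2 * (M + 1)))"
  have \<eta>0: "\<eta>0 > 0" using \<eta>1(1) \<beta>(1) M0 by (simp add: \<eta>0_def)
  have main: "(\<integral>\<^sup>+x. ennreal (((1 - \<eta>) * conv V (k 0 0) (shrink \<eta> x) - V x)\<^sup>2) * indicator ?D x \<partial>lborel) \<le> ennreal \<delta>"
    if h: "0 < \<eta>" "\<eta> \<le> \<eta>0" "\<eta> \<le> 1/2" and m: "mollifier (\<eta> * r / 2) k" for \<eta> k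
  proof -
    define t where "t = 1 - \<eta>"
    have t: "0 < t" "t \<le> 1" using h by (auto simp: t_def)
    define E where "E x = conv (\<lambda>x. V x - F x) (k 0 0) (shrink \<eta> x)" for x
    have [measurable]: "E \<in> borel_measurable borel"
      unfolding E_def using jet_measurable[OF conv_jet[OF m Wi], of 0 0] unfolding shrink_def by measurable
    have lin: "conv V (k 0 0) w = conv (\<lambda>x. V x - F x) (k 0 0) w + conv F (k 0 0) w" for w
      unfolding conv_def using conv_integrable[OF m Wi, of 0 0 w] conv_integrable[OF m Fi, of 0 0 w]
      by (subst Bochner_Integration.integral_add[symmetric]) (auto simp: algebra_simps)
    have b: "\<bar>t * conv F (k 0 0) (shrink \<eta> x) - \<psi> x\<bar> \<le> \<beta>" if "x \<in> S" for x
    proof -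
      let ?C = "conv F (k 0 0) (shrink \<eta> x)"
      have "\<eta> \<le> \<eta>1" "\<eta> \<le> 1" using h by (auto simp: \<eta>0_def)
      then have c: "\<bar>?C - \<psi> x\<bar> \<le> \<beta> / 2" using \<eta>1(2) h(1) m that by blast
      have "t * ?C - \<psi> x = t * (?C - \<psi> x) - \<eta> * \<psi> x" by (simp add: t_def algebra_simps)
      also have "\<bar>\<dots>\<bar> \<le> t * \<bar>?C - \<psi> x\<bar> + \<eta> * \<bar>\<psi> x\<bar>"
        using t h abs_triangle_ineq4[of "t * (?C - \<psi> x)" "\<eta> * \<psi> x"] by (simp add: abs_mult)
      also have "\<dots> \<le> 1 * (\<beta> / 2) + (\<beta> / (2 * (M + 1))) * (M + 1)"
        using t c h order_trans[OF spec[OF M, of x], of "M + 1"] M0 \<beta>(1) by (intro add_mono mult_mono) (auto simp: \<eta>0_def)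
      also have "\<dots> = \<beta>"
      proof -
        have half: "\<beta> / (2 * L) * L = \<beta> / 2" if "L \<noteq> 0" for L using that by simp
        have "M + 1 \<noteq> 0" using M0 by linarith
        then show ?thesis unfolding half[OF \<open>M + 1 \<noteq> 0\<close>] by simp
      qed
      finally show ?thesis .
    qed
    have pt: "ennreal ((t * conv V (k 0 0) (shrink \<eta> x) - V x)\<^sup>2) * indicator ?D x
       \<le> 3 * (ennreal (t\<^sup>2) * ennreal ((E x)\<^sup>2)) + (3 * ennreal (\<beta>\<^sup>2) * indicator ?D x + 3 * ennreal ((V x - F x)\<^sup>2))" for x
    proof (cases "x \<in> ?D")
      case True
      then have xS: "x \<in> S" using interior_subset by blast
      have Fx: "F x = \<psi> x" using True by (simp add: F_def)
      define B where "B = t * conv F (k 0 0) (shrink \<eta> x) - \<psi> x"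
      have B: "B\<^sup>2 \<le> \<beta>\<^sup>2" using b[OF xS] \<beta>(1) by (simp add: B_def abs_le_square_iff[symmetric])
      have "t * conv V (k 0 0) (shrink \<eta> x) - V x = t * E x + B + (F x - V x)"
        unfolding lin E_def[symmetric] B_def Fx by (simp add: algebra_simps)
      then have "(t * conv V (k 0 0) (shrink \<eta> x) - V x)\<^sup>2 \<le> 3 * (t * E x)\<^sup>2 + 3 * B\<^sup>2 + 3 * (F x - V x)\<^sup>2"
        by (simp only: three_square_sum)
      also have "\<dots> \<le> 3 * (t\<^sup>2 * (E x)\<^sup>2) + (3 * \<beta>\<^sup>2 + 3 * (V x - F x)\<^sup>2)"
        using B by (simp add: power_mult_distrib power2_commute)
      finally have "ennreal ((t * conv V (k 0 0) (shrink \<eta> x) - V x)\<^sup>2) \<le> ennreal (3 * (t\<^sup>2 * (E x)\<^sup>2) + (3 * \<beta>\<^sup>2 + 3 * (V x - F x)\<^sup>2))"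
        by (rule ennreal_leI)
      also have "\<dots> = 3 * (ennreal (t\<^sup>2) * ennreal ((E x)\<^sup>2)) + (3 * ennreal (\<beta>\<^sup>2) + 3 * ennreal ((V x - F x)\<^sup>2))"
        by (simp add: ennreal_mult[symmetric] ennreal_plus[symmetric] ennreal_numeral[symmetric] del: ennreal_plus ennreal_numeral)
      finally show ?thesis using True by simp
    qed simp
    have "(\<integral>\<^sup>+x. ennreal ((t * conv V (k 0 0) (shrink \<eta> x) - V x)\<^sup>2) * indicator ?D x \<partial>lborel)
        \<le> (\<integral>\<^sup>+x. 3 * (ennreal (t\<^sup>2) * ennreal ((E x)\<^sup>2)) + (3 * ennreal (\<beta>\<^sup>2) * indicator ?D x + 3 * ennreal ((V x - F x)\<^sup>2)) \<partial>lborel)"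
      by (rule nn_integral_mono) (rule pt)
    also have "\<dots> = 3 * (ennreal (t\<^sup>2) * (\<integral>\<^sup>+x. ennreal ((E x)\<^sup>2) \<partial>lborel))
        + (3 * ennreal (\<beta>\<^sup>2) * emeasure lborel ?D + 3 * (\<integral>\<^sup>+x. ennreal ((V x - F x)\<^sup>2) \<partial>lborel))"
      by (simp add: nn_integral_add nn_integral_cmult nn_integral_cmult_indicator)
    also have "\<dots> \<le> 3 * ennreal \<delta>0 + (3 * ennreal \<delta>0 + 3 * ennreal \<delta>0)"
    proof (intro add_mono)
      have "ennreal (t\<^sup>2) * (\<integral>\<^sup>+x. ennreal ((E x)\<^sup>2) \<partial>lborel) \<le> (\<integral>\<^sup>+x. ennreal ((V x - F x)\<^sup>2) \<partial>lborel)"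
        using conv_L2_le[OF m Wi W2, of t "c - t *\<^sub>R c"] t unfolding E_def shrink_affine t_def[symmetric] by simp
      also note Wle
      finally show "3 * (ennreal (t\<^sup>2) * (\<integral>\<^sup>+x. ennreal ((E x)\<^sup>2) \<partial>lborel)) \<le> 3 * ennreal \<delta>0"
        by (intro mult_left_mono) auto
      have "ennreal (\<beta>\<^sup>2) * emeasure lborel ?D \<le> ennreal \<delta>0"
        unfolding A using \<beta>(2) A(2) by (subst ennreal_mult[symmetric]) (auto intro: ennreal_leI)
      then show "3 * ennreal (\<beta>\<^sup>2) * emeasure lborel ?D \<le> 3 * ennreal \<delta>0"
        unfolding mult.assoc by (intro mult_left_mono) auto
      show "3 * (\<integral>\<^sup>+x. ennreal ((V x - F x)\<^sup>2) \<partial>lborel) \<le> 3 * ennreal \<delta>0"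
        using Wle by (intro mult_left_mono) auto
    qed
    also have "\<dots> = ennreal (9 * \<delta>0)"
      using \<delta>0 by (simp add: ennreal_mult[symmetric] ennreal_plus[symmetric] ennreal_numeral[symmetric] del: ennreal_plus ennreal_numeral)
    also have "\<dots> \<le> ennreal \<delta>" using \<delta> by (intro ennreal_leI) (simp add: \<delta>0_def)
    finally show ?thesis unfolding t_def .
  qed
  then show ?thesis using \<eta>0 by (intro exI[of _ \<eta>0] conjI allI impI)
qed

text \<open>One function has to meet the uniform, the seminorm and the gradient requirements
  together. The seminorm bound has constant 1 and covers all of \<open>S\<close>, so estimates for
  jets apply to \<open>U\<close> with the seminorm of \<open>g\<close> on the right.
  \<open>v1\<close> and \<open>v2\<close> may be any representatives of the weak
  derivatives.\<close>

theorem smooth_approximation: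
  assumes g: "continuous_on S g" and v1: "has_weak_deriv (interior S) (1, 0) g v1"
    and v2: "has_weak_deriv (interior S) (0, 1) g v2" and \<delta>: "\<delta> > 0"
  shows "\<exists>U. jet U \<and> (\<forall>x\<in>S. \<bar>U 0 0 x - g x\<bar> \<le> \<delta>) \<and>
    (\<forall>i j v. 1 \<le> i + j \<longrightarrow> has_weak_deriv (interior S) (i, j) g v \<longrightarrow>
       sq_integral S (U i j) \<le> ennreal ((L2_norm (interior S) v)\<^sup>2)) \<and>
    (\<integral>\<^sup>+x. ennreal ((U 1 0 x - v1 x)\<^sup>2) * indicator (interior S) x \<partial>lebesgue) \<le> ennreal \<delta> \<and>
    (\<integral>\<^sup>+x. ennreal ((U 0 1 x - v2 x)\<^sup>2) * indicator (interior S) x \<partial>lebesgue) \<le> ennreal \<delta>"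
proof -
  let ?D = "interior S"
  have Db: "?D \<in> sets borel" "bounded ?D" using compact_imp_bounded[OF S] bounded_interior by auto
  note [measurable] = Db(1)
  have L2: "g \<in> L2 ?D" "v1 \<in> L2 ?D" "v2 \<in> L2 ?D" using v1 v2 by (auto simp: has_weak_deriv_def)
  obtain f where f[measurable]: "f \<in> borel_measurable borel" and f0: "\<forall>x. x \<notin> ?D \<longrightarrow> f x = 0"
    and fae: "AE x in lebesgue. x \<in> ?D \<longrightarrow> g x = f x" and f2: "integrable lborel (\<lambda>x. (f x)\<^sup>2)"
    and fi: "\<forall>\<phi>. \<phi> \<in> borel_measurable borel \<longrightarrow> (LINT x|lebesgue_on ?D. g x * \<phi> x) = (\<integral>x. f x * \<phi> x \<partial>lborel)"
    using L2_borel_representative[OF L2(1) Db(1)] by (elim exE conjE)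
  have fint: "integrable lborel f" by (rule square_integrable_imp_integrable[OF f f2 _ Db]) (use f0 in auto)
  have fae': "AE y in lborel. y \<in> ?D \<longrightarrow> g y = f y" using fae by (simp add: AE_completion_iff)
  \<comment> \<open>As long as the ball of the kernel stays in the interior, differentiating the
    convolution amounts to mollifying the weak derivative.\<close>
  have rep: "\<exists>V. V \<in> borel_measurable borel \<and> (\<forall>x. x \<notin> ?D \<longrightarrow> V x = 0) \<and> (AE x in lebesgue. x \<in> ?D \<longrightarrow> v x = V x) \<and>
      integrable lborel (\<lambda>x. (V x)\<^sup>2) \<and> integrable lborel V \<and> (\<integral>\<^sup>+x. ennreal ((V x)\<^sup>2) \<partial>lborel) = ennreal ((L2_norm ?D v)\<^sup>2) \<and>
      (\<forall>\<epsilon> k w. mollifier \<epsilon> k \<longrightarrow> cball w \<epsilon> \<subseteq> ?D \<longrightarrow> conv f (k i j) w = conv V (k 0 0) w)"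
    if v: "has_weak_deriv ?D (i, j) g v" for i j v
  proof -
    have "v \<in> L2 ?D" using v by (simp add: has_weak_deriv_def)
    from L2_borel_representative[OF this Db(1)] obtain V where V: "V \<in> borel_measurable borel" "\<forall>x. x \<notin> ?D \<longrightarrow> V x = 0"
      "AE x in lebesgue. x \<in> ?D \<longrightarrow> v x = V x" "integrable lborel (\<lambda>x. (V x)\<^sup>2)"
      "(\<integral>\<^sup>+x. ennreal ((V x)\<^sup>2) \<partial>lborel) = ennreal ((L2_norm ?D v)\<^sup>2)"
      and Vi: "\<forall>\<phi>. \<phi> \<in> borel_measurable borel \<longrightarrow> (LINT x|lebesgue_on ?D. v x * \<phi> x) = (\<integral>x. V x * \<phi> x \<partial>lborel)"
      by (elim exE conjE)
    have "integrable lborel V" by (rule square_integrable_imp_integrable[OF V(1,4) _ Db]) (use V(2) in auto)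
    moreover have "conv f (k i j) w = conv V (k 0 0) w" if m: "mollifier \<epsilon> k" and w: "cball w \<epsilon> \<subseteq> ?D" for \<epsilon> k w
    proof -
      note [measurable] = jet_measurable[OF mollifierD(1)[OF m]]
      have km: "(\<lambda>y. k a b (w - y)) \<in> borel_measurable borel" for a b by measurable
      have "conv f (k i j) w = (LINT y|lebesgue_on ?D. g y * k i j (w - y))"
        unfolding conv_def using fi km by simp
      also have "\<dots> = (LINT y|lebesgue_on ?D. v y * k 0 0 (w - y))"
        by (rule weak_deriv_mollifier[OF m w v])
      also have "\<dots> = conv V (k 0 0) w" unfolding conv_def using Vi km by simp
      finally show ?thesis .
    qed
    ultimately show ?thesis using V by (intro exI[of _ V] conjI) auto
  qed
  obtain V1 where V1: "V1 \<in> borel_measurable borel" "\<forall>x. x \<notin> ?D \<longrightarrow> V1 x = 0" "AE x in lebesgue. x \<in> ?D \<longrightarrow> v1 x = V1 x"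
    "integrable lborel (\<lambda>x. (V1 x)\<^sup>2)"
    "\<forall>\<epsilon> k w. mollifier \<epsilon> k \<longrightarrow> cball w \<epsilon> \<subseteq> ?D \<longrightarrow> conv f (k 1 0) w = conv V1 (k 0 0) w"
    using rep[OF v1] by (elim exE conjE)
  obtain V2 where V2: "V2 \<in> borel_measurable borel" "\<forall>x. x \<notin> ?D \<longrightarrow> V2 x = 0" "AE x in lebesgue. x \<in> ?D \<longrightarrow> v2 x = V2 x"
    "integrable lborel (\<lambda>x. (V2 x)\<^sup>2)"
    "\<forall>\<epsilon> k w. mollifier \<epsilon> k \<longrightarrow> cball w \<epsilon> \<subseteq> ?D \<longrightarrow> conv f (k 0 1) w = conv V2 (k 0 0) w"
    using rep[OF v2] by (elim exE conjE)
  obtain e0 where e0: "e0 > 0" "\<forall>\<eta> k. 0 < \<eta> \<longrightarrow> \<eta> \<le> e0 \<longrightarrow> \<eta> \<le> 1 \<longrightarrow> mollifier (\<eta> * r / 2) k \<longrightarrow>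
     (\<forall>x\<in>S. \<bar>conv f (k 0 0) (shrink \<eta> x) - g x\<bar> \<le> \<delta>)"
    using sup_approx[OF g fint fae' \<delta>] by (elim exE conjE)
  have ex: "\<exists>\<eta>0>0. \<forall>\<eta> k. 0 < \<eta> \<longrightarrow> \<eta> \<le> \<eta>0 \<longrightarrow> \<eta> \<le> 1/2 \<longrightarrow> mollifier (\<eta> * r / 2) k \<longrightarrow>
     (\<integral>\<^sup>+x. ennreal (((1 - \<eta>) * conv V (k 0 0) (shrink \<eta> x) - V x)\<^sup>2) * indicator ?D x \<partial>lborel) \<le> ennreal \<delta>"
    if "V \<in> borel_measurable borel" "integrable lborel (\<lambda>x. (V x)\<^sup>2)" "\<forall>x. x \<notin> ?D \<longrightarrow> V x = 0" for V
    by (rule L2_approx[OF that(1,2) _ \<delta>]) (use that(3) in simp)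
  obtain e1 where e1: "e1 > 0" "\<forall>\<eta> k. 0 < \<eta> \<longrightarrow> \<eta> \<le> e1 \<longrightarrow> \<eta> \<le> 1/2 \<longrightarrow> mollifier (\<eta> * r / 2) k \<longrightarrow>
     (\<integral>\<^sup>+x. ennreal (((1 - \<eta>) * conv V1 (k 0 0) (shrink \<eta> x) - V1 x)\<^sup>2) * indicator ?D x \<partial>lborel) \<le> ennreal \<delta>"
    using ex[OF V1(1,4,2)] by (elim exE conjE)
  obtain e2 where e2: "e2 > 0" "\<forall>\<eta> k. 0 < \<eta> \<longrightarrow> \<eta> \<le> e2 \<longrightarrow> \<eta> \<le> 1/2 \<longrightarrow> mollifier (\<eta> * r / 2) k \<longrightarrow>
     (\<integral>\<^sup>+x. ennreal (((1 - \<eta>) * conv V2 (k 0 0) (shrink \<eta> x) - V2 x)\<^sup>2) * indicator ?D x \<partial>lborel) \<le> ennreal \<delta>"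
    using ex[OF V2(1,4,2)] by (elim exE conjE)
  define \<eta> where "\<eta> = min (1/2) (min e0 (min e1 e2))"
  have \<eta>: "0 < \<eta>" "\<eta> \<le> e0" "\<eta> \<le> e1" "\<eta> \<le> e2" "\<eta> \<le> 1/2" "\<eta> \<le> 1" using e0 e1 e2 by (auto simp: \<eta>_def)
  obtain k where m: "mollifier (\<eta> * r / 2) k" using mollifier_exists[of "\<eta> * r / 2"] \<eta>(1) r by auto
  define t where "t = 1 - \<eta>"
  have t: "0 < t" "t \<le> 1" using \<eta> by (auto simp: t_def)
  define U where "U i j x = t ^ (i + j) * conv f (k i j) ((c - t *\<^sub>R c) + t *\<^sub>R x)" for i j x
  have U_shrink: "U i j x = t ^ (i + j) * conv f (k i j) (shrink \<eta> x)" for i j x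
    by (simp add: U_def shrink_affine t_def)
  have U: "jet U" unfolding U_def by (rule jet_affine[OF conv_jet[OF m fint]])
  have sub: "cball (shrink \<eta> x) (\<eta> * r / 2) \<subseteq> ?D" if "x \<in> S" for x
    by (rule shrink_cball[OF \<eta>(1,6) that])
  have sup: "\<bar>U 0 0 x - g x\<bar> \<le> \<delta>" if "x \<in> S" for x
    using e0(2) \<eta> m that by (simp add: U_shrink)
  have semi: "sq_integral S (U i j) \<le> ennreal ((L2_norm ?D v)\<^sup>2)"
    if ij: "1 \<le> i + j" and v: "has_weak_deriv ?D (i, j) g v" for i j v
  proof -
    obtain V where V: "integrable lborel V" "integrable lborel (\<lambda>x. (V x)\<^sup>2)"
      "(\<integral>\<^sup>+x. ennreal ((V x)\<^sup>2) \<partial>lborel) = ennreal ((L2_norm ?D v)\<^sup>2)"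
      "\<forall>\<epsilon> k w. mollifier \<epsilon> k \<longrightarrow> cball w \<epsilon> \<subseteq> ?D \<longrightarrow> conv f (k i j) w = conv V (k 0 0) w"
      using rep[OF v] by (elim exE conjE)
    note [measurable] = jet_measurable[OF conv_jet[OF m V(1)], of 0 0]
    have "sq_integral S (U i j) \<le> (\<integral>\<^sup>+x. ennreal (t\<^sup>2) * ennreal ((conv V (k 0 0) ((c - t *\<^sub>R c) + t *\<^sub>R x))\<^sup>2) \<partial>lborel)"
      unfolding sq_integral_def
    proof (rule nn_integral_mono)
      fix x
      show "ennreal ((U i j x)\<^sup>2) * indicator S x \<le> ennreal (t\<^sup>2) * ennreal ((conv V (k 0 0) ((c - t *\<^sub>R c) + t *\<^sub>R x))\<^sup>2)"
      proof (cases "x \<in> S")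
        case True
        have eq: "conv f (k i j) (shrink \<eta> x) = conv V (k 0 0) (shrink \<eta> x)" using V(4) m sub[OF True] by blast
        \<comment> \<open>For order at least 1 the squared chain-rule factor is at most
          \<open>t\<^sup>2\<close>, the Jacobian on the left of \<open>conv_L2_le\<close>; this is
          why the constant is exactly 1.\<close>
        have "t ^ (i + j) \<le> t ^ 1" using t ij by (intro power_decreasing) auto
        then have "(t ^ (i + j))\<^sup>2 \<le> t\<^sup>2" using t by (intro power_mono) auto
        then have "(U i j x)\<^sup>2 \<le> t\<^sup>2 * (conv V (k 0 0) (shrink \<eta> x))\<^sup>2"
          unfolding U_shrink eq power_mult_distrib by (intro mult_right_mono) auto
        then have "ennreal ((U i j x)\<^sup>2) \<le> ennreal (t\<^sup>2) * ennreal ((conv V (k 0 0) (shrink \<eta> x))\<^sup>2)"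
          by (subst ennreal_mult[symmetric]) (auto intro: ennreal_leI)
        then show ?thesis using True by (simp add: shrink_affine t_def)
      qed simp
    qed
    also have "\<dots> = ennreal (t\<^sup>2) * (\<integral>\<^sup>+x. ennreal ((conv V (k 0 0) ((c - t *\<^sub>R c) + t *\<^sub>R x))\<^sup>2) \<partial>lborel)"
      by (rule nn_integral_cmult) measurable
    also have "\<dots> \<le> ennreal ((L2_norm ?D v)\<^sup>2)"
      using conv_L2_le[OF m V(1,2), of t "c - t *\<^sub>R c"] t unfolding V(3) by simp
    finally show ?thesis .
  qed
  have grad: "(\<integral>\<^sup>+x. ennreal ((U i j x - v x)\<^sup>2) * indicator ?D x \<partial>lebesgue) \<le> ennreal \<delta>"
    if Vm: "V \<in> borel_measurable borel" and ae: "AE x in lebesgue. x \<in> ?D \<longrightarrow> v x = V x" and ij: "i + j = 1"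
      and eq: "\<forall>\<epsilon> k w. mollifier \<epsilon> k \<longrightarrow> cball w \<epsilon> \<subseteq> ?D \<longrightarrow> conv f (k i j) w = conv V (k 0 0) w"
      and le: "(\<integral>\<^sup>+x. ennreal (((1 - \<eta>) * conv V (k 0 0) (shrink \<eta> x) - V x)\<^sup>2) * indicator ?D x \<partial>lborel) \<le> ennreal \<delta>" for V v i j
  proof -
    note [measurable] = Vm jet_measurable[OF U]
    have "(\<integral>\<^sup>+x. ennreal ((U i j x - v x)\<^sup>2) * indicator ?D x \<partial>lebesgue)
        = (\<integral>\<^sup>+x. ennreal ((U i j x - V x)\<^sup>2) * indicator ?D x \<partial>lebesgue)"
    proof (rule nn_integral_cong_AE)
      show "AE x in lebesgue. ennreal ((U i j x - v x)\<^sup>2) * indicator ?D x = ennreal ((U i j x - V x)\<^sup>2) * indicator ?D x"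
        using ae by eventually_elim (auto split: split_indicator)
    qed
    also have "\<dots> = (\<integral>\<^sup>+x. ennreal ((U i j x - V x)\<^sup>2) * indicator ?D x \<partial>lborel)"
      by (rule nn_integral_completion)
    also have "\<dots> = (\<integral>\<^sup>+x. ennreal (((1 - \<eta>) * conv V (k 0 0) (shrink \<eta> x) - V x)\<^sup>2) * indicator ?D x \<partial>lborel)"
    proof (rule nn_integral_cong)
      fix x
      show "ennreal ((U i j x - V x)\<^sup>2) * indicator ?D x = ennreal (((1 - \<eta>) * conv V (k 0 0) (shrink \<eta> x) - V x)\<^sup>2) * indicator ?D x"
      proof (cases "x \<in> ?D")
        case True
        then have "x \<in> S" using interior_subset by blast
        then have "conv f (k i j) (shrink \<eta> x) = conv V (k 0 0) (shrink \<eta> x)" using eq m sub by blast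
        then show ?thesis by (simp add: U_shrink ij t_def)
      qed simp
    qed
    also note le
    finally show ?thesis .
  qed
  have g1: "(\<integral>\<^sup>+x. ennreal ((U 1 0 x - v1 x)\<^sup>2) * indicator ?D x \<partial>lebesgue) \<le> ennreal \<delta>"
    by (rule grad[OF V1(1,3) _ V1(5)]) (use e1(2) \<eta> m in simp_all)
  have g2: "(\<integral>\<^sup>+x. ennreal ((U 0 1 x - v2 x)\<^sup>2) * indicator ?D x \<partial>lebesgue) \<le> ennreal \<delta>"
    by (rule grad[OF V2(1,3) _ V2(5)]) (use e2(2) \<eta> m in simp_all)
  show ?thesis using U sup semi g1 g2 by (intro exI[of _ U] conjI ballI allI impI)
qed

end

subsection \<open>The Bramble--Hilbert estimate on a patch\<close>

lemma emeasure_cball_2: "0 \<le> \<rho> \<Longrightarrow> emeasure lborel (cball (z::real^2) \<rho>) = ennreal (pi * \<rho>\<^sup>2)"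
  by (simp add: emeasure_cball unit_ball_vol_2)

lemma weak_deriv_works:
  assumes "g \<in> sobolev n S" "i + j \<le> n"
  shows "has_weak_deriv (interior S) (i, j) g (weak_deriv (interior S) (i, j) g)"
proof -
  have "\<exists>v. has_weak_deriv (interior S) (i, j) g v" using assms by (auto simp: sobolev_def)
  then show ?thesis unfolding weak_deriv_def by (rule someI_ex)
qed

lemma sobolev_seminorm_square:
  "(sobolev_seminorm n S g)\<^sup>2 = (\<Sum>a\<le>n. (L2_norm (interior S) (weak_deriv (interior S) (a, n - a) g))\<^sup>2)"
proof -
  have eq: "{\<alpha>. fst \<alpha> + snd \<alpha> = n} = (\<lambda>a. (a, n - a)) ` {..n}" by (auto simp: image_iff)
  have "(sobolev_seminorm n S g)\<^sup>2 = (\<Sum>\<alpha>\<in>{\<alpha>. fst \<alpha> + snd \<alpha> = n}. (L2_norm (interior S) (weak_deriv (interior S) \<alpha> g))\<^sup>2)"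
    unfolding sobolev_seminorm_def by (rule real_sqrt_pow2) (simp add: sum_nonneg)
  also have "\<dots> = (\<Sum>a\<le>n. (L2_norm (interior S) (weak_deriv (interior S) (a, n - a) g))\<^sup>2)"
    unfolding eq by (subst sum.reindex) (auto simp: inj_on_def)
  finally show ?thesis .
qed

lemma sobolev_seminorm_nonneg: "0 \<le> sobolev_seminorm n S g"
  by (simp add: sobolev_seminorm_def sum_nonneg)

text \<open>\<open>U\<close> and \<open>P\<close> depend on \<delta>, so only estimates uniform in
  it are recorded. Leaving \<open>v1\<close> and \<open>v2\<close> arbitrary lets the caller use a
  gradient of \<open>g\<close> that is derived from the chosen weak gradient of the error.\<close>

lemma (in star_shaped) local_polynomial_approximation:
  fixes m :: nat and \<kappa> \<delta> :: real and g v1 v2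
  defines "H \<equiv> sobolev_seminorm (m + 1) S g" and "d \<equiv> diameter S"
  assumes BS: "cball c r \<subseteq> S"
    and \<kappa>: "\<kappa> \<ge> 0" "emeasure lborel S + emeasure lborel (cball c r) \<le> ennreal \<kappa> * emeasure lborel (cball c r)"
    and m: "m \<ge> 1" and g: "continuous_on S g" "g \<in> sobolev (m + 1) S"
    and v1: "has_weak_deriv (interior S) (1, 0) g v1" and v2: "has_weak_deriv (interior S) (0, 1) g v2" and \<delta>: "\<delta> > 0"
  shows "\<exists>U P. jet U \<and> jet P \<and> P 0 0 \<in> polys m \<and>
    (\<forall>x\<in>S. \<bar>g x - P 0 0 x\<bar> \<le> sqrt (bh_const m \<kappa> / pi) * d ^ (m + 1) / r * H + \<delta>) \<and>
    sq_integral S (\<lambda>x. U 1 0 x - P 1 0 x) + sq_integral S (\<lambda>x. U 0 1 x - P 0 1 x) \<le> ennreal (bh_const m \<kappa> * d ^ (2*m) * H\<^sup>2) \<and>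
    (\<integral>\<^sup>+x. ennreal ((U 1 0 x - v1 x)\<^sup>2) * indicator (interior S) x \<partial>lebesgue) \<le> ennreal \<delta> \<and>
    (\<integral>\<^sup>+x. ennreal ((U 0 1 x - v2 x)\<^sup>2) * indicator (interior S) x \<partial>lebesgue) \<le> ennreal \<delta>"
proof -
  obtain U where U: "jet U" "\<forall>x\<in>S. \<bar>U 0 0 x - g x\<bar> \<le> \<delta>"
    and semi: "\<forall>i j v. 1 \<le> i + j \<longrightarrow> has_weak_deriv (interior S) (i, j) g v \<longrightarrow>
       sq_integral S (U i j) \<le> ennreal ((L2_norm (interior S) v)\<^sup>2)"
    and grad: "(\<integral>\<^sup>+x. ennreal ((U 1 0 x - v1 x)\<^sup>2) * indicator (interior S) x \<partial>lebesgue) \<le> ennreal \<delta>"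
      "(\<integral>\<^sup>+x. ennreal ((U 0 1 x - v2 x)\<^sup>2) * indicator (interior S) x \<partial>lebesgue) \<le> ennreal \<delta>"
    using smooth_approximation[OF g(1) v1 v2 \<delta>] by (elim exE conjE)
  define T where "T = (\<Sum>a\<le>m+1. sq_integral S (U a (m + 1 - a)))"
  have T: "T \<le> ennreal (H\<^sup>2)"
  proof -
    have "T \<le> (\<Sum>a\<le>m+1. ennreal ((L2_norm (interior S) (weak_deriv (interior S) (a, m + 1 - a) g))\<^sup>2))"
      unfolding T_def
    proof (rule sum_mono)
      fix a assume "a \<in> {..m+1}"
      then have "1 \<le> a + (m + 1 - a)" "a + (m + 1 - a) \<le> m + 1" by auto
      then show "sq_integral S (U a (m + 1 - a)) \<le> ennreal ((L2_norm (interior S) (weak_deriv (interior S) (a, m + 1 - a) g))\<^sup>2)"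
        using semi weak_deriv_works[OF g(2)] by blast
    qed
    also have "\<dots> = ennreal (H\<^sup>2)"
      unfolding H_def sobolev_seminorm_square by (rule sum_ennreal) simp
    finally show ?thesis .
  qed
  have eB: "emeasure lborel (cball c r) = ennreal (pi * r\<^sup>2)" using r by (simp add: emeasure_cball_2)
  have pos: "emeasure lborel (cball c r) \<noteq> 0" unfolding eB using r by simp
  have dist: "dist x y \<le> d" if "x \<in> S" "y \<in> cball c r" for x y
    unfolding d_def using that BS by (intro diameter_bounded_bound[OF compact_imp_bounded[OF S]]) auto
  have Sb: "S \<in> sets borel" using S by (rule borel_compact)
  have "\<exists>P. jet P \<and> P 0 0 \<in> polys m \<and>
    (\<forall>x\<in>S. emeasure lborel (cball c r) * ennreal ((U 0 0 x - P 0 0 x)\<^sup>2) \<le> ennreal (bh_const m \<kappa> * d ^ (2*m+2)) * T) \<and>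
    sq_integral S (\<lambda>x. U 1 0 x - P 1 0 x) + sq_integral S (\<lambda>x. U 0 1 x - P 0 1 x)
      \<le> ennreal (bh_const m \<kappa> * d ^ (2*m)) * T"
    unfolding T_def
    by (rule bramble_hilbert_jet[OF U(1) Sb compact_cball BS _ _ \<kappa> pos m])
      (rule star_shaped_segment[OF star] dist; assumption)+
  then obtain P where P: "jet P" "P 0 0 \<in> polys m"
    and sup: "\<forall>x\<in>S. emeasure lborel (cball c r) * ennreal ((U 0 0 x - P 0 0 x)\<^sup>2) \<le> ennreal (bh_const m \<kappa> * d ^ (2*m+2)) * T"
    and gr: "sq_integral S (\<lambda>x. U 1 0 x - P 1 0 x) + sq_integral S (\<lambda>x. U 0 1 x - P 0 1 x)
      \<le> ennreal (bh_const m \<kappa> * d ^ (2*m)) * T"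
    by (elim exE conjE)
  let ?b = "bh_const m \<kappa>"
  have b: "?b \<ge> 0" using \<kappa>(1) by (rule bh_const_nonneg)
  have d0: "d \<ge> 0" unfolding d_def using compact_imp_bounded[OF S] by (rule diameter_ge_0)
  have H0: "H \<ge> 0" unfolding H_def by (rule sobolev_seminorm_nonneg)
  have E: "\<bar>g x - P 0 0 x\<bar> \<le> sqrt (?b / pi) * d ^ (m + 1) / r * H + \<delta>" if x: "x \<in> S" for x
  proof -
    have "ennreal (pi * r\<^sup>2 * (U 0 0 x - P 0 0 x)\<^sup>2) \<le> ennreal (?b * d ^ (2*m+2)) * T"
      using bspec[OF sup x] unfolding eB by (simp add: ennreal_mult)
    also have "\<dots> \<le> ennreal (?b * d ^ (2*m+2)) * ennreal (H\<^sup>2)" by (intro mult_left_mono T) simp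
    also have "\<dots> = ennreal (?b * d ^ (2*m+2) * H\<^sup>2)" using b d0 by (simp add: ennreal_mult)
    finally have "pi * r\<^sup>2 * (U 0 0 x - P 0 0 x)\<^sup>2 \<le> ?b * d ^ (2*m+2) * H\<^sup>2"
      using b d0 by (subst (asm) ennreal_le_iff) auto
    \<comment> \<open>Division by the area of the ball is the origin of \<open>pi\<close> and of
      \<open>1 / r\<close> in the bound.\<close>
    then have "(U 0 0 x - P 0 0 x)\<^sup>2 \<le> ?b * d ^ (2*m+2) * H\<^sup>2 / (pi * r\<^sup>2)"
      using r by (simp add: pos_le_divide_eq mult.commute)
    also have "\<dots> = (sqrt (?b / pi) * d ^ (m + 1) / r * H)\<^sup>2"
    proof -
      have "(d ^ (m + 1))\<^sup>2 = d ^ (2*m+2)" by (simp only: power_mult[symmetric] ring_distribs) (simp add: mult.commute)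
      moreover have "(sqrt (?b / pi))\<^sup>2 = ?b / pi" using b by (intro real_sqrt_pow2) simp
      ultimately show ?thesis by (simp only: power_mult_distrib power_divide) simp
    qed
    finally have "\<bar>U 0 0 x - P 0 0 x\<bar> \<le> \<bar>sqrt (?b / pi) * d ^ (m + 1) / r * H\<bar>"
      by (simp only: abs_le_square_iff)
    moreover have "0 \<le> sqrt (?b / pi) * d ^ (m + 1) / r * H"
      using b d0 H0 r by (intro mult_nonneg_nonneg divide_nonneg_pos zero_le_power real_sqrt_ge_zero) auto
    ultimately have "\<bar>U 0 0 x - P 0 0 x\<bar> \<le> sqrt (?b / pi) * d ^ (m + 1) / r * H" by (simp only: abs_of_nonneg)
    moreover have "\<bar>U 0 0 x - g x\<bar> \<le> \<delta>" using U(2) x by blast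
    ultimately show ?thesis by linarith
  qed
  have "ennreal (?b * d ^ (2*m)) * T \<le> ennreal (?b * d ^ (2*m)) * ennreal (H\<^sup>2)" by (intro mult_left_mono T) simp
  also have "\<dots> = ennreal (?b * d ^ (2*m) * H\<^sup>2)" using b d0 by (simp add: ennreal_mult)
  finally have "sq_integral S (\<lambda>x. U 1 0 x - P 1 0 x) + sq_integral S (\<lambda>x. U 0 1 x - P 0 1 x) \<le> ennreal (?b * d ^ (2*m) * H\<^sup>2)"
    using gr by (rule order_trans[rotated])
  then show ?thesis using U(1) P E grad by (intro exI[of _ U] exI[of _ P] conjI ballI)
qed

subsection \<open>Stability of the reconstruction\<close>

text \<open>If the essential supremum were smaller than some value of the continuous function,
  larger values would be taken on an open set meeting the interior, because \<open>S\<close> lies in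
  the closure of its interior; such a set is not null.\<close>

lemma Linf_norm_bounds:
  fixes p :: "real^2 \<Rightarrow> real"
  assumes S: "compact S" "S \<subseteq> closure (interior S)" and p: "continuous_on UNIV p"
    and M: "\<And>x. x \<in> S \<Longrightarrow> \<bar>p x\<bar> \<le> M" and x: "x \<in> S"
  shows "\<bar>p x\<bar> \<le> Linf_norm S p" "Linf_norm S p \<le> M"
proof -
  have SL: "S \<in> sets lebesgue" using S(1) by (simp add: borel_compact)
  have "(\<lambda>x. ereal \<bar>p x\<bar>) \<in> borel_measurable lborel"
    using borel_measurable_continuous_onI[OF p] by simp
  then have meas: "(\<lambda>x. ereal \<bar>p x\<bar>) \<in> borel_measurable (lebesgue_on S)"
    by (intro measurable_restrict_space1 measurable_completion)
  let ?s = "esssup (lebesgue_on S) (\<lambda>x. ereal \<bar>p x\<bar>)"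
  have up: "?s \<le> ereal M"
    by (rule esssup_I[OF meas]) (use M in \<open>auto intro!: AE_I2 simp: space_restrict_space\<close>)
  have low: "ereal \<bar>p z\<bar> \<le> ?s" if z: "z \<in> S" for z
  proof (rule ccontr)
    assume "\<not> ereal \<bar>p z\<bar> \<le> ?s"
    then have "?s < ereal \<bar>p z\<bar>" by simp
    then obtain b where b: "?s < ereal b" "b < \<bar>p z\<bar>" using ereal_dense2 by (metis ereal_less(2) less_ereal.simps(1))
    define W where "W = interior S \<inter> {x. b < \<bar>p x\<bar>}"
    have op: "open {x. b < \<bar>p x\<bar>}" by (intro open_Collect_less continuous_intros p)
    then have W: "open W" unfolding W_def by auto
    have "W \<noteq> {}"
    proof -
      have "z \<in> closure (interior S)" using S(2) z by blast
      moreover have "z \<in> {x. b < \<bar>p x\<bar>}" using b by simp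
      ultimately have "{x. b < \<bar>p x\<bar>} \<inter> interior S \<noteq> {}" using op by (metis (no_types, lifting) IntI disjoint_iff open_Int_closure_eq_empty)
      then show ?thesis unfolding W_def by blast
    qed
    have "AE x in lebesgue_on S. ereal \<bar>p x\<bar> \<le> ?s" by (rule esssup_AE)
    then have "AE x in lebesgue. x \<in> S \<longrightarrow> ereal \<bar>p x\<bar> \<le> ?s" using SL by (simp add: AE_restrict_space_iff)
    then have "AE x in lebesgue. x \<notin> W"
    proof (rule AE_mp, intro AE_I2 impI notI)
      fix x assume h: "x \<in> S \<longrightarrow> ereal \<bar>p x\<bar> \<le> ?s" "x \<in> W"
      then have x: "x \<in> interior S" "b < \<bar>p x\<bar>" by (simp_all add: W_def)
      then have "ereal \<bar>p x\<bar> \<le> ?s" using h(1) interior_subset[of S] by blast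
      also have "?s < ereal b" by (rule b(1))
      finally show False using x(2) by simp
    qed
    then have "W \<in> null_sets lebesgue" using W by (simp add: AE_iff_null_sets)
    then have "negligible W" by (simp add: negligible_iff_null_sets)
    then show False using open_not_negligible[OF W \<open>W \<noteq> {}\<close>] by simp
  qed
  \<comment> \<open>The essential supremum lies between two real numbers, so
    \<open>real_of_ereal\<close> does not return its default value.\<close>
  have s: "?s = ereal (Linf_norm S p)"
    unfolding Linf_norm_def using up low[OF x] by (cases ?s) auto
  show "\<bar>p x\<bar> \<le> Linf_norm S p" using low[OF x] unfolding s by simp
  show "Linf_norm S p \<le> M" using up unfolding s by simp
qed

locale reconstruction_patch =
  fixes S I :: "(real^2) set" and m :: nat
  assumes S: "compact S" "S \<subseteq> closure (interior S)"
    and I: "finite I" "I \<noteq> {}" "I \<subseteq> S"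
    and unisolvent: "\<And>p. p \<in> polys m \<Longrightarrow> \<forall>x\<in>I. p x = 0 \<Longrightarrow> \<forall>x\<in>S. p x = 0"
begin

lemma S_ball: "\<exists>z e. e > 0 \<and> ball z e \<subseteq> S"
proof -
  have "interior S \<noteq> {}" using S(2) I by auto
  then show ?thesis by (meson all_not_in_conv mem_interior)
qed

text \<open>\<open>S\<close> contains a ball, so unisolvence on \<open>S\<close> determines a
  polynomial on the whole plane, as uniqueness of the reconstruction as a function requires.\<close>

lemma polys_determined: "p = (\<lambda>x. 0)" if "p \<in> polys m" "\<forall>x\<in>S. p x = 0"
proof -
  obtain z e where "e > 0" "ball z e \<subseteq> S" using S_ball by (elim exE conjE)
  then show ?thesis using that by (intro polys_eq_0_if_vanishing_on_ball[OF that(1)]) auto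
qed

lemma max_bound: "x \<in> I \<Longrightarrow> \<bar>p x\<bar> \<le> Max ((\<lambda>x. \<bar>p x\<bar>) ` I)" for p :: "real^2 \<Rightarrow> real"
  using I by (intro Max_ge) auto

text \<open>A real supremum is informative only if the quotients are bounded. The reproduction
  formula yields some bound \<open>C\<close>; it certifies finiteness and does not enter the
  estimate.\<close>

lemma Lambda_nodes_bound:
  shows "0 \<le> Lambda_nodes m I S"
    and "p \<in> polys m \<Longrightarrow> x \<in> S \<Longrightarrow> \<bar>p x\<bar> \<le> Lambda_nodes m I S * Max ((\<lambda>x. \<bar>p x\<bar>) ` I)"
proof -
  let ?M = "\<lambda>p::real^2 \<Rightarrow> real. Max ((\<lambda>x. \<bar>p x\<bar>) ` I)"
  let ?A = "{p \<in> polys m. \<exists>x\<in>S. p x \<noteq> 0}"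
  have uni: "p = (\<lambda>x. 0)" if "p \<in> polys m" "\<forall>x\<in>I. p x = 0" for p
    using polys_determined[OF that(1) unisolvent[OF that]] .
  obtain x0 where x0: "x0 \<in> I" "x0 \<in> S" using I by auto
  have Mnn: "0 \<le> ?M p" for p using max_bound[OF x0(1), of p] by linarith
  have Mpos: "0 < ?M p" if "p \<in> ?A" for p
  proof -
    from that have p: "p \<in> polys m" "\<exists>x\<in>S. p x \<noteq> 0" by auto
    then have "\<not> (\<forall>x\<in>I. p x = 0)" using unisolvent[OF p(1)] by blast
    then obtain z where "z \<in> I" "p z \<noteq> 0" by auto
    then show ?thesis using max_bound[of z p] by linarith
  qed
  have "\<exists>L. (\<forall>z. L z \<in> polys m) \<and> (\<forall>p\<in>polys m. \<forall>x. p x = (\<Sum>z\<in>I. p z * L z x))"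
    by (rule polys_interpolation[OF I(1)]) (rule uni)
  then obtain L where L: "\<forall>z. L z \<in> polys m" and lp: "\<forall>p\<in>polys m. \<forall>x. p x = (\<Sum>z\<in>I. p z * L z x)"
    by (elim exE conjE)
  have "\<exists>C\<ge>0. \<forall>x\<in>S. (\<Sum>z\<in>I. \<bar>L z x\<bar>) \<le> C"
    by (rule polys_bounded_on_compact[where m=m and L=L]) (rule spec[OF L] S(1) I(1))+
  then obtain C where C: "C \<ge> 0" "\<forall>x\<in>S. (\<Sum>z\<in>I. \<bar>L z x\<bar>) \<le> C" by (elim exE conjE)
  have pC: "\<bar>p x\<bar> \<le> C * ?M p" if p: "p \<in> polys m" and x: "x \<in> S" for p x
  proof -
    have "\<bar>p x\<bar> = \<bar>\<Sum>z\<in>I. p z * L z x\<bar>" by (subst spec[OF bspec[OF lp p], of x]) simp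
    also have "\<dots> \<le> (\<Sum>z\<in>I. ?M p * \<bar>L z x\<bar>)"
      by (rule order_trans[OF sum_abs]) (auto intro!: sum_mono mult_right_mono max_bound simp: abs_mult)
    also have "\<dots> = ?M p * (\<Sum>z\<in>I. \<bar>L z x\<bar>)" by (simp add: sum_distrib_left)
    also have "\<dots> \<le> ?M p * C" using bspec[OF C(2) x] Mnn by (intro mult_left_mono) auto
    finally show ?thesis by (simp add: mult.commute)
  qed
  have linf: "\<bar>p x\<bar> \<le> Linf_norm S p" "Linf_norm S p \<le> C * ?M p" if "p \<in> polys m" "x \<in> S" for p x
    using Linf_norm_bounds[OF S polys_continuous[OF that(1)] pC[OF that(1)] that(2)] by blast+
  have bdd: "bdd_above ((\<lambda>p. Linf_norm S p / ?M p) ` ?A)"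
  proof (rule bdd_aboveI2[where M=C])
    fix p assume "p \<in> ?A"
    then show "Linf_norm S p / ?M p \<le> C"
      using linf(2)[OF _ x0(2)] Mpos by (simp add: pos_divide_le_eq)
  qed
  have upper: "Linf_norm S p / ?M p \<le> Lambda_nodes m I S" if "p \<in> ?A" for p
    unfolding Lambda_nodes_def by (rule cSUP_upper[OF that bdd])
  \<comment> \<open>The constant polynomial is an admissible competitor and shows that the supremum
    is nonnegative.\<close>
  have one: "(\<lambda>x. 1) \<in> ?A" using polys_monomial[of 0 0 m] x0(2) by auto
  have "0 \<le> Linf_norm S (\<lambda>x. 1) / ?M (\<lambda>x. 1)"
    using linf(1)[of "\<lambda>x. 1", OF _ x0(2)] one Mpos[OF one] by (intro divide_nonneg_pos) auto
  then show nn: "0 \<le> Lambda_nodes m I S" using upper[OF one] by linarith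
  show "\<bar>p x\<bar> \<le> Lambda_nodes m I S * ?M p" if "p \<in> polys m" "x \<in> S"
  proof (cases "p \<in> ?A")
    case True
    have "\<bar>p x\<bar> \<le> Linf_norm S p" by (rule linf(1)[OF that])
    also have "\<dots> \<le> Lambda_nodes m I S * ?M p"
      using upper[OF True] Mpos[OF True] by (simp add: pos_divide_le_eq)
    finally show ?thesis .
  next
    case False
    then have "p x = 0" using that by auto
    then show ?thesis using nn Mnn[of p] by simp
  qed
qed

lemma reconstruction_in_polys: "reconstruction m I g \<in> polys m"
  by (rule reconstruction_properties(1)[OF I(1)]) (rule polys_determined, assumption, rule unisolvent)

text \<open>Minimality against the competitor \<open>P\<close> bounds the residual at each node by
  \<open>sqrt (card I) * e\<close>. This controls \<open>P\<close> minus the reconstruction at the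
  nodes, and \<open>Lambda_nodes\<close> extends the control from the nodes to
  \<open>S\<close>.\<close>

lemma reconstruction_stable:
  assumes P: "P \<in> polys m" and e: "\<And>x. x \<in> S \<Longrightarrow> \<bar>g x - P x\<bar> \<le> e" and x: "x \<in> S"
  shows "\<bar>P x - reconstruction m I g x\<bar> \<le> 2 * (Lambda_nodes m I S * sqrt (card I)) * e"
proof -
  let ?R = "reconstruction m I g"
  have R: "?R \<in> polys m" by (rule reconstruction_in_polys)
  have e0: "0 \<le> e" using e[OF x] by linarith
  have n1: "1 \<le> sqrt (card I)" using I by (simp add: Suc_leI card_gt_0_iff)
  have "(\<Sum>z\<in>I. \<bar>g z - ?R z\<bar>\<^sup>2) \<le> (\<Sum>z\<in>I. \<bar>g z - P z\<bar>\<^sup>2)"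
    by (rule reconstruction_properties(2)[OF I(1) _ P]) (rule polys_determined, assumption, rule unisolvent)
  also have "\<dots> \<le> (\<Sum>z\<in>I. e\<^sup>2)" using e I(3) by (intro sum_mono power_mono) auto
  also have "\<dots> = (sqrt (card I) * e)\<^sup>2" by (simp add: power_mult_distrib)
  finally have sum: "(\<Sum>z\<in>I. \<bar>g z - ?R z\<bar>\<^sup>2) \<le> (sqrt (card I) * e)\<^sup>2" .
  have node: "\<bar>P z - ?R z\<bar> \<le> 2 * sqrt (card I) * e" if z: "z \<in> I" for z
  proof -
    have "\<bar>g z - ?R z\<bar>\<^sup>2 \<le> (\<Sum>z\<in>I. \<bar>g z - ?R z\<bar>\<^sup>2)"
      using I(1) z by (intro member_le_sum[where f="\<lambda>z. \<bar>g z - ?R z\<bar>\<^sup>2"]) auto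
    also note sum
    finally have "\<bar>g z - ?R z\<bar> \<le> sqrt (card I) * e" by (rule power2_le_imp_le) (use e0 in simp)
    moreover have "\<bar>g z - P z\<bar> \<le> e" using e z I(3) by blast
    \<comment> \<open>There is at least one node, so the error of \<open>P\<close> at the node can
      be merged into the factor 2.\<close>
    moreover have "1 * e \<le> sqrt (card I) * e" using n1 e0 by (intro mult_right_mono) auto
    ultimately show ?thesis by linarith
  qed
  have "\<bar>P x - ?R x\<bar> \<le> Lambda_nodes m I S * Max ((\<lambda>x. \<bar>P x - ?R x\<bar>) ` I)"
    by (rule Lambda_nodes_bound(2)[OF polys_diff[OF P R] x])
  also have "\<dots> \<le> Lambda_nodes m I S * (2 * sqrt (card I) * e)"
    using I node by (intro mult_left_mono Lambda_nodes_bound(1) Max.boundedI) auto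
  finally show ?thesis by (simp add: mult_ac)
qed

end

subsection \<open>Shape-regular triangles\<close>

text \<open>Any inscribed disk of more than half the inradius will do. The factor lost in this way
  is the 2 in \<open>2 * \<sigma> * \<rho>\<close>.\<close>

lemma triangle_inscribed_disk:
  assumes T: "2 simplex T" and shape: "diameter T / inradius T \<le> \<sigma>" and \<sigma>: "\<sigma> > 0"
  shows "compact T \<and> (\<exists>z \<rho>. \<rho> > 0 \<and> cball z \<rho> \<subseteq> T \<and> T \<subseteq> cball z (2 * \<sigma> * \<rho>))"
proof -
  obtain C :: "(real^2) set" where C: "\<not> affine_dependent C" "int (card C) = 2 + 1" "T = convex hull C"
    using T unfolding simplex_def by blast
  have fin: "finite C" using C(1) by (rule aff_independent_finite)
  have Tb: "bounded T" unfolding C(3) by (rule bounded_convex_hull[OF finite_imp_bounded[OF fin]])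
  have "card C = Suc DIM(real^2)" using C(2) by simp
  \<comment> \<open>A nondegenerate triangle has positive inradius, so the quotient in the shape
    condition is not a division by zero.\<close>
  then have "interior T \<noteq> {}" unfolding C(3) using C(1) interior_convex_hull_eq_empty by blast
  then obtain y e where e: "e > 0" "cball y e \<subseteq> T" by (meson all_not_in_conv mem_interior_cball)
  define X where "X = {\<rho>. 0 \<le> \<rho> \<and> (\<exists>x. cball x \<rho> \<subseteq> T)}"
  have eX: "e \<in> X" using e by (auto simp: X_def)
  have bdd: "bdd_above X"
  proof (rule bdd_aboveI[where M="diameter T"])
    fix \<rho> assume "\<rho> \<in> X"
    then obtain x where x: "0 \<le> \<rho>" "cball x \<rho> \<subseteq> T" by (auto simp: X_def)
    have "x \<in> T" "x + \<rho> *\<^sub>R axis 1 1 \<in> T" using x by (auto simp: dist_norm)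
    then have "dist x (x + \<rho> *\<^sub>R axis 1 1) \<le> diameter T" by (rule diameter_bounded_bound[OF Tb])
    then show "\<rho> \<le> diameter T" using x(1) by (simp add: dist_norm)
  qed
  have inr: "inradius T = Sup X" by (simp add: inradius_def X_def)
  have ipos: "inradius T > 0" unfolding inr using cSup_upper[OF eX bdd] e(1) by linarith
  have "inradius T / 2 < Sup X" using ipos unfolding inr by simp
  then obtain \<rho> where \<rho>: "\<rho> \<in> X" "inradius T / 2 < \<rho>" using less_cSupD[of X] eX by blast
  then obtain z where z: "cball z \<rho> \<subseteq> T" by (auto simp: X_def)
  have \<rho>0: "\<rho> > 0" using \<rho> ipos by linarith
  have "diameter T \<le> \<sigma> * inradius T" using shape ipos by (simp add: pos_divide_le_eq)
  also have "\<dots> \<le> \<sigma> * (2 * \<rho>)" using \<rho>(2) \<sigma> by (intro mult_left_mono) auto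
  finally have dT: "diameter T \<le> 2 * \<sigma> * \<rho>" by simp
  have "z \<in> T" using z \<rho>0 by auto
  have "T \<subseteq> cball z (2 * \<sigma> * \<rho>)"
  proof
    fix x assume "x \<in> T"
    from diameter_bounded_bound[OF Tb \<open>z \<in> T\<close> this] dT show "x \<in> cball z (2 * \<sigma> * \<rho>)" by simp
  qed
  moreover have "compact T" unfolding C(3) by (rule finite_imp_compact_convex_hull[OF fin])
  ultimately show ?thesis using \<rho>0 z by blast
qed

text \<open>The Bochner integral of a nonnegative function never exceeds its
  \<open>nn_integral\<close>, the default value 0 included, so the bound applies to a weak gradient
  whose values off the interior are arbitrary.\<close>

lemma L2_norm_le:
  assumes "K \<in> sets borel" "0 \<le> X"
    and "(\<integral>\<^sup>+x. ennreal ((norm (f x))\<^sup>2) * indicator K x \<partial>lebesgue) \<le> ennreal (X\<^sup>2)"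
  shows "L2_norm K f \<le> X"
proof -
  have "(\<integral>\<^sup>+x. ennreal ((norm (f x))\<^sup>2) \<partial>lebesgue_on K) \<le> ennreal (X\<^sup>2)"
    using assms by (subst nn_integral_restrict_space) auto
  then have "(LINT x|lebesgue_on K. (norm (f x))\<^sup>2) \<le> X\<^sup>2"
    by (intro integral_real_bounded) auto
  then have "L2_norm K f \<le> sqrt (X\<^sup>2)" unfolding L2_norm_def by (rule real_sqrt_le_mono)
  then show ?thesis using assms(2) by simp
qed

text \<open>On each triangle the pointwise bound is of order \<open>1 / \<rho>\<close>, while the
  area is at most that of a disk of radius \<open>s * \<rho>\<close>. The radius cancels, and
  triangles of very different sizes contribute equally.\<close>

lemma gradient_square_integral_on_triangles:
  assumes q: "q \<in> polys m" and dq: "\<And>x. (q has_derivative (\<lambda>h. q1 x * h$1 + q2 x * h$2)) (at x)"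
    and cont: "continuous_on UNIV q1" "continuous_on UNIV q2"
    and F: "finite F" "card F \<le> N"
    and T: "\<And>T. T \<in> F \<Longrightarrow> compact T \<and> (\<exists>z \<rho>. \<rho> > 0 \<and> cball z \<rho> \<subseteq> T \<and> T \<subseteq> cball z (s * \<rho>))"
    and C: "\<And>z \<rho> M y a b. \<rho> > 0 \<Longrightarrow> \<forall>x\<in>cball z \<rho>. \<bar>q x\<bar> \<le> M \<Longrightarrow> y \<in> cball z (s * \<rho>) \<Longrightarrow>
      (q has_derivative (\<lambda>h. a * h$1 + b * h$2)) (at y) \<Longrightarrow> \<bar>a\<bar> \<le> C * M / \<rho> \<and> \<bar>b\<bar> \<le> C * M / \<rho>"
    and C0: "C \<ge> 0" and s: "s \<ge> 0" and M: "\<And>x. x \<in> \<Union>F \<Longrightarrow> \<bar>q x\<bar> \<le> M" and M0: "M \<ge> 0"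
  shows "(\<integral>\<^sup>+x. ennreal ((q1 x)\<^sup>2 + (q2 x)\<^sup>2) * indicator (\<Union>F) x \<partial>lborel) \<le> ennreal (real N * (2 * pi * s\<^sup>2 * C\<^sup>2 * M\<^sup>2))"
proof -
  note [measurable] = borel_measurable_continuous_onI[OF cont(1)] borel_measurable_continuous_onI[OF cont(2)]
  let ?G = "\<lambda>x. ennreal ((q1 x)\<^sup>2 + (q2 x)\<^sup>2)"
  let ?c = "2 * pi * s\<^sup>2 * C\<^sup>2 * M\<^sup>2"
  have c0: "?c \<ge> 0" by simp
  have each: "(\<integral>\<^sup>+x. ?G x * indicator T x \<partial>lborel) \<le> ennreal ?c" if TF: "T \<in> F" for T
  proof -
    obtain z \<rho> where z: "\<rho> > 0" "cball z \<rho> \<subseteq> T" "T \<subseteq> cball z (s * \<rho>)" using T[OF TF] by auto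
    have Mz: "\<forall>x\<in>cball z \<rho>. \<bar>q x\<bar> \<le> M" using M z(2) TF by blast
    have "?G x * indicator T x \<le> ennreal (2 * (C * M / \<rho>)\<^sup>2) * indicator (cball z (s * \<rho>)) x" for x
    proof (cases "x \<in> T")
      case True
      then have x: "x \<in> cball z (s * \<rho>)" using z(3) by blast
      have "\<bar>q1 x\<bar> \<le> C * M / \<rho> \<and> \<bar>q2 x\<bar> \<le> C * M / \<rho>" by (rule C[OF z(1) Mz x dq])
      then have "\<bar>q1 x\<bar>\<^sup>2 \<le> (C * M / \<rho>)\<^sup>2" "\<bar>q2 x\<bar>\<^sup>2 \<le> (C * M / \<rho>)\<^sup>2" by (intro power_mono; simp)+
      then have "(q1 x)\<^sup>2 + (q2 x)\<^sup>2 \<le> 2 * (C * M / \<rho>)\<^sup>2" by simp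
      from ennreal_leI[OF this] show ?thesis using True x by simp
    qed simp
    then have "(\<integral>\<^sup>+x. ?G x * indicator T x \<partial>lborel) \<le> (\<integral>\<^sup>+x. ennreal (2 * (C * M / \<rho>)\<^sup>2) * indicator (cball z (s * \<rho>)) x \<partial>lborel)"
      by (rule nn_integral_mono)
    also have "\<dots> = ennreal (2 * (C * M / \<rho>)\<^sup>2) * emeasure lborel (cball z (s * \<rho>))"
      by (rule nn_integral_cmult_indicator) simp
    also have "\<dots> = ennreal (2 * (C * M / \<rho>)\<^sup>2 * (pi * (s * \<rho>)\<^sup>2))"
      using s z(1) by (subst emeasure_cball_2) (simp_all add: ennreal_mult)
    also have "2 * (C * M / \<rho>)\<^sup>2 * (pi * (s * \<rho>)\<^sup>2) = ?c"
      using z(1) by (simp add: power_mult_distrib power_divide)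
    finally show ?thesis .
  qed
  have "(\<integral>\<^sup>+x. ?G x * indicator (\<Union>F) x \<partial>lborel) \<le> (\<integral>\<^sup>+x. (\<Sum>T\<in>F. ?G x * indicator T x) \<partial>lborel)"
  proof (rule nn_integral_mono)
    fix x
    show "?G x * indicator (\<Union>F) x \<le> (\<Sum>T\<in>F. ?G x * indicator T x)"
    proof (cases "x \<in> \<Union>F")
      case True
      then obtain T where "T \<in> F" "x \<in> T" by auto
      then show ?thesis
        using True member_le_sum[of T F "\<lambda>T. ?G x * indicator T x"] F(1) by simp
    qed simp
  qed
  also have "\<dots> = (\<Sum>T\<in>F. \<integral>\<^sup>+x. ?G x * indicator T x \<partial>lborel)"
  proof (rule nn_integral_sum)
    fix T' assume "T' \<in> F"
    then have [measurable]: "T' \<in> sets borel" using T by (auto intro: borel_compact)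
    show "(\<lambda>x. ?G x * indicator T' x) \<in> borel_measurable lborel" by measurable
  qed
  also have "\<dots> \<le> (\<Sum>T\<in>F. ennreal ?c)" by (rule sum_mono) (rule each)
  also have "\<dots> = ennreal (real (card F) * ?c)" using c0 by (simp add: ennreal_mult ennreal_of_nat_eq_real_of_nat)
  also have "\<dots> \<le> ennreal (real N * ?c)" using F(2) c0 by (intro ennreal_leI mult_right_mono) auto
  finally show ?thesis .
qed

text \<open>The constants are expressions in \<gamma>, \<open>m\<close>, \<open>N\<close>,
  \<open>s\<close> and \<open>C\<close> only. The error is split through the local polynomial
  \<open>P\<close>; for the gradient the smooth function \<open>U\<close> comes in between, as
  \<open>g\<close> has only weak derivatives.\<close>

lemma patch_estimate:
  fixes S K I :: "(real^2) set" and g :: "real^2 \<Rightarrow> real" and m N :: nat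
  defines "H \<equiv> sobolev_seminorm (m + 1) S g" and "d \<equiv> diameter S" and "h \<equiv> diameter K"
    and "w \<equiv> (\<lambda>x. g x - reconstruction m I g x)"
  assumes ss: "star_shaped S c r" and rp: "reconstruction_patch S I m"
    and BS: "cball c r \<subseteq> S" and SR: "S \<subseteq> cball c' R" and \<gamma>: "\<gamma> = 2 * R / r" and m: "m \<ge> 1"
    and g: "continuous_on S g" "g \<in> sobolev (m + 1) S"
    and L: "1 + Lambda_nodes m I S * sqrt (card I) \<le> \<Lambda>"
    and K: "compact K" "K \<noteq> {}" "K \<subseteq> S" "K = \<Union>F" and F: "finite F" "card F \<le> N"
    and T: "\<And>T. T \<in> F \<Longrightarrow> compact T \<and> (\<exists>z \<rho>. \<rho> > 0 \<and> cball z \<rho> \<subseteq> T \<and> T \<subseteq> cball z (s * \<rho>))" and s: "s \<ge> 0"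
    and C0: "C \<ge> 0" and C: "\<forall>q\<in>polys m. \<forall>z \<rho> M y a b. \<rho> > 0 \<and> (\<forall>x\<in>cball z \<rho>. \<bar>q x\<bar> \<le> M) \<and> y \<in> cball z (s * \<rho>)
      \<and> (q has_derivative (\<lambda>h. a * h$1 + b * h$2)) (at y) \<longrightarrow> \<bar>a\<bar> \<le> C * M / \<rho> \<and> \<bar>b\<bar> \<le> C * M / \<rho>"
  defines "b \<equiv> bh_const m (\<gamma>\<^sup>2 / 4 + 1)"
  defines "C1 \<equiv> sqrt (b / pi) * \<gamma>"
  shows "L2_norm K w \<le> 2 * sqrt pi * C1 * \<Lambda> * h * d ^ m * H"
    and "L2_norm K (weak_gradient (interior S) w)
      \<le> sqrt (3 * (b + real N * (8 * pi * s\<^sup>2 * C\<^sup>2 * C1\<^sup>2))) * \<Lambda> * d ^ m * H"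
proof -
  interpret star_shaped S c r by (rule ss)
  interpret reconstruction_patch S I m by (rule rp)
  let ?D = "interior S"
  let ?R = "reconstruction m I g"
  have cS: "compact S" by (rule star_shaped.S[OF ss])
  have Sbd: "bounded S" using cS by (rule compact_imp_bounded)
  have Db: "?D \<in> sets borel" "bounded ?D" using Sbd bounded_interior by auto
  note [measurable] = Db(1)
  have R0: "R \<ge> 0"
  proof -
    have "c \<in> S" using BS r by auto
    then show ?thesis using SR by (metis empty_iff mem_cball subsetD zero_le_dist order_trans)
  qed
  have \<gamma>0: "\<gamma> \<ge> 0" using R0 r by (simp add: \<gamma>)
  have b0: "b \<ge> 0" unfolding b_def by (rule bh_const_nonneg) simp
  have C10: "C1 \<ge> 0" unfolding C1_def using b0 \<gamma>0 by simp
  have d0: "d \<ge> 0" unfolding d_def using Sbd by (rule diameter_ge_0)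
  have H0: "H \<ge> 0" unfolding H_def by (rule sobolev_seminorm_nonneg)
  have h0: "h \<ge> 0" unfolding h_def using compact_imp_bounded[OF K(1)] by (rule diameter_ge_0)
  have L1: "\<Lambda> \<ge> 1"
  proof -
    have "0 \<le> Lambda_nodes m I S * sqrt (card I)" by (intro mult_nonneg_nonneg Lambda_nodes_bound(1)) simp
    then show ?thesis using L by linarith
  qed
  define E where "E = C1 * d ^ m * H"
  have E0: "E \<ge> 0" unfolding E_def using C10 d0 H0 by simp
  \<comment> \<open>One power of \<open>d\<close> is traded against \<open>1 / r\<close>: the patch
    lies in a disk of radius \<open>R\<close>, so \<open>d / r\<close> is at most \<gamma>.\<close>
  have dr: "sqrt (b / pi) * d ^ (m + 1) / r * H \<le> E"
  proof -
    have "d \<le> 2 * R" unfolding d_def using diameter_subset[OF SR bounded_cball] R0 by simp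
    then have "d / r \<le> \<gamma>" using r unfolding \<gamma> by (intro divide_right_mono) auto
    then have "sqrt (b / pi) * d ^ m * H * (d / r) \<le> sqrt (b / pi) * d ^ m * H * \<gamma>"
      using b0 d0 H0 by (intro mult_left_mono) auto
    then show ?thesis unfolding E_def C1_def by (simp add: mult_ac)
  qed
  \<comment> \<open>The areas of the two disks of radii \<open>R\<close> and \<open>r\<close> sum to
    \<open>\<gamma>\<^sup>2 / 4 + 1\<close> times that of the smaller one.\<close>
  have \<kappa>: "\<gamma>\<^sup>2 / 4 + 1 \<ge> 0" "emeasure lborel S + emeasure lborel (cball c r) \<le> ennreal (\<gamma>\<^sup>2 / 4 + 1) * emeasure lborel (cball c r)"
  proof -
    have "emeasure lborel S + emeasure lborel (cball c r) \<le> emeasure lborel (cball c' R) + emeasure lborel (cball c r)"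
      by (intro add_mono emeasure_mono SR order_refl) simp
    also have "\<dots> = ennreal (pi * R\<^sup>2 + pi * r\<^sup>2)"
      using R0 r by (simp add: emeasure_cball_2)
    also have "pi * R\<^sup>2 + pi * r\<^sup>2 = (\<gamma>\<^sup>2 / 4 + 1) * (pi * r\<^sup>2)"
      using r by (simp add: \<gamma> power_divide power_mult_distrib ring_distribs)
    also have "ennreal \<dots> = ennreal (\<gamma>\<^sup>2 / 4 + 1) * emeasure lborel (cball c r)"
      using r by (simp only: emeasure_cball_2 less_imp_le) (simp add: ennreal_mult)
    finally show "emeasure lborel S + emeasure lborel (cball c r) \<le> ennreal (\<gamma>\<^sup>2 / 4 + 1) * emeasure lborel (cball c r)" .
  qed simp
  have Rp: "?R \<in> polys m" by (rule reconstruction_in_polys)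
  obtain R1 R2 where R1: "R1 \<in> polys m" and R2: "R2 \<in> polys m"
    and dR: "\<forall>x. (?R has_derivative (\<lambda>h. R1 x * h$1 + R2 x * h$2)) (at x)"
    using polys_has_derivative[OF Rp] by (elim bexE)
  have wR: "has_weak_deriv ?D (1, 0) ?R R1" "has_weak_deriv ?D (0, 1) ?R R2"
    by (rule polys_has_weak_deriv[OF spec[OF dR]]; (rule polys_continuous Rp R1 R2 Db)+)+
  \<comment> \<open>The negative lets \<open>has_weak_deriv_diff\<close> recover \<open>g\<close>
    from the error \<open>w\<close> by adding the reconstruction back.\<close>
  have wRneg: "has_weak_deriv ?D (1, 0) (\<lambda>x. - ?R x) (\<lambda>x. - R1 x)" "has_weak_deriv ?D (0, 1) (\<lambda>x. - ?R x) (\<lambda>x. - R2 x)"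
  proof -
    have "((\<lambda>x. - ?R x) has_derivative (\<lambda>h. (- R1 x) * h$1 + (- R2 x) * h$2)) (at x)" for x
      by (rule has_derivative_eq_rhs[OF has_derivative_minus[OF spec[OF dR]]]) auto
    note this' = polys_has_weak_deriv[OF this]
    show "has_weak_deriv ?D (1, 0) (\<lambda>x. - ?R x) (\<lambda>x. - R1 x)" "has_weak_deriv ?D (0, 1) (\<lambda>x. - ?R x) (\<lambda>x. - R2 x)"
      by (rule this'; (rule continuous_on_minus polys_continuous Rp R1 R2 Db)+)+
  qed
  \<comment> \<open>These are the representatives that \<open>weak_gradient\<close> selects for
    \<open>w\<close>; \<open>v1\<close> and \<open>v2\<close> are derived from them, so that no
    comparison of different representatives is needed.\<close>
  define V1 where "V1 = weak_deriv ?D (1, 0) w"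
  define V2 where "V2 = weak_deriv ?D (0, 1) w"
  have V1: "has_weak_deriv ?D (1, 0) w V1"
  proof -
    have "has_weak_deriv ?D (1, 0) g (weak_deriv ?D (1, 0) g)" by (rule weak_deriv_works[OF g(2)]) simp
    then have "has_weak_deriv ?D (1, 0) w (\<lambda>x. weak_deriv ?D (1, 0) g x - R1 x)"
      unfolding w_def using wR(1) Db by (rule has_weak_deriv_diff)
    then show ?thesis unfolding V1_def weak_deriv_def by (rule someI[of "has_weak_deriv ?D (1, 0) w"])
  qed
  have V2: "has_weak_deriv ?D (0, 1) w V2"
  proof -
    have "has_weak_deriv ?D (0, 1) g (weak_deriv ?D (0, 1) g)" by (rule weak_deriv_works[OF g(2)]) simp
    then have "has_weak_deriv ?D (0, 1) w (\<lambda>x. weak_deriv ?D (0, 1) g x - R2 x)"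
      unfolding w_def using wR(2) Db by (rule has_weak_deriv_diff)
    then show ?thesis unfolding V2_def weak_deriv_def by (rule someI[of "has_weak_deriv ?D (0, 1) w"])
  qed
  define v1 where "v1 x = V1 x - - R1 x" for x
  define v2 where "v2 x = V2 x - - R2 x" for x
  have v1: "has_weak_deriv ?D (1, 0) g v1"
    using has_weak_deriv_diff[OF V1 wRneg(1) Db] unfolding w_def v1_def by simp
  have v2: "has_weak_deriv ?D (0, 1) g v2"
    using has_weak_deriv_diff[OF V2 wRneg(2) Db] unfolding w_def v2_def by simp
  have approx: "\<exists>U P. jet U \<and> jet P \<and> P 0 0 \<in> polys m \<and>
    (\<forall>x\<in>S. \<bar>g x - P 0 0 x\<bar> \<le> E + \<delta>) \<and>
    sq_integral S (\<lambda>x. U 1 0 x - P 1 0 x) + sq_integral S (\<lambda>x. U 0 1 x - P 0 1 x) \<le> ennreal (b * d ^ (2*m) * H\<^sup>2) \<and>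
    (\<integral>\<^sup>+x. ennreal ((U 1 0 x - v1 x)\<^sup>2) * indicator ?D x \<partial>lebesgue) \<le> ennreal \<delta> \<and>
    (\<integral>\<^sup>+x. ennreal ((U 0 1 x - v2 x)\<^sup>2) * indicator ?D x \<partial>lebesgue) \<le> ennreal \<delta>" if \<delta>: "\<delta> > 0" for \<delta>
  proof -
    obtain U P where UP: "jet U" "jet P" "P 0 0 \<in> polys m"
      and a: "\<forall>x\<in>S. \<bar>g x - P 0 0 x\<bar> \<le> sqrt (b / pi) * d ^ (m + 1) / r * H + \<delta>"
      and rest: "sq_integral S (\<lambda>x. U 1 0 x - P 1 0 x) + sq_integral S (\<lambda>x. U 0 1 x - P 0 1 x) \<le> ennreal (b * d ^ (2*m) * H\<^sup>2)"
        "(\<integral>\<^sup>+x. ennreal ((U 1 0 x - v1 x)\<^sup>2) * indicator ?D x \<partial>lebesgue) \<le> ennreal \<delta>"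
        "(\<integral>\<^sup>+x. ennreal ((U 0 1 x - v2 x)\<^sup>2) * indicator ?D x \<partial>lebesgue) \<le> ennreal \<delta>"
      using local_polynomial_approximation[OF BS \<kappa> m g v1 v2 \<delta>]
      unfolding H_def[symmetric] d_def[symmetric] b_def[symmetric] by (elim exE conjE)
    have "\<bar>g x - P 0 0 x\<bar> \<le> E + \<delta>" if "x \<in> S" for x using bspec[OF a that] dr by linarith
    then show ?thesis using UP rest by (intro exI[of _ U] exI[of _ P] conjI ballI)
  qed
  \<comment> \<open>\<open>\<Lambda>\<close> contains the summand 1, so the stability factor is
    \<open>\<Lambda> - 1\<close>. The saved \<open>2 * e\<close> absorbs the distance from
    \<open>g\<close> to \<open>P\<close>.\<close>
  have stable: "\<bar>P x - ?R x\<bar> \<le> 2 * \<Lambda> * e - 2 * e"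
    if P: "P \<in> polys m" and e: "\<And>x. x \<in> S \<Longrightarrow> \<bar>g x - P x\<bar> \<le> e" and x: "x \<in> S" for P e x
  proof -
    have e0: "e \<ge> 0" using e[OF x] by linarith
    have "\<bar>P x - ?R x\<bar> \<le> 2 * (Lambda_nodes m I S * sqrt (card I)) * e" by (rule reconstruction_stable[OF P e x])
    also have "\<dots> \<le> 2 * (\<Lambda> - 1) * e" using L e0 by (intro mult_right_mono mult_left_mono) auto
    finally show ?thesis by (simp add: algebra_simps)
  qed
  have wE: "\<bar>w x\<bar> \<le> 2 * \<Lambda> * E" if x: "x \<in> S" for x
  proof (rule field_le_epsilon)
    fix e :: real assume e: "e > 0"
    \<comment> \<open>Chosen so that the contribution \<open>2 * \<Lambda> * \<delta>\<close> equals
      \<open>e\<close>.\<close>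
    define \<delta> where "\<delta> = e / (2 * \<Lambda>)"
    have \<delta>: "\<delta> > 0" using e L1 by (simp add: \<delta>_def)
    obtain U P where P: "P 0 0 \<in> polys m" "\<forall>x\<in>S. \<bar>g x - P 0 0 x\<bar> \<le> E + \<delta>"
      using approx[OF \<delta>] by (elim exE conjE)
    have "\<bar>w x\<bar> \<le> \<bar>g x - P 0 0 x\<bar> + \<bar>P 0 0 x - ?R x\<bar>" unfolding w_def by simp
    also have "\<dots> \<le> (E + \<delta>) + (2 * \<Lambda> * (E + \<delta>) - 2 * (E + \<delta>))"
      using P(2) x by (intro add_mono stable[OF P(1)]) auto
    also have "\<dots> \<le> 2 * \<Lambda> * (E + \<delta>)" using E0 \<delta> by simp
    also have "\<dots> = 2 * \<Lambda> * E + e" using L1 by (simp add: \<delta>_def ring_distribs)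
    finally show "\<bar>w x\<bar> \<le> 2 * \<Lambda> * E + e" .
  qed
  have Kb: "K \<in> sets borel" using K(1) by (rule borel_compact)
  note [measurable] = Kb
  show "L2_norm K w \<le> 2 * sqrt pi * C1 * \<Lambda> * h * d ^ m * H"
  proof (rule L2_norm_le[OF Kb])
    show "0 \<le> 2 * sqrt pi * C1 * \<Lambda> * h * d ^ m * H" using C10 L1 h0 d0 H0 by simp
    obtain x0 where x0: "x0 \<in> K" using K(2) by auto
    \<comment> \<open>The area of \<open>K\<close> is thus at most \<open>pi * h\<^sup>2\<close>,
      which supplies the factor \<open>h\<close> and the constant \<open>sqrt pi\<close>.\<close>
    have sub: "K \<subseteq> cball x0 h"
    proof
      fix x assume "x \<in> K"
      from diameter_bounded_bound[OF compact_imp_bounded[OF K(1)] x0 this] show "x \<in> cball x0 h" by (simp add: h_def)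
    qed
    have "(\<integral>\<^sup>+x. ennreal ((norm (w x))\<^sup>2) * indicator K x \<partial>lebesgue) \<le> (\<integral>\<^sup>+x. ennreal ((2 * \<Lambda> * E)\<^sup>2) * indicator (cball x0 h) x \<partial>lebesgue)"
    proof (rule nn_integral_mono)
      fix x
      show "ennreal ((norm (w x))\<^sup>2) * indicator K x \<le> ennreal ((2 * \<Lambda> * E)\<^sup>2) * indicator (cball x0 h) x"
      proof (cases "x \<in> K")
        case True
        then have x: "x \<in> S" "x \<in> cball x0 h" using K(3) sub by blast+
        have "(norm (w x))\<^sup>2 \<le> (2 * \<Lambda> * E)\<^sup>2" using wE[OF x(1)] by (intro power_mono) auto
        from ennreal_leI[OF this] show ?thesis using True x(2) by simp
      qed simp
    qed
    also have "\<dots> = ennreal ((2 * \<Lambda> * E)\<^sup>2) * emeasure lborel (cball x0 h)"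
      unfolding nn_integral_completion by (rule nn_integral_cmult_indicator) simp
    also have "\<dots> = ennreal ((2 * \<Lambda> * E)\<^sup>2 * (pi * h\<^sup>2))"
      using h0 by (subst emeasure_cball_2) (simp_all add: ennreal_mult)
    also have "(2 * \<Lambda> * E)\<^sup>2 * (pi * h\<^sup>2) = (2 * sqrt pi * C1 * \<Lambda> * h * d ^ m * H)\<^sup>2"
      unfolding E_def power_mult_distrib by (simp add: mult_ac)
    finally show "(\<integral>\<^sup>+x. ennreal ((norm (w x))\<^sup>2) * indicator K x \<partial>lebesgue) \<le> ennreal ((2 * sqrt pi * C1 * \<Lambda> * h * d ^ m * H)\<^sup>2)" .
  qed
  define Q where "Q = b * d ^ (2*m) * H\<^sup>2"
  have Q0: "Q \<ge> 0" using b0 d0 by (simp add: Q_def)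
  \<comment> \<open>The right-hand side as a continuous function of the accuracy, with no trace of
    \<open>U\<close> and \<open>P\<close>.\<close>
  define f where "f \<delta> = 3 * (2 * \<delta> + Q + real N * (2 * pi * s\<^sup>2 * C\<^sup>2 * (2 * \<Lambda> * (E + \<delta>))\<^sup>2))" for \<delta>
  let ?X = "\<integral>\<^sup>+x. ennreal ((V1 x)\<^sup>2 + (V2 x)\<^sup>2) * indicator (K \<inter> ?D) x \<partial>lebesgue"
  have bound: "?X \<le> ennreal (f \<delta>)" if \<delta>: "\<delta> > 0" for \<delta>
  proof -
    obtain U P where U: "jet U" and P: "jet P" "P 0 0 \<in> polys m" and gP: "\<forall>x\<in>S. \<bar>g x - P 0 0 x\<bar> \<le> E + \<delta>"
      and UP: "sq_integral S (\<lambda>x. U 1 0 x - P 1 0 x) + sq_integral S (\<lambda>x. U 0 1 x - P 0 1 x) \<le> ennreal Q"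
      and Uv: "(\<integral>\<^sup>+x. ennreal ((U 1 0 x - v1 x)\<^sup>2) * indicator ?D x \<partial>lebesgue) \<le> ennreal \<delta>"
        "(\<integral>\<^sup>+x. ennreal ((U 0 1 x - v2 x)\<^sup>2) * indicator ?D x \<partial>lebesgue) \<le> ennreal \<delta>"
      using approx[OF \<delta>] unfolding Q_def by (elim exE conjE)
    define q1 where "q1 x = P 1 0 x - R1 x" for x
    define q2 where "q2 x = P 0 1 x - R2 x" for x
    have cq: "continuous_on UNIV q1" "continuous_on UNIV q2"
      unfolding q1_def q2_def
      by (intro continuous_on_diff jet_continuous P(1) polys_continuous[OF R1] polys_continuous[OF R2])+
    define q where "q x = P 0 0 x - ?R x" for x
    have q: "q \<in> polys m" unfolding q_def by (rule polys_diff[OF P(2) Rp])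
    have dq: "(q has_derivative (\<lambda>h. q1 x * h$1 + q2 x * h$2)) (at x)" for x
      unfolding q_def q1_def q2_def
      by (rule has_derivative_eq_rhs[OF has_derivative_diff[OF jetD[OF P(1)] spec[OF dR]]]) (auto simp: algebra_simps)
    define M where "M = 2 * \<Lambda> * (E + \<delta>)"
    have M0: "M \<ge> 0" using L1 E0 \<delta> by (simp add: M_def)
    have qM: "\<bar>q x\<bar> \<le> M" if "x \<in> \<Union>F" for x
    proof -
      have x: "x \<in> S" using that K(3,4) by blast
      have "\<bar>q x\<bar> \<le> 2 * \<Lambda> * (E + \<delta>) - 2 * (E + \<delta>)" unfolding q_def using gP by (intro stable[OF P(2) _ x]) auto
      also have "\<dots> \<le> M" unfolding M_def using E0 \<delta> by simp
      finally show ?thesis .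
    qed
    have Cq: "\<bar>a\<bar> \<le> C * M / \<rho> \<and> \<bar>b\<bar> \<le> C * M / \<rho>"
      if "\<rho> > 0" "\<forall>x\<in>cball z \<rho>. \<bar>q x\<bar> \<le> M" "y \<in> cball z (s * \<rho>)" "(q has_derivative (\<lambda>h. a * h$1 + b * h$2)) (at y)" for z \<rho> M y a b
      using bspec[OF C q] that by (elim allE[of _ z] allE[of _ \<rho>] allE[of _ M] allE[of _ y] allE[of _ a] allE[of _ b] impE) (intro conjI)
    have qint: "(\<integral>\<^sup>+x. ennreal ((q1 x)\<^sup>2 + (q2 x)\<^sup>2) * indicator K x \<partial>lborel) \<le> ennreal (real N * (2 * pi * s\<^sup>2 * C\<^sup>2 * M\<^sup>2))"
      unfolding K(4) by (rule gradient_square_integral_on_triangles[OF q dq cq F T Cq C0 s qM M0])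
    note [measurable] = jet_measurable[OF U] jet_measurable[OF P(1)]
      borel_measurable_continuous_onI[OF cq(1)] borel_measurable_continuous_onI[OF cq(2)]
    have SLb: "S \<in> sets borel" using cS by (rule borel_compact)
    note [measurable] = SLb
    define A where "A x = ennreal ((U 1 0 x - v1 x)\<^sup>2) * indicator ?D x + ennreal ((U 0 1 x - v2 x)\<^sup>2) * indicator ?D x" for x
    define B where "B x = ennreal ((U 1 0 x - P 1 0 x)\<^sup>2) * indicator S x + ennreal ((U 0 1 x - P 0 1 x)\<^sup>2) * indicator S x" for x
    define G where "G x = ennreal ((q1 x)\<^sup>2 + (q2 x)\<^sup>2) * indicator K x" for x
    \<comment> \<open>Weak derivatives are measurable only on the interior; extension by zero gives
      measurability on the plane without changing the product.\<close>
    have mv: "(\<lambda>x. ennreal ((U i j x - v x)\<^sup>2) * indicator ?D x) \<in> borel_measurable lebesgue" if "v \<in> L2 ?D" for i j v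
    proof -
      have "v \<in> borel_measurable (lebesgue_on ?D)" using that by (simp add: L2_def)
      then have vm: "(\<lambda>x. if x \<in> ?D then v x else 0) \<in> borel_measurable lebesgue"
        using Db(1) by (simp add: borel_measurable_if)
      have Um: "U i j \<in> borel_measurable lebesgue" by (rule measurable_completion) simp
      have "(\<lambda>x. ennreal ((U i j x - (if x \<in> ?D then v x else 0))\<^sup>2) * indicator ?D x) \<in> borel_measurable lebesgue"
        using Db(1)
        by (intro borel_measurable_times_ennreal measurable_compose[OF _ measurable_ennreal]
            borel_measurable_power borel_measurable_diff Um vm borel_measurable_indicator) simp
      also have "(\<lambda>x. ennreal ((U i j x - (if x \<in> ?D then v x else 0))\<^sup>2) * indicator ?D x)
          = (\<lambda>x. ennreal ((U i j x - v x)\<^sup>2) * indicator ?D x)"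
        by (auto simp: fun_eq_iff indicator_def)
      finally show ?thesis .
    qed
    have vL: "v1 \<in> L2 ?D" "v2 \<in> L2 ?D" using v1 v2 by (simp_all add: has_weak_deriv_def)
    have mA: "A \<in> borel_measurable lebesgue" unfolding A_def by (intro borel_measurable_add mv vL)
    have mBl: "B \<in> borel_measurable lborel" unfolding B_def by measurable
    have mGl: "G \<in> borel_measurable lborel" unfolding G_def by measurable
    note mB = measurable_completion[OF mBl] and mG = measurable_completion[OF mGl]
    have "?X \<le> (\<integral>\<^sup>+x. 3 * A x + (3 * B x + 3 * G x) \<partial>lebesgue)"
    proof (rule nn_integral_mono)
      fix x
      show "ennreal ((V1 x)\<^sup>2 + (V2 x)\<^sup>2) * indicator (K \<inter> ?D) x \<le> 3 * A x + (3 * B x + 3 * G x)"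
      proof (cases "x \<in> K \<inter> ?D")
        case True
        then have x: "x \<in> K" "x \<in> ?D" "x \<in> S" using K(3) by auto
        \<comment> \<open>Smoothing error, Bramble-Hilbert error and gradient of the polynomial
          part; the sum telescopes since \<open>v1\<close> is \<open>V1\<close> plus the derivative
          of the reconstruction.\<close>
        have "V1 x = (v1 x - U 1 0 x) + (U 1 0 x - P 1 0 x) + q1 x" "V2 x = (v2 x - U 0 1 x) + (U 0 1 x - P 0 1 x) + q2 x"
          by (simp_all add: v1_def v2_def q1_def q2_def)
        then have "(V1 x)\<^sup>2 \<le> 3 * (v1 x - U 1 0 x)\<^sup>2 + 3 * (U 1 0 x - P 1 0 x)\<^sup>2 + 3 * (q1 x)\<^sup>2"
          "(V2 x)\<^sup>2 \<le> 3 * (v2 x - U 0 1 x)\<^sup>2 + 3 * (U 0 1 x - P 0 1 x)\<^sup>2 + 3 * (q2 x)\<^sup>2"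
          by (simp_all only: three_square_sum)
        then have "(V1 x)\<^sup>2 + (V2 x)\<^sup>2 \<le> 3 * ((U 1 0 x - v1 x)\<^sup>2 + (U 0 1 x - v2 x)\<^sup>2)
            + (3 * ((U 1 0 x - P 1 0 x)\<^sup>2 + (U 0 1 x - P 0 1 x)\<^sup>2) + 3 * ((q1 x)\<^sup>2 + (q2 x)\<^sup>2))"
          by (simp add: power2_commute[of "v1 x"] power2_commute[of "v2 x"])
        then have "ennreal ((V1 x)\<^sup>2 + (V2 x)\<^sup>2) \<le> ennreal (3 * ((U 1 0 x - v1 x)\<^sup>2 + (U 0 1 x - v2 x)\<^sup>2)
            + (3 * ((U 1 0 x - P 1 0 x)\<^sup>2 + (U 0 1 x - P 0 1 x)\<^sup>2) + 3 * ((q1 x)\<^sup>2 + (q2 x)\<^sup>2)))"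
          by (rule ennreal_leI)
        also have "\<dots> = 3 * (ennreal ((U 1 0 x - v1 x)\<^sup>2) + ennreal ((U 0 1 x - v2 x)\<^sup>2))
            + (3 * (ennreal ((U 1 0 x - P 1 0 x)\<^sup>2) + ennreal ((U 0 1 x - P 0 1 x)\<^sup>2)) + 3 * ennreal ((q1 x)\<^sup>2 + (q2 x)\<^sup>2))"
          by (simp add: ennreal_mult[symmetric] ennreal_plus[symmetric] ennreal_numeral[symmetric] del: ennreal_plus ennreal_numeral)
        finally show ?thesis using x True by (simp add: A_def B_def G_def)
      qed simp
    qed
    also have "\<dots> = 3 * (\<integral>\<^sup>+x. A x \<partial>lebesgue) + (3 * (\<integral>\<^sup>+x. B x \<partial>lebesgue) + 3 * (\<integral>\<^sup>+x. G x \<partial>lebesgue))"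
      using mA mB mG by (simp add: nn_integral_add nn_integral_cmult)
    also have "(\<integral>\<^sup>+x. A x \<partial>lebesgue) = (\<integral>\<^sup>+x. ennreal ((U 1 0 x - v1 x)\<^sup>2) * indicator ?D x \<partial>lebesgue)
        + (\<integral>\<^sup>+x. ennreal ((U 0 1 x - v2 x)\<^sup>2) * indicator ?D x \<partial>lebesgue)"
      unfolding A_def by (rule nn_integral_add) (rule mv, rule vL)+
    also have "(\<integral>\<^sup>+x. B x \<partial>lebesgue) = sq_integral S (\<lambda>x. U 1 0 x - P 1 0 x) + sq_integral S (\<lambda>x. U 0 1 x - P 0 1 x)"
      unfolding nn_integral_completion B_def sq_integral_def by (rule nn_integral_add) measurable
    also have "(\<integral>\<^sup>+x. G x \<partial>lebesgue) = (\<integral>\<^sup>+x. ennreal ((q1 x)\<^sup>2 + (q2 x)\<^sup>2) * indicator K x \<partial>lborel)"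
      unfolding nn_integral_completion G_def ..
    also have "3 * ((\<integral>\<^sup>+x. ennreal ((U 1 0 x - v1 x)\<^sup>2) * indicator ?D x \<partial>lebesgue)
        + (\<integral>\<^sup>+x. ennreal ((U 0 1 x - v2 x)\<^sup>2) * indicator ?D x \<partial>lebesgue))
      + (3 * (sq_integral S (\<lambda>x. U 1 0 x - P 1 0 x) + sq_integral S (\<lambda>x. U 0 1 x - P 0 1 x))
        + 3 * (\<integral>\<^sup>+x. ennreal ((q1 x)\<^sup>2 + (q2 x)\<^sup>2) * indicator K x \<partial>lborel))
      \<le> 3 * (ennreal \<delta> + ennreal \<delta>) + (3 * ennreal Q + 3 * ennreal (real N * (2 * pi * s\<^sup>2 * C\<^sup>2 * M\<^sup>2)))"
      by (intro add_mono mult_left_mono Uv UP qint) auto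
    also have "\<dots> = ennreal (f \<delta>)"
    proof -
      have *: "3 * (ennreal \<delta> + ennreal \<delta>) + (3 * ennreal Q + 3 * ennreal Y) = ennreal (3 * (2 * \<delta> + Q + Y))" if "Y \<ge> 0" for Y
        using that \<delta> Q0
        by (simp add: ennreal_mult[symmetric] ennreal_plus[symmetric] ennreal_numeral[symmetric] del: ennreal_plus ennreal_numeral)
      show ?thesis unfolding f_def M_def[symmetric] by (rule *) simp
    qed
    finally show ?thesis .
  qed
  \<comment> \<open>The left-hand side does not depend on the accuracy, so the limit involves
    numbers only.\<close>
  have X0: "?X \<le> ennreal (f 0)"
  proof (rule tendsto_lowerbound)
    have "(f \<longlongrightarrow> f 0) (at_right 0)"
      unfolding f_def by (intro tendsto_intros)
    then show "((\<lambda>\<delta>. ennreal (f \<delta>)) \<longlongrightarrow> ennreal (f 0)) (at_right 0)" by (rule tendsto_ennrealI)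
    show "\<forall>\<^sub>F \<delta> in at_right 0. ?X \<le> ennreal (f \<delta>)"
      using bound by (intro eventually_at_rightI[of 0 1]) auto
  qed simp
  define C2 where "C2 = sqrt (3 * (b + real N * (8 * pi * s\<^sup>2 * C\<^sup>2 * C1\<^sup>2)))"
  have rad: "3 * (b + real N * (8 * pi * s\<^sup>2 * C\<^sup>2 * C1\<^sup>2)) \<ge> 0" using b0 by simp
  \<comment> \<open>Since \<open>\<Lambda>\<close> is at least 1, its square can be put in front of
    \<open>Q\<close> as well and then factored out.\<close>
  have f0: "f 0 \<le> (C2 * \<Lambda> * d ^ m * H)\<^sup>2"
  proof -
    have "1 * Q \<le> \<Lambda>\<^sup>2 * Q" using L1 Q0 by (intro mult_right_mono) auto
    then have "f 0 \<le> 3 * (\<Lambda>\<^sup>2 * Q + real N * (2 * pi * s\<^sup>2 * C\<^sup>2 * (2 * \<Lambda> * E)\<^sup>2))" by (simp add: f_def)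
    also have "\<dots> = 3 * (b + real N * (8 * pi * s\<^sup>2 * C\<^sup>2 * C1\<^sup>2)) * (\<Lambda>\<^sup>2 * (d ^ m)\<^sup>2 * H\<^sup>2)"
    proof -
      have dm: "d ^ (2 * m) = (d ^ m)\<^sup>2" by (simp add: power_mult[symmetric] mult.commute)
      show ?thesis unfolding Q_def E_def dm by (simp add: power_mult_distrib algebra_simps)
    qed
    also have "\<dots> = (C2 * \<Lambda> * d ^ m * H)\<^sup>2"
      unfolding C2_def power_mult_distrib real_sqrt_pow2[OF rad] by (simp add: mult_ac)
    finally show ?thesis .
  qed
  \<comment> \<open>The weak gradient is an arbitrary function on \<open>K - interior S\<close>, which is a null set.\<close>
  have neg: "AE x in lebesgue. x \<notin> frontier S"
  proof -
    have "negligible (frontier S)"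
      by (rule star_shaped_negligible_frontier[OF star r compact_imp_closed[OF cS]])
    then have "frontier S \<in> null_sets lebesgue" by (simp add: negligible_iff_null_sets)
    then show ?thesis by (rule AE_not_in)
  qed
  have "L2_norm K (weak_gradient ?D w) \<le> C2 * \<Lambda> * d ^ m * H"
  proof (rule L2_norm_le[OF Kb])
    show "0 \<le> C2 * \<Lambda> * d ^ m * H" unfolding C2_def using rad L1 d0 H0 by simp
    have "(\<integral>\<^sup>+x. ennreal ((norm (weak_gradient ?D w x))\<^sup>2) * indicator K x \<partial>lebesgue) = ?X"
    proof (rule nn_integral_cong_AE)
      show "AE x in lebesgue. ennreal ((norm (weak_gradient ?D w x))\<^sup>2) * indicator K x
          = ennreal ((V1 x)\<^sup>2 + (V2 x)\<^sup>2) * indicator (K \<inter> ?D) x"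
        using neg
      proof (rule AE_mp, intro AE_I2 impI)
        fix x assume "x \<notin> frontier S"
        then have "x \<in> K \<longleftrightarrow> x \<in> K \<inter> ?D"
          using K(3) closure_subset[of S] by (auto simp: frontier_def)
        then have "indicator K x = (indicator (K \<inter> ?D) x :: ennreal)" by (simp add: indicator_def)
        moreover have "(norm (weak_gradient ?D w x))\<^sup>2 = (V1 x)\<^sup>2 + (V2 x)\<^sup>2"
          unfolding norm_sq_2 weak_gradient_def V1_def V2_def vector_2 ..
        ultimately show "ennreal ((norm (weak_gradient ?D w x))\<^sup>2) * indicator K x
          = ennreal ((V1 x)\<^sup>2 + (V2 x)\<^sup>2) * indicator (K \<inter> ?D) x" by simp
      qed
    qed
    also note X0
    also have "ennreal (f 0) \<le> ennreal ((C2 * \<Lambda> * d ^ m * H)\<^sup>2)" by (rule ennreal_leI[OF f0])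
    finally show "(\<integral>\<^sup>+x. ennreal ((norm (weak_gradient ?D w x))\<^sup>2) * indicator K x \<partial>lebesgue) \<le> ennreal ((C2 * \<Lambda> * d ^ m * H)\<^sup>2)" .
  qed
  then show "L2_norm K (weak_gradient ?D w) \<le> sqrt (3 * (b + real N * (8 * pi * s\<^sup>2 * C\<^sup>2 * C1\<^sup>2))) * \<Lambda> * d ^ m * H"
    unfolding C2_def .
qed

theorem lemma2p4:
  fixes m N :: nat and \<sigma> \<gamma> :: real
  assumes "m \<ge> 1" and "\<sigma> > 0"
  shows "\<exists>C::real. \<forall>(\<Omega> :: (real^2) set) \<T> \<T>' node patch (r::real) (R::real).
     polygonal_domain \<Omega> \<and> polygonal_mesh \<Omega> \<T> \<and>
     compatible_subdecomposition \<Omega> \<T> \<T>' \<and> cond_A1 N \<T> \<T>' \<and> cond_A2 \<sigma> \<T>' \<and>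
     sampling_nodes \<T> node \<and> element_patches \<T> patch \<and>
     assumption_A r R \<T> patch \<and> \<gamma> = 2 * R / r \<and> assumption_B m \<T> node patch \<longrightarrow>
     (\<forall>K\<in>\<T>. \<forall>g.
        continuous_on (patch_domain patch K) g \<and> g \<in> sobolev (m + 1) (patch_domain patch K) \<longrightarrow>
        (let S = patch_domain patch K;
             Rg = reconstruction m (patch_nodes node patch K) g;
             h = diameter K;
             d = diameter S;
             \<Lambda> = Lambda_mesh m \<T> node patch
         in L2_norm K (\<lambda>x. g x - Rg x) \<le> C * \<Lambda> * h * d ^ m * sobolev_seminorm (m + 1) S g \<and>
            L2_norm K (weak_gradient (interior S) (\<lambda>x. g x - Rg x))
              \<le> C * (h ^ m + \<Lambda> * d ^ m) * sobolev_seminorm (m + 1) S g))"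
proof -
  \<comment> \<open>The enlargement of the inscribed disk supplied by
    \<open>triangle_inscribed_disk\<close>.\<close>
  define s where "s = 2 * \<sigma>"
  have s: "s \<ge> 0" using assms(2) by (simp add: s_def)
  obtain Ci where Ci: "Ci \<ge> 0" "\<forall>q\<in>polys m. \<forall>z \<rho> M y a b. \<rho> > 0 \<and> (\<forall>x\<in>cball z \<rho>. \<bar>q x\<bar> \<le> M) \<and> y \<in> cball z (s * \<rho>)
    \<and> (q has_derivative (\<lambda>h. a * h$1 + b * h$2)) (at y) \<longrightarrow> \<bar>a\<bar> \<le> Ci * M / \<rho> \<and> \<bar>b\<bar> \<le> Ci * M / \<rho>"
    using polys_inverse_estimate[OF s, of m] by (elim exE conjE)
  define b where "b = bh_const m (\<gamma>\<^sup>2 / 4 + 1)"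
  define C1 where "C1 = sqrt (b / pi) * \<gamma>"
  define C2 where "C2 = sqrt (3 * (b + real N * (8 * pi * s\<^sup>2 * Ci\<^sup>2 * C1\<^sup>2)))"
  \<comment> \<open>A maximum of expressions in \<open>N\<close>, \<sigma>, \<gamma> and
    \<open>m\<close>, fixed before any mesh is introduced; \<open>C2\<close> makes it
    nonnegative.\<close>
  define C where "C = max (2 * sqrt pi * C1) C2"
  have b0: "b \<ge> 0" unfolding b_def by (rule bh_const_nonneg) simp
  have C2: "C2 \<ge> 0" unfolding C2_def using b0 by simp
  have C: "2 * sqrt pi * C1 \<le> C" "C2 \<le> C" "0 \<le> C" using C2 by (auto simp: C_def)
  have main: "L2_norm K (\<lambda>x. g x - reconstruction m (patch_nodes node patch K) g x)
        \<le> C * Lambda_mesh m \<T> node patch * diameter K * diameter (patch_domain patch K) ^ m * sobolev_seminorm (m + 1) (patch_domain patch K) g \<and>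
      L2_norm K (weak_gradient (interior (patch_domain patch K)) (\<lambda>x. g x - reconstruction m (patch_nodes node patch K) g x))
        \<le> C * (diameter K ^ m + Lambda_mesh m \<T> node patch * diameter (patch_domain patch K) ^ m) * sobolev_seminorm (m + 1) (patch_domain patch K) g"
    if mesh: "polygonal_mesh \<Omega> \<T>" and sub: "compatible_subdecomposition \<Omega> \<T> \<T>'" and A1: "cond_A1 N \<T> \<T>'" and A2: "cond_A2 \<sigma> \<T>'"
      and nodes: "sampling_nodes \<T> node" and patches: "element_patches \<T> patch" and A: "assumption_A r R \<T> patch"
      and \<gamma>: "\<gamma> = 2 * R / r" and B: "assumption_B m \<T> node patch"
      and K: "K \<in> \<T>" and g: "continuous_on (patch_domain patch K) g" "g \<in> sobolev (m + 1) (patch_domain patch K)"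
    for \<Omega> \<T> \<T>' node patch r R K g
  proof -
    let ?S = "patch_domain patch K" and ?I = "patch_nodes node patch K"
    let ?\<Lambda> = "Lambda_mesh m \<T> node patch" and ?H = "sobolev_seminorm (m + 1) (patch_domain patch K) g"
    have pK: "patch K \<subseteq> \<T>" "K \<in> patch K" using patches K by (auto simp: element_patches_def)
    have finT: "finite \<T>" using mesh by (simp add: polygonal_mesh_def)
    have finp: "finite (patch K)" using finite_subset[OF pK(1) finT] .
    have comp: "compact L \<and> L \<noteq> {}" if "L \<in> \<T>" for L
    proof -
      have "closed_polygon L" using mesh that by (simp add: polygonal_mesh_def)
      then obtain E where E: "polygonal_domain E" "L = closure E"
        unfolding closed_polygon_def by (elim exE conjE)
      then have "bounded E" "E \<noteq> {}" by (simp_all add: polygonal_domain_def)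
      then show ?thesis using E(2) by (simp add: compact_closure)
    qed
    have S: "compact ?S" unfolding patch_domain_def using pK(1) comp by (intro compact_Union finp) auto
    have r: "r > 0" using A by (simp add: assumption_A_def)
    have "\<forall>K\<in>\<T>. \<exists>c c'. cball c r \<subseteq> patch_domain patch K \<and> patch_domain patch K \<subseteq> cball c' R \<and>
        star_shaped_wrt (patch_domain patch K) (cball c r)"
      using A unfolding assumption_A_def by (elim conjE)
    from bspec[OF this K] obtain c c' where BS: "cball c r \<subseteq> ?S" and SR: "?S \<subseteq> cball c' R"
      and star: "star_shaped_wrt ?S (cball c r)" by (elim exE conjE)
    have ss: "star_shaped ?S c r" using S r star by (rule star_shaped.intro)
    have I: "finite ?I" "?I \<noteq> {}" "?I \<subseteq> ?S"
      unfolding patch_nodes_def patch_domain_def using finp pK nodes by (auto simp: sampling_nodes_def)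
    have uni: "\<forall>x\<in>?S. p x = 0" if "p \<in> polys m" "\<forall>x\<in>?I. p x = 0" for p
      using bspec[OF bspec[OF B[unfolded assumption_B_def] K] that(1)] that(2) by (rule mp)
    have rp: "reconstruction_patch ?S ?I m"
      by (rule reconstruction_patch.intro[OF S star_shaped_closure_interior[OF star r] I]) (rule uni)
    have L: "1 + Lambda_nodes m ?I ?S * sqrt (card ?I) \<le> ?\<Lambda>"
      unfolding Lambda_mesh_def using finT K by (intro Max_ge) auto
    obtain F where F: "F \<subseteq> \<T>'" "card F \<le> N" "K = \<Union>F"
      using bspec[OF A1[unfolded cond_A1_def] K] by (elim exE conjE)
    have finT': "finite \<T>'" using sub by (simp add: compatible_subdecomposition_def triangulation_def)
    have finF: "finite F" using finite_subset[OF F(1) finT'] .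
    have T: "compact T \<and> (\<exists>z \<rho>. \<rho> > 0 \<and> cball z \<rho> \<subseteq> T \<and> T \<subseteq> cball z (s * \<rho>))" if "T \<in> F" for T
    proof -
      have "T \<in> \<T>'" using F(1) that by blast
      then have "2 simplex T" "diameter T / inradius T \<le> \<sigma>"
        using sub A2 by (auto simp: compatible_subdecomposition_def cond_A2_def)
      from triangle_inscribed_disk[OF this assms(2)] show ?thesis unfolding s_def .
    qed
    have KS: "K \<subseteq> ?S" unfolding patch_domain_def using pK(2) by blast
    note pe = patch_estimate[OF ss rp BS SR \<gamma> assms(1) g L conjunct1[OF comp[OF K]] conjunct2[OF comp[OF K]]
        KS F(3) finF F(2) T s Ci]
    have est1: "L2_norm K (\<lambda>x. g x - reconstruction m ?I g x) \<le> 2 * sqrt pi * C1 * ?\<Lambda> * diameter K * diameter ?S ^ m * ?H"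
      unfolding C1_def b_def by (rule pe(1))
    have est2: "L2_norm K (weak_gradient (interior ?S) (\<lambda>x. g x - reconstruction m ?I g x)) \<le> C2 * ?\<Lambda> * diameter ?S ^ m * ?H"
      unfolding C2_def C1_def b_def by (rule pe(2))
    have H0: "0 \<le> ?H" by (rule sobolev_seminorm_nonneg)
    have h0: "0 \<le> diameter K" using comp[OF K] by (intro diameter_ge_0 compact_imp_bounded) simp
    have d0: "0 \<le> diameter ?S" using S by (intro diameter_ge_0 compact_imp_bounded)
    have L0: "0 \<le> ?\<Lambda>"
    proof -
      interpret reconstruction_patch ?S ?I m by (rule rp)
      have "0 \<le> Lambda_nodes m ?I ?S * sqrt (card ?I)" by (intro mult_nonneg_nonneg Lambda_nodes_bound(1)) simp
      then show ?thesis using L by linarith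
    qed
    have "2 * sqrt pi * C1 * ?\<Lambda> * diameter K * diameter ?S ^ m * ?H \<le> C * ?\<Lambda> * diameter K * diameter ?S ^ m * ?H"
      using C(1) L0 h0 d0 H0 by (intro mult_right_mono) auto
    \<comment> \<open>The patch estimate bounds the gradient by the \<open>\<Lambda>\<close> term;
      the other summand on the right is nonnegative.\<close>
    moreover have "C2 * ?\<Lambda> * diameter ?S ^ m * ?H \<le> C * (diameter K ^ m + ?\<Lambda> * diameter ?S ^ m) * ?H"
    proof -
      have "C2 * (?\<Lambda> * diameter ?S ^ m) \<le> C * (diameter K ^ m + ?\<Lambda> * diameter ?S ^ m)"
        using C L0 h0 d0 by (intro mult_mono) auto
      from mult_right_mono[OF this H0] show ?thesis by (simp add: mult.assoc)
    qed
    ultimately show ?thesis by (intro conjI order_trans[OF est1] order_trans[OF est2])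
  qed
  show ?thesis
    unfolding Let_def by (intro exI[of _ C] allI impI ballI, elim conjE) (rule main)
qed

end
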